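(* Let $f(\tau)=\prod_{n\mid N}\eta(n\tau)^{r_n}=\sum_n c_f(n)q^n$ be a weakly admissible eta-quotient of level $N$ and weight $k=\frac12\sum_n r_n$, and put $\mathbf r=(r_n)_{n\mid N}$, $x_N=\sum_{n\mid N}nr_n$, $\varpi=\prod_{n\mid N}(N/n)^{|r_n|}$. Then for every $l\in L_f$ there exists a unique $c_l\in\mathbb{C}$ such that $$l^{-\frac k2}\sum_{\substack{a\mid l,\ d=l/a\\(a,N)=1}}\Big(\frac a\varpi\Big)a^kc_f\Big(\frac{ln}{a^2}\Big)\sum_{\substack{0\le b<d\\(a,b,d)=1}}\Big(\frac{-Nb}{(a,d)}\Big)^{2k}e\Big(bd\Big(\frac nl-\frac{x_N}{24}\Big)\Big)\psi_{l,\mathbf r}(a,b)=c_l\cdot c_f(n)$$ for all $n\in\frac{x_N}{24}+\mathbb{Z}$ (with $c_f(\frac{ln}{a^2})=0$ if $\frac{ln}{a^2}\notin\frac{x_N}{24}+\mathbb{Z}$). Moreover, $c_l$ equals the left-hand side with $n=\frac{x_N}{24}$.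
   Context: $e(x)=\exp(2\pi ix)$, $q=e(\tau)$, $\eta(\tau)=q^{1/24}\prod(1-q^n)$, $r_n\in\mathbb{Z}$, level $N=\operatorname{lcm}\{n:r_n\ne0\}$. $\widetilde{\Gamma_0(N)}$: pairs $(\gamma,\varepsilon(c\tau+d)^{1/2})$, $\gamma=\begin{pmatrix}a&b\\c&d\end{pmatrix}\in\Gamma_0(N)$, $\varepsilon=\pm1$, principal square root, product $(\gamma_1,\phi_1)(\gamma_2,\phi_2)=(\gamma_1\gamma_2,\phi_1(\gamma_2\tau)\phi_2(\tau))$; $\widetilde\gamma=(\gamma,(c\tau+d)^{1/2})$; $(g|_k(\gamma,\phi))(\tau)=\phi(\tau)^{-2k}g(\gamma\tau)$. Character of $f$: $\chi(\gamma,\varepsilon(c\tau+d)^{1/2})=\varepsilon^{-2k}e(\frac1{24}\sum r_n\Psi\begin{pmatrix}a&bn\\c/n&d\end{pmatrix})$, $\Psi\begin{pmatrix}a&b\\c&d\end{pmatrix}=\frac{a+d}c+12s(-d,c)-3$ ($c>0$), $\frac{a+d}c+12s(d,-c)+3$ ($c<0$), $b$ ($c=0,a>0$), $-b-6$ ($c=0,a<0$); $s(h,c)=\sum_{r\bmod c}((r/c))((hr/c))$. $M_k$, $S_k$: holomorphic $g$ with $g|_k\gamma=\chi(\gamma)g$ on $\widetilde{\Gamma_0(N)}$, with all $g|_k\widetilde\gamma$ ($\gamma\in\mathrm{SL}_2(\mathbb{Z})$) having $q$-expansions $\sum_{n\in\frac1h\mathbb{Z}}c_nq^n$ with $c_n=0$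 for $n<0$ (resp. $n\le 0$). Weakly admissible: $f\in M_k(\Gamma_0(N),\chi)$ and either $\dim M_k(\Gamma_0(N),\chi)=1$, or $\dim M_k\ge2$, $\dim S_k(\Gamma_0(N),\chi)=1$ and $f$ is a cusp form. $m_f=24/\gcd(24,\sum(N/n)r_n,\sum nr_n)$; $L_f=\{l\ge1:l\equiv1\bmod m_f\}$ if $k\in\mathbb{Z}$, and additionally $l$ a perfect square if $k\in\frac12+\mathbb{Z}$. With $d=l/a$: $\psi_{l,\mathbf r}(a,b)=e(-\frac{k+\delta}4(d-1)+\frac{(k+\delta)(l-1)(N-1)}4)$ if $2\nmid l$; $e(-\frac{k+\delta}4(a-1)-\frac{N(k+\delta)(1+\delta_1)}4b)$ if $2\mid l,2\mid N$; $1$ if $2\mid l,2\nmid N$; $\delta=0$ (resp. $1$) if $\varpi=2^\alpha(4m+1)$ (resp. $2^\alpha(4m+3)$); $\delta_1=1$ if $2\mid l$, $4\mid N$, $k\in\frac12+\mathbb{Z}$, $v_2(\varpi)$ odd, else $0$. $(\frac mn)$: Kronecker–Jacobi symbol with $(\frac m0)=0$ for $m\ne\pm1$, $(\frac{\pm1}0)=1$. $c_f(n)$: coefficients of $f=\sum_{n\in\frac{x_N}{24}+\mathbb{Z}_{\ge0}}c_f(n)q^n$. *)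

theory Defs
  imports "HOL-Analysis.Analysis" "HOL-Number_Theory.Number_Theory"
begin

definition ee :: "real \<Rightarrow> complex" where
  "ee x = exp (2 * pi * \<i> * complex_of_real x)"

definition HH :: "complex set" where
  "HH = {z. Im z > 0}"

definition eta :: "complex \<Rightarrow> complex" where
  "eta \<tau> = exp (2 * pi * \<i> * \<tau> / 24) *
            (\<Prod>n. (1 - exp (2 * pi * \<i> * of_nat (Suc n) * \<tau>)))"

definition supp :: "(nat \<Rightarrow> int) \<Rightarrow> nat set" where
  "supp r = {n. r n \<noteq> 0}"

definition level :: "(nat \<Rightarrow> int) \<Rightarrow> nat" where
  "level r = Lcm (supp r)"

definition eta_quot :: "(nat \<Rightarrow> int) \<Rightarrow> complex \<Rightarrow> complex" where
  "eta_quot r \<tau> = (\<Prod>n\<in>supp r. eta (of_nat n * \<tau>) powi r n)"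

definition wt2 :: "(nat \<Rightarrow> int) \<Rightarrow> int" where
  "wt2 r = (\<Sum>n\<in>supp r. r n)"

definition wt :: "(nat \<Rightarrow> int) \<Rightarrow> real" where
  "wt r = real_of_int (wt2 r) / 2"

definition xN :: "(nat \<Rightarrow> int) \<Rightarrow> int" where
  "xN r = (\<Sum>n\<in>supp r. int n * r n)"

definition varpi :: "(nat \<Rightarrow> int) \<Rightarrow> int" where
  "varpi r = (\<Prod>n\<in>supp r. int (level r div n) ^ nat \<bar>r n\<bar>)"

text \<open>Coefficients c_f(x) of f = sum c_f(x) q^x (x in x_N/24 + Z), extracted as Fourier
  coefficients of the 1-periodic function f(tau) e(-x tau) on the line Im tau = 1;
  c_f(x) = 0 for x not in x_N/24 + Z.\<close>
definition cf :: "(nat \<Rightarrow> int) \<Rightarrow> real \<Rightarrow> complex" where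
  "cf r x = (if (\<exists>m::int. x = real_of_int (xN r) / 24 + real_of_int m)
     then integral {0..1} (\<lambda>t::real. eta_quot r (complex_of_real t + \<i>) *
            exp (- 2 * pi * \<i> * complex_of_real x * (complex_of_real t + \<i>)))
     else 0)"

definition saw :: "real \<Rightarrow> real" where
  "saw x = (if x \<in> \<int> then 0 else x - of_int \<lfloor>x\<rfloor> - 1/2)"

definition dsum :: "int \<Rightarrow> int \<Rightarrow> real" where
  "dsum h c = (\<Sum>x\<in>{0..<c}. saw (of_int x / of_int c) * saw (of_int (h * x) / of_int c))"

definition Psi :: "int \<Rightarrow> int \<Rightarrow> int \<Rightarrow> int \<Rightarrow> real" where
  "Psi a b c d =
    (if c > 0 then of_int (a + d) / of_int c + 12 * dsum (- d) c - 3
     else if c < 0 then of_int (a + d) / of_int c + 12 * dsum d (- c) + 3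
     else if a > 0 then of_int b
     else - of_int b - 6)"

text \<open>chi((a,b;c,d), eps (c tau + d)^(1/2))\<close>
definition chi :: "(nat \<Rightarrow> int) \<Rightarrow> int \<Rightarrow> int \<Rightarrow> int \<Rightarrow> int \<Rightarrow> complex \<Rightarrow> complex" where
  "chi r a b c d \<epsilon> = \<epsilon> powi (- wt2 r) *
      ee ((1/24) * (\<Sum>n\<in>supp r. of_int (r n) * Psi a (b * int n) (c div int n) d))"

text \<open>(g |_k (gamma, eps (c tau + d)^(1/2)))(tau), principal square root csqrt\<close>
definition slash :: "(nat \<Rightarrow> int) \<Rightarrow> (complex \<Rightarrow> complex) \<Rightarrow> int \<Rightarrow> int \<Rightarrow> int \<Rightarrow> int
                     \<Rightarrow> complex \<Rightarrow> complex \<Rightarrow> complex" where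
  "slash r g a b c d \<epsilon> \<tau> =
     (\<epsilon> * csqrt (of_int c * \<tau> + of_int d)) powi (- wt2 r) *
     g ((of_int a * \<tau> + of_int b) / (of_int c * \<tau> + of_int d))"

definition transforms :: "(nat \<Rightarrow> int) \<Rightarrow> (complex \<Rightarrow> complex) \<Rightarrow> bool" where
  "transforms r g \<longleftrightarrow>
     (\<forall>a b c d \<epsilon>. a * d - b * c = 1 \<and> int (level r) dvd c \<and> (\<epsilon> = 1 \<or> \<epsilon> = -1) \<longrightarrow>
        (\<forall>\<tau>\<in>HH. slash r g a b c d \<epsilon> \<tau> = chi r a b c d \<epsilon> * g \<tau>))"

definition cusp_expansions :: "bool \<Rightarrow> (nat \<Rightarrow> int) \<Rightarrow> (complex \<Rightarrow> complex) \<Rightarrow> bool" where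
  "cusp_expansions strict r g \<longleftrightarrow>
     (\<forall>a b c d. a * d - b * c = 1 \<longrightarrow>
        (\<exists>h::nat. h > 0 \<and> (\<exists>co::nat \<Rightarrow> complex. (strict \<longrightarrow> co 0 = 0) \<and>
           (\<forall>\<tau>\<in>HH. (\<lambda>m. co m * exp (2 * pi * \<i> * of_nat m * \<tau> / of_nat h))
                        sums slash r g a b c d 1 \<tau>))))"

definition MF :: "(nat \<Rightarrow> int) \<Rightarrow> (complex \<Rightarrow> complex) \<Rightarrow> bool" where
  "MF r g \<longleftrightarrow> g holomorphic_on HH \<and> transforms r g \<and> cusp_expansions False r g"

definition SF :: "(nat \<Rightarrow> int) \<Rightarrow> (complex \<Rightarrow> complex) \<Rightarrow> bool" where
  "SF r g \<longleftrightarrow> g holomorphic_on HH \<and> transforms r g \<and> cusp_expansions True r g"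

definition dim_eq_1 :: "((complex \<Rightarrow> complex) \<Rightarrow> bool) \<Rightarrow> bool" where
  "dim_eq_1 V \<longleftrightarrow> (\<exists>g. V g \<and> (\<exists>\<tau>\<in>HH. g \<tau> \<noteq> 0) \<and>
                        (\<forall>h. V h \<longrightarrow> (\<exists>c. \<forall>\<tau>\<in>HH. h \<tau> = c * g \<tau>)))"

definition dim_ge_2 :: "((complex \<Rightarrow> complex) \<Rightarrow> bool) \<Rightarrow> bool" where
  "dim_ge_2 V \<longleftrightarrow> (\<exists>g h. V g \<and> V h \<and>
      (\<forall>\<alpha> \<beta>. (\<forall>\<tau>\<in>HH. \<alpha> * g \<tau> + \<beta> * h \<tau> = 0) \<longrightarrow> \<alpha> = 0 \<and> \<beta> = 0))"

definition weakly_admissible :: "(nat \<Rightarrow> int) \<Rightarrow> bool" where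
  "weakly_admissible r \<longleftrightarrow> MF r (eta_quot r) \<and>
     (dim_eq_1 (MF r) \<or> (dim_ge_2 (MF r) \<and> dim_eq_1 (SF r) \<and> SF r (eta_quot r)))"

definition mf :: "(nat \<Rightarrow> int) \<Rightarrow> int" where
  "mf r = 24 div gcd 24 (gcd (\<Sum>n\<in>supp r. int (level r div n) * r n) (xN r))"

definition Lf :: "(nat \<Rightarrow> int) \<Rightarrow> nat set" where
  "Lf r = {l. l \<ge> 1 \<and> [int l = 1] (mod mf r) \<and> (odd (wt2 r) \<longrightarrow> (\<exists>s. l = s\<^sup>2))}"

definition kron2 :: "int \<Rightarrow> int" where
  "kron2 m = (if even m then 0 else if m mod 8 = 1 \<or> m mod 8 = 7 then 1 else -1)"

definition kron_prime :: "int \<Rightarrow> nat \<Rightarrow> int" where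
  "kron_prime m p = (if p = 2 then kron2 m else Legendre m (int p))"

definition kronecker :: "int \<Rightarrow> int \<Rightarrow> int" where
  "kronecker m n =
    (if n = 0 then (if m = 1 \<or> m = -1 then 1 else 0)
     else (if n < 0 \<and> m < 0 then -1 else 1) *
          (\<Prod>p\<in>prime_factors (nat \<bar>n\<bar>). kron_prime m p ^ multiplicity p (nat \<bar>n\<bar>)))"

definition delta :: "(nat \<Rightarrow> int) \<Rightarrow> real" where
  "delta r = (let w = varpi r div 2 ^ multiplicity 2 (varpi r) in
              if w mod 4 = 1 then 0 else 1)"

definition delta1 :: "(nat \<Rightarrow> int) \<Rightarrow> nat \<Rightarrow> real" where
  "delta1 r l = (if even l \<and> 4 dvd level r \<and> odd (wt2 r) \<and> odd (multiplicity 2 (varpi r))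
                 then 1 else 0)"

definition psi :: "(nat \<Rightarrow> int) \<Rightarrow> nat \<Rightarrow> nat \<Rightarrow> nat \<Rightarrow> complex" where
  "psi r l a b =
    (let d = l div a; kd = wt r + delta r; N = level r in
     if odd l then ee (- kd / 4 * (real d - 1) + kd * (real l - 1) * (real N - 1) / 4)
     else if even N then ee (- kd / 4 * (real a - 1) - real N * kd * (1 + delta1 r l) / 4 * real b)
     else 1)"

definition hecke_lhs :: "(nat \<Rightarrow> int) \<Rightarrow> nat \<Rightarrow> real \<Rightarrow> complex" where
  "hecke_lhs r l n =
     complex_of_real (real l powr (- wt r / 2)) *
     (\<Sum>a\<in>{a. a dvd l \<and> coprime a (level r)}.
        (let d = l div a in
         of_int (kronecker (int a) (varpi r)) * complex_of_real (real a powr wt r) *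
         cf r (real l * n / (real a)\<^sup>2) *
         (\<Sum>b\<in>{b. b < d \<and> gcd (gcd a b) d = 1}.
            of_int (kronecker (- int (level r) * int b) (int (gcd a d))) powi wt2 r *
            ee (real b * real d * (n / real l - real_of_int (xN r) / 24)) *
            psi r l a b)))"

end

theory Submission
  imports Defs "HOL-Complex_Analysis.Complex_Analysis" "HOL-Computational_Algebra.Nth_Powers"
begin

text \<open>Write \<open>f\<close> for the eta-quotient. The left-hand side of the identity is, up to the factor
  $l^{k/2}$, the $n$-th coefficient of $g(\tau) = \sum_{(a,b)} w(a,b)\, d^{-k} f((a\tau+b)/d)$,
  where $w(a,b)$ collects the Kronecker symbols and roots of unity. By weak admissibility $f$ spans
  either the space of modular forms or that of cusp forms for its character. If $g$ lies in that
  space it is a multiple of $f$, whose leading coefficient is 1.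

  Since $f$ has no zeros, the transformation law of $g$ says that the weight-0 functions
  $w(a,b)\, d^{-k} f((a\tau+b)/d) / f(\tau)$ are permuted by $\Gamma_0(N)$. The matrices
  $(a, b; 0, d)$ represent the left cosets in one double coset, hence only two facts are needed:
  the function belonging to $(1, 0; 0, l)$ is fixed by its stabilizer, and every other one arises
  from it by a single suitable element. Both are identities for the character, which Dedekind
  reciprocity and quadratic reciprocity turn into Petersson's formula. There they become congruences
  modulo 24, checked modulo 3 and 8: a prime dividing both $l$ and 24 makes $\sum n r_n$ and
  $\sum (N/n) r_n$ vanish modulo its part of 24, and for the others the element in the second fact
  can be chosen such that most terms are trivial.\<close>
section \<open>The Kronecker symbol\<close>

lemma kronecker_conv_prod_mset:
  assumes "n > 0"
  shows "kronecker m (int n) = prod_mset (image_mset (kron_prime m) (prime_factorization n))"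
proof -
  have "prod_mset (image_mset (kron_prime m) (prime_factorization n))
      = (\<Prod>p\<in>prime_factors n. kron_prime m p ^ count (prime_factorization n) p)"
    by (rule image_prod_mset_multiplicity)
  also have "\<dots> = (\<Prod>p\<in>prime_factors n. kron_prime m p ^ multiplicity p n)"
    by (intro prod.cong) (auto simp: count_prime_factorization)
  finally show ?thesis using assms by (simp add: kronecker_def)
qed

lemma kronecker_1_right [simp]: "kronecker m 1 = 1"
  using kronecker_conv_prod_mset[of 1 m] by simp

lemma kronecker_prime:
  assumes "prime p"
  shows "kronecker m (int p) = kron_prime m p"
  using kronecker_conv_prod_mset[of p m] assms
  by (simp add: prime_gt_0_nat prime_factorization_prime)

lemma kronecker_mult_right:
  assumes "n1 > 0" "n2 > 0"
  shows "kronecker m (n1 * n2) = kronecker m n1 * kronecker m n2"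
proof -
  obtain k1 k2 where k: "n1 = int k1" "n2 = int k2" "k1 > 0" "k2 > 0"
    using assms by (metis zero_less_imp_eq_int)
  have "kronecker m (n1 * n2) = kronecker m (int (k1 * k2))" by (simp add: k)
  also have "\<dots> = kronecker m (int k1) * kronecker m (int k2)"
    using k by (subst (1 2 3) kronecker_conv_prod_mset) (auto simp: prime_factorization_mult)
  finally show ?thesis by (simp add: k)
qed

lemma int_prime_factor_induct [consumes 1, case_names one step]:
  assumes "n > (0::int)"
    and "P 1"
    and "\<And>p m. prime p \<Longrightarrow> m > 0 \<Longrightarrow> int p dvd n \<Longrightarrow> m dvd n \<Longrightarrow> P m \<Longrightarrow> P (int p * m)"
  shows "P n"
proof -
  have "m dvd nat n \<Longrightarrow> m > 0 \<Longrightarrow> P (int m)" for m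
  proof (induction m rule: prime_divisors_induct)
    case (factor p x)
    have "x > 0" using factor.prems by (cases x) auto
    moreover have "x dvd nat n" using factor.prems(1) by (metis dvd_mult_right)
    moreover have "int p dvd n" "int x dvd n" using factor.prems(1) assms(1)
      by (metis dvd_mult_left dvd_mult_right int_dvd_int_iff nat_0_le less_imp_le)+
    ultimately show ?case using assms(3)[of p "int x"] factor by simp
  qed (use assms in \<open>auto simp: dvd_1_iff_1\<close>)
  from this[of "nat n"] show ?thesis using assms(1) by simp
qed

lemma odd_mod_4_cases: "odd (a::int) \<Longrightarrow> a mod 4 = 1 \<or> a mod 4 = 3"
  by presburger

lemma odd_mod_8_cases: "odd (a::int) \<Longrightarrow> a mod 8 = 1 \<or> a mod 8 = 3 \<or> a mod 8 = 5 \<or> a mod 8 = 7"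
  by presburger

lemma kron2_mult: "kron2 (a * b) = kron2 a * kron2 b"
proof (cases "odd a \<and> odd b")
  case True
  have mult: "a * b mod 8 = x * y mod 8" if "a mod 8 = x" "b mod 8 = y" for x y
    using that by (metis mod_mult_eq)
  from True have "a mod 8 = 1 \<or> a mod 8 = 3 \<or> a mod 8 = 5 \<or> a mod 8 = 7"
    "b mod 8 = 1 \<or> b mod 8 = 3 \<or> b mod 8 = 5 \<or> b mod 8 = 7"
    using odd_mod_8_cases by blast+
  then show ?thesis using True by - (elim disjE; frule (1) mult; simp add: kron2_def)
qed (auto simp: kron2_def)

lemma kron2_diff_2:
  assumes "odd n"
  shows "kron2 n = (if n mod 4 = 1 then 1 else -1) * kron2 (n - 2)"
proof -
  have "(n - 2) mod 8 = 1 \<longleftrightarrow> n mod 8 = 3" "(n - 2) mod 8 = 7 \<longleftrightarrow> n mod 8 = 1"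
    "n mod 4 = 1 \<longleftrightarrow> n mod 8 = 1 \<or> n mod 8 = 5" by presburger+
  then show ?thesis using assms odd_mod_8_cases[OF assms] by (auto simp: kron2_def)
qed

lemma Legendre_values: "Legendre a p \<in> {-1, 0, 1}"
  by (auto simp: Legendre_def)

lemma Legendre_cong:
  assumes "[a = b] (mod p)"
  shows "Legendre a p = Legendre b p"
proof -
  have "[a = 0] (mod p) \<longleftrightarrow> [b = 0] (mod p)" using assms cong_sym cong_trans by blast
  moreover have "QuadRes p a \<longleftrightarrow> QuadRes p b"
    unfolding QuadRes_def using assms cong_sym cong_trans by blast
  ultimately show ?thesis by (simp add: Legendre_def)
qed

lemma cong_signs_imp_eq:
  assumes "[a = b] (mod p)" "a \<in> {-1, 0, 1}" "b \<in> {-1, 0, 1}" "(p::int) > 2"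
  shows "a = b"
proof -
  have "p dvd a - b" using assms(1) by (simp add: cong_iff_dvd_diff)
  moreover have "\<bar>a - b\<bar> \<le> 2" using assms by auto
  ultimately show ?thesis using assms(4) dvd_imp_le_int[of "a - b" p] by linarith
qed

lemma Legendre_mult:
  assumes "prime p" "p > 2"
  shows "Legendre (a * b) (int p) = Legendre a (int p) * Legendre b (int p)"
proof (rule cong_signs_imp_eq)
  let ?e = "(p - 1) div 2"
  have "[Legendre (a * b) (int p) = (a * b) ^ ?e] (mod int p)"
    using euler_criterion[OF assms] .
  also have "(a * b) ^ ?e = a ^ ?e * b ^ ?e" by (simp add: power_mult_distrib)
  also have "[a ^ ?e * b ^ ?e = Legendre a (int p) * Legendre b (int p)] (mod int p)"
    by (intro cong_mult cong_sym[OF euler_criterion[OF assms]])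
  finally show "[Legendre (a * b) (int p) = Legendre a (int p) * Legendre b (int p)] (mod int p)" .
  show "Legendre (a * b) (int p) \<in> {-1, 0, 1}" by (rule Legendre_values)
  show "Legendre a (int p) * Legendre b (int p) \<in> {-1, 0, 1}"
    using Legendre_values[of a "int p"] Legendre_values[of b "int p"] by auto
  show "2 < int p" using assms by simp
qed

lemma prime_neq_2_imp_gt_2: "prime (p::nat) \<Longrightarrow> p \<noteq> 2 \<Longrightarrow> p > 2"
  using prime_ge_2_nat[of p] by linarith

lemma kron_prime_mult: "prime p \<Longrightarrow> kron_prime (a * b) p = kron_prime a p * kron_prime b p"
  by (auto simp: kron_prime_def kron2_mult Legendre_mult prime_neq_2_imp_gt_2)

lemma kron_prime_eq_1:
  assumes "prime p" "[m = 1] (mod (if p = 2 then 8 else int p))"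
  shows "kron_prime m p = 1"
proof (cases "p = 2")
  case True
  then have "m mod 8 = 1" using assms(2) by (simp add: cong_def)
  moreover from this have "odd m" by presburger
  ultimately show ?thesis using True by (simp add: kron_prime_def kron2_def)
next
  case False
  have "QuadRes (int p) 1" unfolding QuadRes_def by (rule exI[of _ 1]) simp
  then have "Legendre 1 (int p) = 1"
    using assms(1) prime_gt_1_nat[of p] by (auto simp: Legendre_def cong_def)
  then show ?thesis using False assms(2) Legendre_cong[of m 1] by (simp add: kron_prime_def)
qed

lemma kron_prime_in_signs:
  assumes "prime p" "\<not> int p dvd a"
  shows "kron_prime a p \<in> {-1, 1}"
  using assms by (auto simp: kron_prime_def kron2_def Legendre_def cong_0_iff)

lemma kronecker_mult_left:
  assumes "n > 0"
  shows "kronecker (a * b) n = kronecker a n * kronecker b n"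
  using assms
proof (induction n rule: int_prime_factor_induct)
  case (step p m)
  then show ?case
    by (simp add: kronecker_mult_right prime_gt_0_nat kronecker_prime kron_prime_mult)
qed simp

lemma kronecker_eq_1:
  assumes "n > 0" "\<And>p. prime p \<Longrightarrow> int p dvd n \<Longrightarrow> [m = 1] (mod (if p = 2 then 8 else int p))"
  shows "kronecker m n = 1"
  using assms
proof (induction n rule: int_prime_factor_induct)
  case (step p k)
  have "kronecker m k = 1" using step by (meson dvd_mult)
  moreover have "kron_prime m p = 1" using step by (intro kron_prime_eq_1) auto
  ultimately show ?case
    using step by (simp add: kronecker_mult_right prime_gt_0_nat kronecker_prime)
qed simp

lemma kronecker_1_left: "n > 0 \<Longrightarrow> kronecker 1 n = 1"
  by (rule kronecker_eq_1) auto

lemma kronecker_power_left: "n > 0 \<Longrightarrow> kronecker (a ^ j) n = kronecker a n ^ j"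
  by (induction j) (auto simp: kronecker_1_left kronecker_mult_left)

lemma kronecker_prod_left:
  "n > 0 \<Longrightarrow> kronecker (prod f A) n = (\<Prod>i\<in>A. kronecker (f i) n)"
  by (induction A rule: infinite_finite_induct) (auto simp: kronecker_1_left kronecker_mult_left)

lemma kronecker_power_right: "n > 0 \<Longrightarrow> kronecker m (n ^ j) = kronecker m n ^ j"
  by (induction j) (auto simp: kronecker_mult_right)

lemma kronecker_cong:
  assumes "n > 0" "odd n" "[a = b] (mod n)"
  shows "kronecker a n = kronecker b n"
  using assms
proof (induction n rule: int_prime_factor_induct)
  case (step p m)
  have "[a = b] (mod int p)" "[a = b] (mod m)"
    using step by (auto intro: cong_modulus_mult cong_dvd_modulus)
  moreover have "p \<noteq> 2" using step by auto
  ultimately show ?case using step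
    by (simp add: kronecker_mult_right prime_gt_0_nat kronecker_prime kron_prime_def
         Legendre_cong[of a b])
qed simp

lemma kronecker_in_signs:
  assumes "n > 0" "coprime a n"
  shows "kronecker a n \<in> {-1, 1}"
  using assms
proof (induction n rule: int_prime_factor_induct)
  case (step p m)
  then have "coprime a (int p)" "coprime a m" by auto
  then have "\<not> int p dvd a" using step(1)
    by (metis coprime_absorb_right coprime_commute not_prime_unit of_nat_1 prime_nat_int_transfer)
  with kron_prime_in_signs[OF step(1), of a] step \<open>coprime a m\<close> show ?case
    by (auto simp: kronecker_mult_right prime_gt_0_nat kronecker_prime)
qed simp

definition qr_sign :: "int \<Rightarrow> int \<Rightarrow> int" where
  "qr_sign m n = (if m mod 4 = 3 \<and> n mod 4 = 3 then -1 else 1)"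

lemma qr_sign_commute: "qr_sign m n = qr_sign n m"
  by (auto simp: qr_sign_def)

lemma qr_sign_mult_left:
  assumes "odd a" "odd b"
  shows "qr_sign (a * b) n = qr_sign a n * qr_sign b n"
proof -
  have mult: "a * b mod 4 = x * y mod 4" if "a mod 4 = x" "b mod 4 = y" for x y
    using that by (metis mod_mult_eq)
  show ?thesis using odd_mod_4_cases[OF assms(1)] odd_mod_4_cases[OF assms(2)]
    by - (elim disjE; frule (1) mult; simp add: qr_sign_def)
qed

lemma qr_sign_mult_right:
  assumes "odd a" "odd b"
  shows "qr_sign n (a * b) = qr_sign n a * qr_sign n b"
  using qr_sign_mult_left[OF assms] by (simp add: qr_sign_commute)

lemma qr_sign_cong_mod_8:
  assumes "odd m" "odd n"
  shows "[2 * qr_sign m n = 2 - (m - 1) * (n - 1)] (mod 8)"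
proof -
  obtain i j where ij: "m = 2 * i + 1" "n = 2 * j + 1" using assms by (auto elim!: oddE)
  have residue: "(2 * i + 1) mod 4 = 3 \<longleftrightarrow> odd i" for i :: int by presburger
  have "qr_sign m n = (if odd (i * j) then -1 else 1)"
    by (simp add: qr_sign_def ij residue)
  moreover have "(m - 1) * (n - 1) = 4 * (i * j)" by (simp add: ij)
  moreover have "8 dvd 4 * z - 4 \<longleftrightarrow> odd z" "8 dvd 4 * z \<longleftrightarrow> even z" for z :: int
    by presburger+
  ultimately show ?thesis by (simp add: cong_iff_dvd_diff)
qed

lemma Legendre_reciprocity:
  assumes "prime p" "p > 2" "prime q" "q > 2"
  shows "Legendre (int p) (int q) = qr_sign (int p) (int q) * Legendre (int q) (int p)"
proof (cases "p = q")
  case True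
  then show ?thesis by (simp add: Legendre_def cong_def)
next
  case False
  then have "\<not> p dvd q" using assms by (metis prime_nat_iff primes_dvd_imp_eq)
  then have "Legendre (int q) (int p) \<in> {-1, 1}" by (auto simp: Legendre_def cong_0_iff)
  then have square: "Legendre (int q) (int p) * Legendre (int q) (int p) = 1" by auto
  have "odd p" "odd q" using assms prime_odd_nat by auto
  then have "odd ((p - 1) div 2) \<longleftrightarrow> int p mod 4 = 3" "odd ((q - 1) div 2) \<longleftrightarrow> int q mod 4 = 3"
    by presburger+
  then have "((-1)::int) ^ ((p - 1) div 2 * ((q - 1) div 2)) = qr_sign (int p) (int q)"
    by (auto simp: qr_sign_def minus_one_power_iff)
  then have "Legendre p q * Legendre q p = qr_sign (int p) (int q)"
    using Quadratic_Reciprocity[OF assms False] by simp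
  then show ?thesis using square by (metis mult.assoc mult.right_neutral)
qed

lemma kronecker_reciprocity_prime:
  assumes "prime p" "p > 2" "n > 0" "odd n"
  shows "kronecker (int p) n = qr_sign (int p) n * kronecker n (int p)"
  using assms(3,4)
proof (induction n rule: int_prime_factor_induct)
  case one
  then show ?case using assms by (simp add: kronecker_1_left prime_gt_0_nat qr_sign_def)
next
  case (step q m)
  have q: "q > 2" using step(1,6) by (intro prime_neq_2_imp_gt_2) auto
  have odd: "odd (int q)" "odd m" using step by auto
  have "kronecker (int p) (int q) = qr_sign (int p) (int q) * kronecker (int q) (int p)"
    using Legendre_reciprocity[OF assms(1,2) step(1) q] assms q step(1)
    by (simp add: kronecker_prime kron_prime_def)
  moreover have "kronecker (int p) m = qr_sign (int p) m * kronecker m (int p)"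
    using step odd by simp
  ultimately show ?case
    using assms q step odd
    by (simp add: kronecker_mult_right kronecker_mult_left qr_sign_mult_right)
qed

lemma kronecker_reciprocity_odd:
  assumes "m > 0" "odd m" "n > 0" "odd n"
  shows "kronecker m n = qr_sign m n * kronecker n m"
  using assms(1,2)
proof (induction m rule: int_prime_factor_induct)
  case one
  then show ?case using assms by (simp add: kronecker_1_left qr_sign_def)
next
  case (step p m)
  have p: "p > 2" using step by (intro prime_neq_2_imp_gt_2) auto
  have odd: "odd (int p)" "odd m" using step by auto
  have "kronecker (int p) n = qr_sign (int p) n * kronecker n (int p)"
    by (rule kronecker_reciprocity_prime[OF step(1) p assms(3,4)])
  moreover have "kronecker m n = qr_sign m n * kronecker n m" using step odd by simp
  ultimately show ?case
    using assms p step odd by (simp add: kronecker_mult_right kronecker_mult_left qr_sign_mult_left)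
qed

lemma Legendre_minus_one:
  assumes "prime p" "p > 2"
  shows "Legendre (-1) (int p) = (if int p mod 4 = 1 then 1 else -1)"
proof (rule cong_signs_imp_eq)
  have "odd p" using assms prime_odd_nat by auto
  then have "even ((p - 1) div 2) \<longleftrightarrow> int p mod 4 = 1" by presburger
  then have "(if int p mod 4 = 1 then 1 else -1) = ((-1)::int) ^ ((p - 1) div 2)"
    by (simp add: minus_one_power_iff)
  then show "[Legendre (-1) (int p) = (if int p mod 4 = 1 then 1 else -1)] (mod int p)"
    using euler_criterion[OF assms, of "-1"] by simp
qed (use assms Legendre_values[of "-1" "int p"] in auto)

lemma kronecker_minus_one:
  assumes "n > 0" "odd n"
  shows "kronecker (-1) n = (if n mod 4 = 1 then 1 else -1)"
  using assms
proof (induction n rule: int_prime_factor_induct)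
  case (step p m)
  have p: "p > 2" using step by (intro prime_neq_2_imp_gt_2) auto
  have odd: "odd (int p)" "odd m" using step by auto
  have mult: "int p * m mod 4 = x * y mod 4" if "int p mod 4 = x" "m mod 4 = y" for x y
    using that by (metis mod_mult_eq)
  have "kronecker (-1) (int p * m)
      = (if int p mod 4 = 1 then 1 else -1) * (if m mod 4 = 1 then 1 else -1)"
    using step p odd
    by (simp add: kronecker_mult_right kronecker_prime kron_prime_def Legendre_minus_one)
  also have "\<dots> = (if int p * m mod 4 = 1 then 1 else -1)"
    using odd_mod_4_cases[OF odd(1)] odd_mod_4_cases[OF odd(2)]
    by - (elim disjE; frule (1) mult; simp)
  finally show ?case .
qed simp

text \<open>Since $2 \equiv -(n-2)$ modulo $n$, odd reciprocity relates $(2/n)$ to $(2/(n-2))$.\<close>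
lemma kronecker_two:
  assumes "n > 0" "odd n"
  shows "kronecker 2 n = kron2 n"
proof -
  have "kronecker 2 (2 * int j + 1) = kron2 (2 * int j + 1)" for j
  proof (induction j)
    case 0
    then show ?case by (simp add: kron2_def)
  next
    case (Suc j)
    define n where "n = 2 * int j + 3"
    have n: "n > 0" "odd n" "n - 2 > 0" "odd (n - 2)" by (auto simp: n_def)
    have "kronecker 2 n = kronecker ((-1) * (n - 2)) n"
      by (rule kronecker_cong) (use n in \<open>auto simp: cong_iff_dvd_diff\<close>)
    also have "\<dots> = kronecker (-1) n * kronecker (n - 2) n"
      using n by (intro kronecker_mult_left) auto
    also have "kronecker (n - 2) n = kronecker n (n - 2)"
    proof -
      have "qr_sign (n - 2) n = 1" unfolding qr_sign_def using n by presburger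
      then show ?thesis using kronecker_reciprocity_odd[OF n(3,4,1,2)] by simp
    qed
    also have "\<dots> = kronecker 2 (n - 2)"
      by (rule kronecker_cong) (use n in \<open>auto simp: cong_iff_dvd_diff\<close>)
    also have "\<dots> = kron2 (n - 2)" using Suc by (simp add: n_def add.commute)
    also have "kronecker (-1) n * kron2 (n - 2) = kron2 n"
      using kronecker_minus_one[OF n(1,2)] kron2_diff_2[OF n(2)] by simp
    finally show ?case by (simp add: n_def algebra_simps)
  qed
  from this[of "nat ((n - 1) div 2)"] show ?thesis using assms by simp
qed

definition odd_part :: "int \<Rightarrow> int" where
  "odd_part m = m div 2 ^ multiplicity 2 m"

lemma odd_part_decompose: "m = 2 ^ multiplicity 2 m * odd_part m"
  by (simp add: odd_part_def multiplicity_dvd)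

lemma odd_odd_part: "m \<noteq> 0 \<Longrightarrow> odd (odd_part m)"
  unfolding odd_part_def by (rule multiplicity_decompose) auto

lemma odd_part_pos: "m > 0 \<Longrightarrow> odd_part m > 0"
  by (metis odd_part_decompose zero_less_mult_pos zero_less_numeral zero_less_power)

lemma odd_part_power_2_mult:
  assumes "odd j"
  shows "odd_part (2 ^ i * j) = j"
proof -
  have "multiplicity 2 (2 ^ i * j) = i" using assms by (intro multiplicity_decomposeI) auto
  then show ?thesis by (simp add: odd_part_def)
qed

lemma odd_part_odd: "odd j \<Longrightarrow> odd_part j = j"
  using odd_part_power_2_mult[of j 0] by simp

lemma odd_part_mult:
  assumes "a \<noteq> 0" "b \<noteq> 0"
  shows "odd_part (a * b) = odd_part a * odd_part b"
proof -
  have "a * b = 2 ^ (multiplicity 2 a + multiplicity 2 b) * (odd_part a * odd_part b)"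
    by (subst (1) odd_part_decompose[of a], subst (1) odd_part_decompose[of b])
       (simp add: power_add)
  then show ?thesis using assms odd_odd_part odd_part_power_2_mult by (metis even_mult_iff)
qed

lemma odd_part_power: "a \<noteq> 0 \<Longrightarrow> odd_part (a ^ j) = odd_part a ^ j"
  by (induction j) (auto simp: odd_part_mult odd_part_odd)

lemma odd_part_prod:
  "(\<And>i. i \<in> A \<Longrightarrow> f i \<noteq> 0) \<Longrightarrow> odd_part (prod f A) = (\<Prod>i\<in>A. odd_part (f i))"
  by (induction A rule: infinite_finite_induct) (auto simp: odd_part_mult odd_part_odd)

theorem kronecker_reciprocity:
  assumes "m > 0" "n > 0" "odd n"
  shows "kronecker m n = qr_sign (odd_part m) n * kronecker n m"
proof -
  let ?e = "multiplicity 2 m" and ?u = "odd_part m"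
  have u: "?u > 0" "odd ?u" using assms odd_part_pos odd_odd_part by auto
  have two: "kronecker n 2 = kron2 n" using kronecker_prime[of 2 n] by (simp add: kron_prime_def)
  have "kronecker m n = kronecker 2 n ^ ?e * kronecker ?u n"
    using assms
    by (subst (1) odd_part_decompose[of m]) (simp add: kronecker_mult_left kronecker_power_left)
  also have "\<dots> = qr_sign ?u n * (kronecker n 2 ^ ?e * kronecker n ?u)"
    using assms u kronecker_reciprocity_odd[of ?u n] by (simp add: kronecker_two two)
  also have "kronecker n 2 ^ ?e * kronecker n ?u = kronecker n m"
    using u by (subst (3) odd_part_decompose[of m])
      (simp add: kronecker_mult_right kronecker_power_right)
  finally show ?thesis .
qed

definition eps4 :: "int \<Rightarrow> int" where
  "eps4 a = (if a mod 4 = 1 then 0 else 1)"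

lemma eps4_cong: "odd a \<Longrightarrow> [a = 1 + 2 * eps4 a] (mod 4)"
  using odd_mod_4_cases[of a] by (auto simp: eps4_def cong_def)

lemma eps4_mult:
  assumes "odd a" "odd b"
  shows "[eps4 (a * b) = eps4 a + eps4 b] (mod 2)"
proof -
  have mult: "a * b mod 4 = x * y mod 4" if "a mod 4 = x" "b mod 4 = y" for x y
    using that by (metis mod_mult_eq)
  show ?thesis using odd_mod_4_cases[OF assms(1)] odd_mod_4_cases[OF assms(2)]
    by - (elim disjE; frule (1) mult; simp add: eps4_def cong_def)
qed

lemma eps4_power: "odd a \<Longrightarrow> [eps4 (a ^ j) = int j * eps4 a] (mod 2)"
proof (induction j)
  case (Suc j)
  have "[eps4 (a * a ^ j) = eps4 a + eps4 (a ^ j)] (mod 2)" using Suc by (intro eps4_mult) auto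
  also have "[eps4 a + eps4 (a ^ j) = eps4 a + int j * eps4 a] (mod 2)"
    using Suc by (intro cong_add cong_refl) auto
  finally show ?case by (simp add: algebra_simps)
qed (simp add: eps4_def)

lemma eps4_prod:
  assumes "\<And>i. i \<in> A \<Longrightarrow> odd (f i)"
  shows "[eps4 (prod f A) = (\<Sum>i\<in>A. eps4 (f i))] (mod 2)"
  using assms
proof (induction A rule: infinite_finite_induct)
  case (insert i A)
  have "[eps4 (f i * prod f A) = eps4 (f i) + eps4 (prod f A)] (mod 2)"
    using insert by (intro eps4_mult) (auto simp: even_prod_iff)
  also have "[eps4 (f i) + eps4 (prod f A) = eps4 (f i) + (\<Sum>i\<in>A. eps4 (f i))] (mod 2)"
    using insert by (intro cong_add cong_refl) auto
  finally show ?case using insert by simp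
qed (simp_all add: eps4_def)

section \<open>Dedekind sums\<close>

lemma coprime_of_det: "a * d - b * c = (1::int) \<Longrightarrow> coprime d c"
  by (metis add_diff_cancel_left' coprime_doff_one_right coprime_mult_left_iff
      coprime_mult_right_iff diff_add_cancel)

lemma coprime_3_iff: "coprime h 3 \<longleftrightarrow> \<not> 3 dvd (h::int)"
  using prime_imp_coprime[of 3 h] by (auto simp: coprime_commute dest: coprime_common_divisor)

lemma coprime_8_iff: "coprime h 8 \<longleftrightarrow> odd (h::int)"
  using coprime_power_right_iff[of h 2 3] by simp

lemma coprime_imp_square_cong_1:
  fixes h m :: int
  assumes "m \<in> {3, 8}" "coprime h m"
  shows "[h\<^sup>2 = 1] (mod m)"
proof -
  have "(h mod 3)\<^sup>2 mod 3 = 1" if "\<not> 3 dvd h"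
  proof -
    have "h mod 3 = 1 \<or> h mod 3 = 2" using that by presburger
    then show ?thesis by auto
  qed
  moreover have "(h mod 8)\<^sup>2 mod 8 = 1" if "odd h"
    using odd_mod_8_cases[OF that] by auto
  ultimately show ?thesis
    using assms by (auto simp: cong_def coprime_3_iff coprime_8_iff power_mod)
qed

lemma zle_div_iff_mult_le: "k > 0 \<Longrightarrow> q \<le> x div k \<longleftrightarrow> q * k \<le> (x::int)"
  by (smt (verit) nonzero_mult_div_cancel_right zdiv_mono1 pos_mod_sign mult_div_mod_eq
      mult.commute mult_right_mono)

lemma zdiv_less_iff_less_mult: "k > 0 \<Longrightarrow> x div k < q \<longleftrightarrow> (x::int) < q * k"
  using zle_div_iff_mult_le[of k q x] by linarith

lemma sum_Ico_int_add_1: "1 \<le> k \<Longrightarrow> sum f {1..<k + 1} = sum f {1..<k} + f (k::int)"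
proof -
  assume "1 \<le> k"
  then have "{1..<k + 1} = insert k {1..<k}" by auto
  then show ?thesis by (simp add: add.commute)
qed

lemma sum_Ico_int: "1 \<le> k \<Longrightarrow> 2 * (\<Sum>x\<in>{1..<k}. x) = k * (k - 1 :: int)"
  by (induction k rule: int_ge_induct) (simp_all add: sum_Ico_int_add_1 algebra_simps)

lemma sum_squares_Ico_int: "1 \<le> k \<Longrightarrow> 6 * (\<Sum>x\<in>{1..<k}. x\<^sup>2) = (k - 1) * k * (2 * k - 1 :: int)"
  by (induction k rule: int_ge_induct)
     (simp_all add: sum_Ico_int_add_1 algebra_simps power2_eq_square)

lemma sum_mult_mod:
  "coprime h (k::int) \<Longrightarrow> (\<Sum>x\<in>{1..<k}. g (h * x mod k)) = (\<Sum>x\<in>{1..<k}. g x)"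
  by (rule sum.reindex_bij_betw[OF bij_betw_int_remainders_mult])

lemma sum_mult_div:
  assumes "(k::int) > 0" "coprime h k"
  shows "2 * (\<Sum>x\<in>{1..<k}. h * x div k) = (h - 1) * (k - 1)"
proof -
  let ?q = "\<Sum>x\<in>{1..<k}. h * x div k" and ?s = "\<Sum>x\<in>{1..<k}. x"
  have "?s = (\<Sum>x\<in>{1..<k}. h * x mod k)"
    using sum_mult_mod[OF assms(2), of "\<lambda>x. x"] by simp
  also have "\<dots> = (\<Sum>x\<in>{1..<k}. h * x - k * (h * x div k))"
    by (intro sum.cong refl) (simp add: minus_mult_div_eq_mod)
  also have "\<dots> = h * ?s - k * ?q" by (simp add: sum_subtractf sum_distrib_left)
  finally have "2 * k * ?q = (h - 1) * (2 * ?s)" by (simp add: algebra_simps)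
  also have "2 * ?s = k * (k - 1)" using assms by (intro sum_Ico_int) simp
  finally have "k * (2 * ?q) = k * ((h - 1) * (k - 1))" by (simp add: algebra_simps)
  then show ?thesis using assms(1) by simp
qed

lemma sum_square_mult_div:
  assumes "coprime h (k::int)"
  shows "k\<^sup>2 * (\<Sum>x\<in>{1..<k}. (h * x div k)\<^sup>2)
    = 2 * h * k * (\<Sum>x\<in>{1..<k}. x * (h * x div k)) - (h\<^sup>2 - 1) * (\<Sum>x\<in>{1..<k}. x\<^sup>2)"
proof -
  have "(\<Sum>x\<in>{1..<k}. x\<^sup>2) = (\<Sum>x\<in>{1..<k}. (h * x mod k)\<^sup>2)"
    using sum_mult_mod[OF assms, of "\<lambda>x. x\<^sup>2"] by simp
  also have "\<dots> = (\<Sum>x\<in>{1..<k}. h\<^sup>2 * x\<^sup>2 - 2 * h * k * (x * (h * x div k)) + k\<^sup>2 * (h * x div k)\<^sup>2)"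
    by (intro sum.cong refl)
       (simp add: minus_mult_div_eq_mod [symmetric] algebra_simps power2_eq_square)
  also have "\<dots> = h\<^sup>2 * (\<Sum>x\<in>{1..<k}. x\<^sup>2) - 2 * h * k * (\<Sum>x\<in>{1..<k}. x * (h * x div k))
      + k\<^sup>2 * (\<Sum>x\<in>{1..<k}. (h * x div k)\<^sup>2)"
    by (simp add: sum.distrib sum_subtractf sum_distrib_left)
  finally show ?thesis by (simp add: algebra_simps)
qed

lemma sum_greater_fraction:
  assumes "0 < j" "j < h" "k > 0" "coprime h (k::int)"
  shows "2 * (\<Sum>x\<in>{1..<k}. if j * k \<le> h * x then x else 0)
    = k * (k - 1) - (k * j div h) * (k * j div h + 1)"
proof -
  define q where "q = k * j div h"
  have q: "0 \<le> q" "q < k" using assms unfolding q_def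
    by (auto simp: pos_imp_zdiv_nonneg_iff zdiv_less_iff_less_mult)
  have "\<not> h dvd k * j" using assms zdvd_not_zless[of j h]
    by (simp add: coprime_dvd_mult_right_iff)
  then have "k * j \<noteq> x * h" for x by (metis dvd_triv_right)
  then have "k * j \<le> x * h \<longleftrightarrow> q < x" for x
    using assms(1,2) by (simp add: q_def zdiv_less_iff_less_mult order.order_iff_strict)
  then have "j * k \<le> h * x \<longleftrightarrow> q < x" for x by (metis mult.commute)
  then have "(\<Sum>x\<in>{1..<k}. if j * k \<le> h * x then x else 0) = (\<Sum>x\<in>{x\<in>{1..<k}. q < x}. x)"
    by (subst sum.inter_filter) simp_all
  also have "{x\<in>{1..<k}. q < x} = {1..<k} - {1..<q + 1}" using q by auto
  also have "(\<Sum>x\<in>{1..<k} - {1..<q + 1}. x) = (\<Sum>x\<in>{1..<k}. x) - (\<Sum>x\<in>{1..<q + 1}. x)"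
    using q by (intro sum_diff) auto
  finally show ?thesis using sum_Ico_int[of k] sum_Ico_int[of "q + 1"] q
    by (simp add: q_def algebra_simps)
qed

lemma two_sum_mult_mult_div:
  assumes "h > 0" "k > 0" "coprime h (k::int)"
  shows "2 * (\<Sum>x\<in>{1..<k}. x * (h * x div k))
       = (\<Sum>j\<in>{1..<h}. k * (k - 1) - (k * j div h) * (k * j div h + 1))"
proof -
  have "x * (h * x div k) = (\<Sum>j\<in>{1..<h}. if j * k \<le> h * x then x else 0)"
    if x: "x \<in> {1..<k}" for x
  proof -
    have "h * x div k < h" using x assms by (simp add: zdiv_less_iff_less_mult)
    then have "{j \<in> {1..<h}. j * k \<le> h * x} = {1..h * x div k}"
      using assms(2) by (auto simp flip: zle_div_iff_mult_le)
    then have "(\<Sum>j\<in>{1..<h}. if j * k \<le> h * x then x else 0) = (\<Sum>j\<in>{1..h * x div k}. x)"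
      by (subst sum.inter_filter[symmetric]) simp_all
    then show ?thesis using x assms by (simp add: pos_imp_zdiv_nonneg_iff)
  qed
  then have "2 * (\<Sum>x\<in>{1..<k}. x * (h * x div k))
     = 2 * (\<Sum>x\<in>{1..<k}. \<Sum>j\<in>{1..<h}. if j * k \<le> h * x then x else 0)"
    by simp
  also have "\<dots> = (\<Sum>j\<in>{1..<h}. 2 * (\<Sum>x\<in>{1..<k}. if j * k \<le> h * x then x else 0))"
    by (subst sum.swap) (simp add: sum_distrib_left)
  also have "\<dots> = (\<Sum>j\<in>{1..<h}. k * (k - 1) - (k * j div h) * (k * j div h + 1))"
    using assms by (intro sum.cong refl sum_greater_fraction) auto
  finally show ?thesis .
qed

text \<open>The integer $12\,k\,s(h,k)$, for coprime \<open>h\<close> and \<open>k\<close>.\<close>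
definition dsum12 :: "int \<Rightarrow> int \<Rightarrow> int" where
  "dsum12 h k =
     2 * h * (k - 1) * (2 * k - 1) - 12 * (\<Sum>x\<in>{1..<k}. x * (h * x div k)) - 3 * k * (k - 1)"

lemma saw_of_int_divide:
  assumes "k > 0"
  shows "saw (of_int x / of_int k)
     = (if k dvd x then 0 else of_int (x mod k) / of_int k - 1 / 2)"
proof -
  have Ints: "(of_int x / of_int k :: real) \<in> \<int> \<longleftrightarrow> k dvd x"
    using assms by (metis less_irrefl of_int_div_of_int_in_Ints_iff)
  have "(of_int x :: real) = of_int k * of_int (x div k) + of_int (x mod k)"
    by (metis mult_div_mod_eq of_int_add of_int_mult)
  then have "of_int x / of_int k - of_int (x div k) = (of_int (x mod k) / of_int k :: real)"
    using assms by (simp add: field_simps)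
  then show ?thesis unfolding saw_def Ints by (auto simp: floor_divide_of_int_eq)
qed

lemma sum_centered_mult_mod:
  assumes "k > 0" "coprime h k"
  shows "3 * (\<Sum>x\<in>{1..<k}. (2 * x - k) * (2 * (h * x mod k) - k)) = k * dsum12 h k"
proof -
  let ?I = "{1..<k}" and ?m = "\<lambda>x. h * x mod k"
  let ?s = "\<Sum>x\<in>?I. x" and ?sq = "\<Sum>x\<in>?I. x\<^sup>2" and ?S = "\<Sum>x\<in>?I. x * (h * x div k)"
  have "(\<Sum>x\<in>?I. x * ?m x) = (\<Sum>x\<in>?I. h * x\<^sup>2 - k * (x * (h * x div k)))"
    by (intro sum.cong refl)
       (simp add: minus_mult_div_eq_mod [symmetric] algebra_simps power2_eq_square)
  also have "\<dots> = h * ?sq - k * ?S" by (simp add: sum_subtractf sum_distrib_left)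
  finally have moment: "(\<Sum>x\<in>?I. x * ?m x) = h * ?sq - k * ?S" .
  have "(\<Sum>x\<in>?I. (2 * x - k) * (2 * ?m x - k))
      = (\<Sum>x\<in>?I. 4 * (x * ?m x) - 2 * k * x - 2 * k * ?m x + k * k)"
    by (intro sum.cong refl) (simp add: algebra_simps)
  also have "\<dots> = 4 * (\<Sum>x\<in>?I. x * ?m x) - 2 * k * ?s - 2 * k * (\<Sum>x\<in>?I. ?m x) + (k - 1) * (k * k)"
    using assms(1) by (simp add: sum_subtractf sum.distrib flip: sum_distrib_left)
  also have "(\<Sum>x\<in>?I. ?m x) = ?s"
    using sum_mult_mod[OF assms(2), of "\<lambda>x. x"] by simp
  finally have "3 * (\<Sum>x\<in>?I. (2 * x - k) * (2 * ?m x - k))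
      = 2 * h * (6 * ?sq) - 12 * k * ?S - 6 * k * (2 * ?s) + 3 * (k - 1) * (k * k)"
    unfolding moment by (simp add: algebra_simps)
  also have "6 * ?sq = (k - 1) * k * (2 * k - 1)" using assms by (intro sum_squares_Ico_int) simp
  also have "2 * ?s = k * (k - 1)" using assms by (intro sum_Ico_int) simp
  finally show ?thesis unfolding dsum12_def by (simp add: algebra_simps)
qed

lemma dsum_eq_dsum12:
  assumes "k > 0" "coprime h k"
  shows "12 * of_int k * dsum h k = of_int (dsum12 h k)"
proof -
  let ?saw = "\<lambda>y. saw (of_int y / of_int k)" and ?t = "\<lambda>x. (2 * x - k) * (2 * (h * x mod k) - k)"
  have centered: "2 * of_int k * ?saw y = of_int (2 * (y mod k) - k)" if "\<not> k dvd y" for y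
    using that assms(1) by (simp add: saw_of_int_divide field_simps)
  have summand: "4 * of_int k * of_int k * (?saw x * ?saw (h * x)) = of_int (?t x)"
    if x: "x \<in> {1..<k}" for x
  proof -
    have not_dvd: "\<not> k dvd x" using x zdvd_not_zless[of x k] by simp
    then have not_dvd_mult: "\<not> k dvd h * x"
      using assms by (simp add: coprime_dvd_mult_right_iff coprime_commute)
    have "4 * of_int k * of_int k * (?saw x * ?saw (h * x))
        = (2 * of_int k * ?saw x) * (2 * of_int k * ?saw (h * x))"
      by simp
    also have "\<dots> = of_int (?t x)"
      unfolding centered[OF not_dvd] centered[OF not_dvd_mult] using x by simp
    finally show ?thesis .
  qed
  have "{0..<k} = insert 0 {1..<k}" using assms(1) by auto
  then have "dsum h k = (\<Sum>x\<in>{1..<k}. ?saw x * ?saw (h * x))"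
    by (simp add: dsum_def saw_def)
  then have "of_int k * (12 * of_int k * dsum h k)
      = 3 * (\<Sum>x\<in>{1..<k}. 4 * of_int k * of_int k * (?saw x * ?saw (h * x)))"
    by (simp add: mult_ac flip: sum_distrib_left)
  also have "\<dots> = 3 * (\<Sum>x\<in>{1..<k}. of_int (?t x))"
    by (simp only: summand cong: sum.cong)
  also have "\<dots> = of_int (k * dsum12 h k)"
    unfolding sum_centered_mult_mod[OF assms, symmetric] by simp
  finally show ?thesis using assms(1) by simp
qed

theorem dsum12_reciprocity:
  assumes "h > 0" "k > 0" "coprime h k"
  shows "h * dsum12 h k + k * dsum12 k h = h\<^sup>2 + k\<^sup>2 + 1 - 3 * h * k"
proof -
  define q where "q j = k * j div h" for j
  define A B C Q S where "A = (\<Sum>j\<in>{1..<h}. j * q j)" and "B = (\<Sum>j\<in>{1..<h}. (q j)\<^sup>2)"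
    and "C = (\<Sum>j\<in>{1..<h}. q j)" and "Q = (\<Sum>j\<in>{1..<h}. j\<^sup>2)"
    and "S = (\<Sum>x\<in>{1..<k}. x * (h * x div k))"
  note sum_defs = A_def B_def C_def Q_def S_def q_def
  have coprime: "coprime k h" using assms(3) by (simp add: coprime_commute)
  have two_C: "2 * C = (k - 1) * (h - 1)"
    using sum_mult_div[OF assms(1) coprime] by (simp add: sum_defs)
  have six_Q: "6 * Q = (h - 1) * h * (2 * h - 1)"
    using sum_squares_Ico_int[of h] assms(1) by (simp add: sum_defs)
  have square_B: "h\<^sup>2 * B = 2 * k * h * A - (k\<^sup>2 - 1) * Q"
    using sum_square_mult_div[OF coprime] by (simp add: sum_defs)
  have "2 * S = (\<Sum>j\<in>{1..<h}. k * (k - 1) - (q j)\<^sup>2 - q j)"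
    using two_sum_mult_mult_div[OF assms] by (simp add: sum_defs algebra_simps power2_eq_square)
  also have "\<dots> = (h - 1) * (k * (k - 1)) - B - C"
    using assms(1) by (simp add: sum_subtractf B_def C_def)
  finally have two_S: "2 * S = (h - 1) * (k * (k - 1)) - B - C" .
  have "h * (h * dsum12 h k + k * dsum12 k h - (h\<^sup>2 + k\<^sup>2 + 1 - 3 * h * k))
      = - 6 * h\<^sup>2 * (2 * S - ((h - 1) * (k * (k - 1)) - B - C))
        + 6 * (h\<^sup>2 * B - (2 * k * h * A - (k\<^sup>2 - 1) * Q))
        + 3 * h\<^sup>2 * (2 * C - (k - 1) * (h - 1))
        - (k\<^sup>2 - 1) * (6 * Q - (h - 1) * h * (2 * h - 1))"
    unfolding dsum12_def S_def[symmetric] A_def[unfolded q_def, symmetric]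
    by (simp add: algebra_simps power2_eq_square)
  also have "\<dots> = 0" using square_B two_C six_Q two_S by simp
  finally show ?thesis using assms(1) by simp
qed

lemma saw_minus: "saw (- x) = - saw x"
proof (cases "x \<in> \<int>")
  case False
  then have "of_int \<lfloor>x\<rfloor> \<noteq> x" by (metis Ints_of_int)
  then have "\<lfloor>- x\<rfloor> = - \<lfloor>x\<rfloor> - 1" by linarith
  then show ?thesis using False by (simp add: saw_def)
qed (simp add: saw_def)

lemma dsum_minus: "dsum (- h) k = - dsum h k"
  unfolding dsum_def by (simp add: saw_minus sum_negf)

lemma dsum_cong:
  assumes "k > 0" "[h = h'] (mod k)"
  shows "dsum h k = dsum h' k"
proof -
  have "[h * x = h' * x] (mod k)" for x using assms(2) by (rule cong_scalar_right)
  then have "k dvd h * x \<longleftrightarrow> k dvd h' * x" "h * x mod k = h' * x mod k" for x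
    by (auto simp: cong_def dvd_eq_mod_eq_0)
  then have "saw (of_int (h * x) / of_int k) = saw (of_int (h' * x) / of_int k)" for x
    by (simp only: saw_of_int_divide[OF assms(1)])
  then show ?thesis unfolding dsum_def by simp
qed

lemma dsum12_cong:
  assumes "k > 0" "coprime h k" "[h = h'] (mod k)"
  shows "dsum12 h k = dsum12 h' k"
proof -
  have "coprime h' k" using assms(2,3) cong_imp_coprime by blast
  then have "real_of_int (dsum12 h k) = of_int (dsum12 h' k)"
    using dsum_eq_dsum12[OF assms(1)] assms dsum_cong[OF assms(1,3)] by metis
  then show ?thesis by simp
qed

lemma dsum12_minus:
  assumes "k > 0" "coprime h k"
  shows "dsum12 (- h) k = - dsum12 h k"
proof -
  have "real_of_int (dsum12 (- h) k) = of_int (- dsum12 h k)"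
    using dsum_eq_dsum12[OF assms(1)] assms dsum_minus[of h k]
    by (metis coprime_minus_left_iff mult_minus_right of_int_minus)
  then show ?thesis by linarith
qed

lemma three_dvd_dsum12:
  assumes "\<not> 3 dvd k"
  shows "3 dvd dsum12 h k"
proof -
  have "3 dvd k - 1 \<or> 3 dvd 2 * k - 1" using assms by presburger
  then have "3 dvd 2 * h * (k - 1) * (2 * k - 1)" by auto
  moreover have "3 dvd 12 * (\<Sum>x\<in>{1..<k}. x * (h * x div k))" "3 dvd 3 * k * (k - 1)"
    by (simp_all add: mult.assoc)
  ultimately show ?thesis unfolding dsum12_def by (intro dvd_diff)
qed

lemma qr_sign_mult_sign_cong_mod_8:
  assumes "odd h" "odd k" "J = 1 \<or> J = (-1 :: int)"
  shows "[3 * h - 4 * k - h * k + 2 * h * k * J = k + 1 - 2 * (qr_sign h k * J)] (mod 8)"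
proof -
  obtain i j where ij: "h = 2 * i + 1" "k = 2 * j + 1" using assms by (auto elim!: oddE)
  have "3 * h - 4 * k - h * k + 2 * h * k * J - (k + 1 - 2 * (qr_sign h k * J))
      = J * (2 * qr_sign h k - (2 - (h - 1) * (k - 1)))
        + (3 * h - 5 * k - h * k + 2 * h * k * J - 1 + J * (2 - (h - 1) * (k - 1)))"
    by (simp add: algebra_simps)
  also have "8 dvd \<dots>"
  proof (rule dvd_add)
    show "8 dvd J * (2 * qr_sign h k - (2 - (h - 1) * (k - 1)))"
      using qr_sign_cong_mod_8[OF assms(1,2)] by (simp add: cong_iff_dvd_diff)
    show "8 dvd 3 * h - 5 * k - h * k + 2 * h * k * J - 1 + J * (2 - (h - 1) * (k - 1))"
      using assms(3) by (auto simp: ij algebra_simps)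
  qed
  finally show ?thesis by (simp add: cong_iff_dvd_diff)
qed

lemma dsum12_mod_8_swap:
  assumes "h > 0" "odd h" "k > 0" "odd k" "coprime h k"
    and "[dsum12 k h = h + 1 - 2 * kronecker k h] (mod 8)"
  shows "[dsum12 h k = k + 1 - 2 * kronecker h k] (mod 8)"
proof -
  let ?D = "dsum12 h k" and ?E = "dsum12 k h"
  define J q where "J = kronecker k h" and "q = qr_sign h k"
  have J: "J = 1 \<or> J = -1"
    using kronecker_in_signs[of h k] assms by (auto simp: J_def coprime_commute)
  have squares: "8 dvd h\<^sup>2 - 1" "8 dvd k\<^sup>2 - 1"
    using assms coprime_imp_square_cong_1[of 8]
    by (simp_all add: coprime_8_iff flip: cong_iff_dvd_diff)
  have "?D - (3 * h - 4 * k - h * k + 2 * h * k * J)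
      = h * (h * ?D + k * ?E - (h\<^sup>2 + k\<^sup>2 + 1 - 3 * h * k)) + h * (k\<^sup>2 - 1)
        - (h\<^sup>2 - 1) * (?D - h + 4 * k) - h * k * (?E - (h + 1 - 2 * J))"
    by (simp add: algebra_simps power2_eq_square)
  also have "8 dvd \<dots>"
    unfolding dsum12_reciprocity[OF assms(1,3,5)]
    using squares assms(6) by (simp add: cong_iff_dvd_diff J_def)
  finally have "[?D = 3 * h - 4 * k - h * k + 2 * h * k * J] (mod 8)"
    by (simp add: cong_iff_dvd_diff)
  also have "[3 * h - 4 * k - h * k + 2 * h * k * J = k + 1 - 2 * (q * J)] (mod 8)"
    using assms J unfolding q_def by (intro qr_sign_mult_sign_cong_mod_8)
  also have "q * J = kronecker h k"
    using assms by (simp add: q_def J_def kronecker_reciprocity_odd[of h k])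
  finally show ?thesis .
qed

lemma dsum12_mod_8_minus:
  assumes "k > 0" "odd k" "coprime h k" "[dsum12 h k = k + 1 - 2 * kronecker h k] (mod 8)"
  shows "[dsum12 (- h) k = k + 1 - 2 * kronecker (- h) k] (mod 8)"
proof -
  have "kronecker (- h) k = (if k mod 4 = 1 then 1 else -1) * kronecker h k"
    using kronecker_mult_left[OF assms(1), of "-1" h] kronecker_minus_one[OF assms(1,2)] by simp
  moreover have "kronecker h k = 1 \<or> kronecker h k = -1"
    using kronecker_in_signs[OF assms(1,3)] by auto
  ultimately show ?thesis using assms(4) odd_mod_4_cases[OF assms(2)]
    unfolding dsum12_minus[OF assms(1,3)] cong_iff_dvd_diff
    by (elim disjE; simp; presburger)
qed

lemma odd_residue_exists:
  assumes "k > 1" "odd k" "coprime h (k::int)"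
  obtains h' where "0 < h'" "h' < k" "odd h'" "coprime h' k"
    "[h = h'] (mod k) \<or> [h = - h'] (mod k)"
proof -
  define h0 where "h0 = h mod k"
  have "[h = h0] (mod k)" by (simp add: h0_def)
  then have "coprime h0 k" using assms(3) cong_imp_coprime by blast
  then have "h0 \<noteq> 0" using assms(1) by auto
  then have h0: "0 < h0" "h0 < k"
    using assms(1) pos_mod_sign[of k h] pos_mod_bound[of k h] unfolding h0_def by linarith+
  show ?thesis
  proof (cases "odd h0")
    case True
    then show ?thesis using that h0 \<open>coprime h0 k\<close> \<open>[h = h0] (mod k)\<close> by blast
  next
    case False
    have "[- (k - h0) = h0] (mod k)" by (simp add: cong_iff_dvd_diff)
    moreover from this have "coprime (k - h0) k"
      using \<open>coprime h0 k\<close> by (metis cong_imp_coprime cong_sym coprime_minus_left_iff)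
    moreover have "[h = - (k - h0)] (mod k)"
      using calculation(1) \<open>[h = h0] (mod k)\<close> by (metis cong_sym cong_trans)
    ultimately show ?thesis using that[of "k - h0"] h0 False assms(2) by simp
  qed
qed

theorem dsum12_mod_8:
  assumes "k > 0" "odd k" "coprime h k"
  shows "[dsum12 h k = k + 1 - 2 * kronecker h k] (mod 8)"
  using assms
proof (induction "nat k" arbitrary: h k rule: less_induct)
  case (less k h)
  show ?case
  proof (cases "k = 1")
    case True
    then show ?thesis by (simp add: dsum12_def)
  next
    case False
    then have "k > 1" using less.prems by simp
    then obtain h' where h': "0 < h'" "h' < k" "odd h'" "coprime h' k"
      "[h = h'] (mod k) \<or> [h = - h'] (mod k)"
      using odd_residue_exists less.prems by metis
    have "[dsum12 k h' = h' + 1 - 2 * kronecker k h'] (mod 8)"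
      using less.hyps[of h' k] h' less.prems by (simp add: coprime_commute)
    then have swapped: "[dsum12 h' k = k + 1 - 2 * kronecker h' k] (mod 8)"
      using dsum12_mod_8_swap h' less.prems by simp
    show ?thesis using h'(5)
    proof
      assume "[h = h'] (mod k)"
      then show ?thesis using swapped dsum12_cong kronecker_cong less.prems by metis
    next
      assume "[h = - h'] (mod k)"
      then show ?thesis
        using dsum12_mod_8_minus[OF _ _ h'(4) swapped] dsum12_cong kronecker_cong less.prems
        by metis
    qed
  qed
qed

lemma Psi_eq_of_int:
  assumes "a * d - b * c = 1" "c > 0" "d > 0"
  obtains P :: int where "Psi a b c d = of_int P"
    "c * P = a + d - 3 * c - dsum12 d c" "d * P = b - c + dsum12 c d"
proof -
  have coprime: "coprime d c" by (rule coprime_of_det[OF assms(1)])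
  define U V where "U = a + d - 3 * c - dsum12 d c" and "V = b - c + dsum12 c d"
  define P where "P = a * V - b * U"
  have Psi: "of_int c * Psi a b c d = of_int U"
    using dsum_eq_dsum12[OF assms(2) coprime] assms(2)
    by (simp add: Psi_def U_def dsum_minus field_simps)
  have "d * U - c * V = (a * d - b * c - 1)
     - (c * dsum12 c d + d * dsum12 d c - (c\<^sup>2 + d\<^sup>2 + 1 - 3 * c * d))"
    unfolding U_def V_def by (simp add: algebra_simps power2_eq_square)
  also have "\<dots> = 0"
    using dsum12_reciprocity[OF assms(2,3)] coprime assms(1) by (simp add: coprime_commute)
  finally have UV: "d * U = c * V" by simp
  have "c * P = a * (c * V) - b * c * U" by (simp add: P_def algebra_simps)
  also have "\<dots> = (a * d - b * c) * U" unfolding UV[symmetric] by (simp add: algebra_simps)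
  finally have cP: "c * P = U" using assms(1) by simp
  have "d * P = a * d * V - b * (d * U)" by (simp add: P_def algebra_simps)
  also have "\<dots> = (a * d - b * c) * V" unfolding UV by (simp add: algebra_simps)
  finally have dP: "d * P = V" using assms(1) by simp
  have "of_int c * Psi a b c d = of_int c * of_int P" using Psi cP by (metis of_int_mult)
  then have "Psi a b c d = of_int P" using assms(2) by simp
  then show ?thesis using that cP dP by (simp add: U_def V_def)
qed

text \<open>The right-hand side of Petersson's formula for the multiplier of the eta function.\<close>
definition petersson :: "int \<Rightarrow> int \<Rightarrow> int \<Rightarrow> int \<Rightarrow> int" where
  "petersson a b c d = (a + d) * c - b * d * (c\<^sup>2 - 1) + 3 * (d - 1 - c * d)"

lemma petersson_mod_8:
  assumes det: "a * d - b * c = 1" and "d > 0" "odd d"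
    and P: "d * P = b - c + dsum12 c d"
  shows "[P = petersson a b c d + 6 * (1 - kronecker c d)] (mod 8)"
proof -
  define J where "J = kronecker c d"
  define X where "X = petersson a b c d + 6 * (1 - J)"
  have coprime: "coprime c d" using coprime_of_det[OF det] by (simp add: coprime_commute)
  have J_sign: "J = 1 \<or> J = -1" using kronecker_in_signs[OF assms(2) coprime] by (auto simp: J_def)
  obtain i where i: "d = 2 * i + 1" using assms(3) by (auto elim: oddE)
  have "d * (P - X) = (d * P - (b - c + dsum12 c d)) - c * (a * d - b * c - 1)
      + (dsum12 c d - (d + 1 - 2 * J)) - (d\<^sup>2 - 1) * (b + 3 - 2 * c - b * c\<^sup>2)
      - (2 * (1 + d) - 2 * J * (3 * d - 1))"
    by (simp add: X_def petersson_def algebra_simps power2_eq_square)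
  also have "\<dots> = (dsum12 c d - (d + 1 - 2 * J)) - (d\<^sup>2 - 1) * (b + 3 - 2 * c - b * c\<^sup>2)
      - (2 * (1 + d) - 2 * J * (3 * d - 1))"
    using P det by simp
  also have "8 dvd \<dots>"
  proof (rule dvd_diff[OF dvd_diff])
    show "8 dvd dsum12 c d - (d + 1 - 2 * J)"
      using dsum12_mod_8[OF assms(2,3) coprime] by (simp add: J_def cong_iff_dvd_diff)
    show "8 dvd (d\<^sup>2 - 1) * (b + 3 - 2 * c - b * c\<^sup>2)"
      using assms(3) coprime_imp_square_cong_1[of 8 d]
      by (simp add: coprime_8_iff cong_iff_dvd_diff)
    show "8 dvd 2 * (1 + d) - 2 * J * (3 * d - 1)" using J_sign by (auto simp: i)
  qed
  finally have "8 dvd P - X"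
    using assms(3) by (simp add: coprime_dvd_mult_right_iff coprime_8_iff coprime_commute)
  then show ?thesis by (simp add: X_def J_def cong_iff_dvd_diff)
qed

lemma petersson_mod_3:
  assumes "coprime c d" and P: "c * P = a + d - 3 * c - dsum12 d c" "d * P = b - c + dsum12 c d"
  shows "[P = petersson a b c d] (mod 3)"
proof (cases "3 dvd c")
  case False
  have "P - petersson a b c d = c * (c * P - (a + d - 3 * c - dsum12 d c)) - (c\<^sup>2 - 1) * (P - b * d)
      - c * dsum12 d c - 3 * (c\<^sup>2 + d - 1 - c * d)"
    by (simp add: petersson_def algebra_simps power2_eq_square)
  also have "3 dvd \<dots>"
    using P(1) three_dvd_dsum12[OF False] coprime_imp_square_cong_1[of 3 c] False
    by (simp add: coprime_3_iff cong_iff_dvd_diff)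
  finally show ?thesis by (simp add: cong_iff_dvd_diff)
next
  case True
  have not_dvd: "\<not> 3 dvd d" using coprime_common_divisor[OF assms(1) True] by auto
  have "P - petersson a b c d = d * (d * P - (b - c + dsum12 c d)) - (d\<^sup>2 - 1) * P
      + d * dsum12 c d - c * (a + 2 * d - b * c * d) - 3 * (d - 1 - c * d)"
    by (simp add: petersson_def algebra_simps power2_eq_square)
  also have "3 dvd \<dots>"
    using P(2) True three_dvd_dsum12[OF not_dvd] coprime_imp_square_cong_1[of 3 d] not_dvd
    by (simp add: coprime_3_iff cong_iff_dvd_diff)
  finally show ?thesis by (simp add: cong_iff_dvd_diff)
qed

theorem Psi_cong_petersson:
  assumes det: "a * d - b * c = 1" and "c > 0" "d > 0" "odd d"
  obtains P :: int where "Psi a b c d = of_int P"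
    "[P = petersson a b c d + 6 * (1 - kronecker c d)] (mod 24)"
proof -
  obtain P where P: "Psi a b c d = of_int P"
    "c * P = a + d - 3 * c - dsum12 d c" "d * P = b - c + dsum12 c d"
    using Psi_eq_of_int[OF assms(1-3)] by blast
  have "coprime c d" using coprime_of_det[OF det] by (simp add: coprime_commute)
  then have "[P = petersson a b c d + 6 * (1 - kronecker c d)] (mod 3)"
    using cong_add[OF petersson_mod_3[OF _ P(2,3)], of 0 "6 * (1 - kronecker c d)"]
    by (simp add: cong_iff_dvd_diff)
  moreover have "[P = petersson a b c d + 6 * (1 - kronecker c d)] (mod 8)"
    using petersson_mod_8[OF det assms(3,4) P(3)] .
  ultimately have "[P = petersson a b c d + 6 * (1 - kronecker c d)] (mod 8 * 3)"
    by (intro coprime_cong_mult) (auto simp: coprime_3_iff)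
  then show ?thesis using that P(1) by simp
qed

section \<open>Fourier expansion of eta-quotients\<close>

definition euler_prod :: "complex \<Rightarrow> complex" where
  "euler_prod q = (\<Prod>n. 1 - q ^ Suc n)"

lemma convergent_euler_prod:
  assumes "norm (q::complex) < 1"
  shows "convergent_prod (\<lambda>n. 1 - q ^ Suc n)"
proof -
  have "summable (\<lambda>n. norm q * norm q ^ n)"
    using assms by (intro summable_mult summable_geometric) simp
  then have "abs_convergent_prod (\<lambda>n. 1 - q ^ Suc n)"
    unfolding abs_convergent_prod_conv_summable by (simp add: norm_mult norm_power)
  then show ?thesis by (rule abs_convergent_prod_imp_convergent_prod)
qed

lemma norm_power_less_1: "norm (q::complex) < 1 \<Longrightarrow> n > 0 \<Longrightarrow> norm (q ^ n) < 1"
  by (metis norm_ge_zero norm_power power_less_one_iff)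

lemma euler_prod_nonzero:
  assumes "norm q < 1"
  shows "euler_prod q \<noteq> 0"
  unfolding euler_prod_def
proof (intro prodinf_nonzero convergent_euler_prod assms)
  show "1 - q ^ Suc n \<noteq> 0" for n
    using norm_power_less_1[OF assms, of "Suc n"]
    by (metis eq_iff_diff_eq_0 less_irrefl norm_one zero_less_Suc)
qed

lemma euler_prod_0: "euler_prod 0 = 1"
  unfolding euler_prod_def by simp

lemma uniform_limit_euler_prod:
  assumes "0 \<le> R" "R < 1"
  shows "uniform_limit (cball 0 R) (\<lambda>N q. \<Prod>n<N. 1 - q ^ Suc n) euler_prod sequentially"
proof -
  have "uniformly_convergent_on (cball 0 R) (\<lambda>N q. \<Prod>n<N. 1 - q ^ Suc n :: complex)"
  proof (rule uniformly_convergent_on_prod')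
    show "uniformly_convergent_on (cball 0 R) (\<lambda>N q. \<Sum>n<N. norm (1 - q ^ Suc n - 1 :: complex))"
    proof (rule Weierstrass_m_test')
      fix n and q :: complex assume "q \<in> cball 0 R"
      then have "norm q ^ Suc n \<le> R ^ Suc n" by (intro power_mono) auto
      then show "norm (norm (1 - q ^ Suc n - 1)) \<le> R ^ Suc n" by (simp add: norm_mult norm_power)
    next
      have "summable (\<lambda>n. R * R ^ n)" using assms by (intro summable_mult summable_geometric) simp
      then show "summable (\<lambda>n. R ^ Suc n)" by simp
    qed
  qed (auto intro!: continuous_intros)
  then have "uniform_limit (cball 0 R) (\<lambda>N q. \<Prod>n<N. 1 - q ^ Suc n)
     (\<lambda>q. lim (\<lambda>N. \<Prod>n<N. 1 - q ^ Suc n :: complex)) sequentially"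
    by (simp only: uniformly_convergent_uniform_limit_iff)
  moreover have "lim (\<lambda>N. \<Prod>n<N. 1 - q ^ Suc n) = euler_prod q" if "q \<in> cball 0 R" for q
  proof -
    have "norm q < 1" using that assms by auto
    then have "(\<lambda>N. \<Prod>n\<le>N. 1 - q ^ Suc n) \<longlonglongrightarrow> euler_prod q"
      unfolding euler_prod_def by (intro convergent_prod_LIMSEQ convergent_euler_prod)
    then show ?thesis unfolding LIMSEQ_lessThan_iff_atMost[symmetric] by (rule limI)
  qed
  ultimately show ?thesis by (subst (asm) uniform_limit_cong') auto
qed

lemma holomorphic_euler_prod: "euler_prod holomorphic_on ball 0 1"
proof (rule holomorphic_uniform_sequence)
  show "(\<lambda>q::complex. \<Prod>n<N. 1 - q ^ Suc n) holomorphic_on ball 0 1" for N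
    by (intro holomorphic_intros)
  fix q :: complex assume q: "q \<in> ball 0 1"
  define R where "R = (1 + norm q) / 2"
  have R: "0 \<le> R" "R < 1" "norm q < R" using q by (auto simp: R_def)
  have subset: "cball q (R - norm q) \<subseteq> cball 0 R"
  proof
    fix w assume "w \<in> cball q (R - norm q)"
    then have "norm (w - q) \<le> R - norm q" by (simp add: dist_norm norm_minus_commute)
    then show "w \<in> cball 0 R" using norm_triangle_ineq[of "w - q" q] by simp
  qed
  show "\<exists>d>0. cball q d \<subseteq> ball 0 1 \<and>
     uniform_limit (cball q d) (\<lambda>N q. \<Prod>n<N. 1 - q ^ Suc n) euler_prod sequentially"
  proof (intro exI conjI)
    show "R - norm q > 0" using R by simp
    show "cball q (R - norm q) \<subseteq> ball 0 1" using subset R by force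
    show "uniform_limit (cball q (R - norm q)) (\<lambda>N q. \<Prod>n<N. 1 - q ^ Suc n) euler_prod sequentially"
      by (rule uniform_limit_on_subset[OF uniform_limit_euler_prod subset]) (use R in auto)
  qed
qed auto

definition eta_quot_prod :: "(nat \<Rightarrow> int) \<Rightarrow> complex \<Rightarrow> complex" where
  "eta_quot_prod r q = (\<Prod>n\<in>supp r. euler_prod (q ^ n) powi r n)"

abbreviation nome :: "complex \<Rightarrow> complex" where
  "nome \<tau> \<equiv> exp (2 * pi * \<i> * \<tau>)"

lemma eta_conv_euler_prod: "eta \<tau> = exp (2 * pi * \<i> * \<tau> / 24) * euler_prod (nome \<tau>)"
proof -
  have "exp (2 * pi * \<i> * of_nat (Suc n) * \<tau>) = nome \<tau> ^ Suc n" for n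
    by (subst exp_of_nat_mult [symmetric]) (simp add: mult_ac)
  then show ?thesis unfolding eta_def euler_prod_def by simp
qed

lemma eta_quot_conv_prod:
  "eta_quot r \<tau> = exp (2 * pi * \<i> * (of_int (xN r) / 24) * \<tau>) * eta_quot_prod r (nome \<tau>)"
proof (cases "finite (supp r)")
  case True
  have "eta (of_nat n * \<tau>) powi r n = exp (of_int (int n * r n) * (2 * pi * \<i> * \<tau> / 24)) *
      (euler_prod (nome \<tau> ^ n) powi r n)" for n
  proof -
    have "nome (of_nat n * \<tau>) = nome \<tau> ^ n"
      by (subst exp_of_nat_mult [symmetric]) (simp add: mult_ac)
    then show ?thesis
      by (simp add: eta_conv_euler_prod power_int_mult_distrib exp_power_int mult_ac)
  qed
  then have "eta_quot r \<tau> = (\<Prod>n\<in>supp r. exp (of_int (int n * r n) * (2 * pi * \<i> * \<tau> / 24))) *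
     eta_quot_prod r (nome \<tau>)"
    unfolding eta_quot_def eta_quot_prod_def by (simp add: prod.distrib)
  also have "(\<Prod>n\<in>supp r. exp (of_int (int n * r n) * (2 * pi * \<i> * \<tau> / 24)))
      = exp (of_int (xN r) * (2 * pi * \<i> * \<tau> / 24))"
    unfolding xN_def of_int_sum sum_distrib_right by (rule exp_sum[OF True, symmetric])
  finally show ?thesis by (simp add: mult_ac)
qed (simp add: eta_quot_def eta_quot_prod_def xN_def)

lemma supp_pos: "0 \<notin> supp r \<Longrightarrow> n \<in> supp r \<Longrightarrow> n > 0"
  by (cases n) auto

lemma eta_quot_prod_nonzero:
  assumes "finite (supp r)" "0 \<notin> supp r" "norm q < 1"
  shows "eta_quot_prod r q \<noteq> 0"
  using assms supp_pos euler_prod_nonzero norm_power_less_1 by (simp add: eta_quot_prod_def)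

lemma holomorphic_eta_quot_prod:
  assumes "0 \<notin> supp r"
  shows "eta_quot_prod r holomorphic_on ball 0 1"
  unfolding eta_quot_prod_def
proof (intro holomorphic_intros)
  fix n assume "n \<in> supp r"
  then have n: "n > 0" using assms supp_pos by blast
  then show "r n \<ge> 0 \<or> (\<forall>q\<in>ball 0 1. euler_prod (q ^ n) \<noteq> 0)"
    using euler_prod_nonzero norm_power_less_1 by auto
  have "euler_prod \<circ> (\<lambda>q. q ^ n) holomorphic_on ball 0 1"
    by (rule holomorphic_on_compose_gen[OF _ holomorphic_euler_prod])
       (use n norm_power_less_1 in \<open>auto intro!: holomorphic_intros\<close>)
  then show "(\<lambda>q. euler_prod (q ^ n)) holomorphic_on ball 0 1" by (simp add: comp_def)
qed

lemma eta_quot_prod_0: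
  assumes "0 \<notin> supp r"
  shows "eta_quot_prod r 0 = 1"
proof -
  have "euler_prod (0 ^ n) powi r n = 1" if "n \<in> supp r" for n
    using supp_pos[OF assms that] by (simp only: zero_power euler_prod_0 power_int_1_left)
  then show ?thesis by (simp add: eta_quot_prod_def)
qed

lemma norm_nome_less_1: "\<tau> \<in> HH \<Longrightarrow> norm (nome \<tau>) < 1"
  by (simp add: HH_def norm_exp_eq_Re)

lemma eta_quot_nonzero:
  assumes "finite (supp r)" "0 \<notin> supp r" "\<tau> \<in> HH"
  shows "eta_quot r \<tau> \<noteq> 0"
  using eta_quot_prod_nonzero[OF assms(1,2) norm_nome_less_1[OF assms(3)]]
  by (simp add: eta_quot_conv_prod)

lemma holomorphic_eta_quot:
  assumes "0 \<notin> supp r"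
  shows "eta_quot r holomorphic_on HH"
proof -
  have "eta_quot_prod r \<circ> (\<lambda>\<tau>. nome \<tau>) holomorphic_on HH"
    by (rule holomorphic_on_compose_gen[OF _ holomorphic_eta_quot_prod[OF assms]])
       (use norm_nome_less_1 in \<open>auto intro!: holomorphic_intros simp del: norm_exp_eq_Re\<close>)
  then have "(\<lambda>\<tau>. exp (2 * pi * \<i> * (of_int (xN r) / 24) * \<tau>) * eta_quot_prod r (nome \<tau>))
      holomorphic_on HH"
    by (auto intro!: holomorphic_intros simp: comp_def)
  then show ?thesis by (simp only: eta_quot_conv_prod[symmetric, abs_def])
qed

lemma ee_0 [simp]: "ee 0 = 1"
  by (simp add: ee_def)

lemma ee_nonzero [simp]: "ee x \<noteq> 0"
  by (simp add: ee_def)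

lemma ee_half: "ee (1 / 2) = -1"
  by (simp add: ee_def)

lemma norm_ee [simp]: "norm (ee x) = 1"
  by (simp add: ee_def norm_exp_eq_Re)

lemma ee_add: "ee (x + y) = ee x * ee y"
  by (simp add: ee_def distrib_left exp_add)

lemma ee_powi: "ee x powi n = ee (of_int n * x)"
  by (simp add: ee_def exp_power_int mult_ac)

lemma ee_sum: "finite A \<Longrightarrow> ee (sum g A) = (\<Prod>i\<in>A. ee (g i))"
  by (induction A rule: finite_induct) (auto simp: ee_add)

lemma ee_of_int: "ee (of_int m) = 1"
  unfolding ee_def by (auto simp: exp_eq_1 intro: exI[of _ m])

lemma ee_eqI:
  assumes "x - y \<in> \<int>"
  shows "ee x = ee y"
proof -
  obtain k where "x = y + of_int k" using assms by (auto elim!: Ints_cases simp: algebra_simps)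
  then show ?thesis by (simp add: ee_add ee_of_int)
qed

lemma eta_quot_add_int:
  "eta_quot r (\<tau> + of_int m) = ee (of_int (xN r * m) / 24) * eta_quot r \<tau>"
proof -
  have "nome (\<tau> + of_int m) = nome \<tau> * ee (of_int m)"
    unfolding ee_def distrib_left exp_add by simp
  moreover have "exp (2 * pi * \<i> * (of_int (xN r) / 24) * (\<tau> + of_int m))
      = ee (of_int (xN r * m) / 24) * exp (2 * pi * \<i> * (of_int (xN r) / 24) * \<tau>)"
    unfolding ee_def distrib_left exp_add by (simp add: mult_ac)
  ultimately show ?thesis unfolding eta_quot_conv_prod by (simp add: ee_of_int)
qed

definition eta_prod_coeff :: "(nat \<Rightarrow> int) \<Rightarrow> nat \<Rightarrow> complex" where
  "eta_prod_coeff r m = (deriv ^^ m) (eta_quot_prod r) 0 / fact m"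

lemma eta_prod_coeff_0: "0 \<notin> supp r \<Longrightarrow> eta_prod_coeff r 0 = 1"
  by (simp add: eta_prod_coeff_def eta_quot_prod_0)

lemma eta_prod_coeff_sums:
  assumes "0 \<notin> supp r" "norm q < 1"
  shows "(\<lambda>m. eta_prod_coeff r m * q ^ m) sums eta_quot_prod r q"
  using holomorphic_power_series[OF holomorphic_eta_quot_prod[OF assms(1)], of q] assms(2)
  by (simp add: eta_prod_coeff_def)

lemma eta_prod_coeff_abs_summable:
  assumes "0 \<notin> supp r" "0 \<le> R" "R < 1"
  shows "summable (\<lambda>m. norm (eta_prod_coeff r m) * R ^ m)"
proof -
  define S where "S = (1 + R) / 2"
  have "norm (complex_of_real S) < 1" unfolding norm_of_real using assms by (auto simp: S_def)
  then have "summable (\<lambda>m. eta_prod_coeff r m * complex_of_real S ^ m)"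
    by (rule sums_summable[OF eta_prod_coeff_sums[OF assms(1)]])
  then have "summable (\<lambda>m. norm (eta_prod_coeff r m * complex_of_real R ^ m))"
    by (rule powser_insidea) (use assms in \<open>auto simp: S_def simp del: of_real_add of_real_divide\<close>)
  then show ?thesis using assms by (simp add: norm_mult norm_power)
qed

lemma eta_quot_fourier:
  assumes "0 \<notin> supp r" "\<tau> \<in> HH"
  shows "(\<lambda>m. eta_prod_coeff r m * exp (2 * pi * \<i> * of_real (of_int (xN r) / 24 + real m) * \<tau>))
    sums eta_quot r \<tau>"
proof -
  let ?q = "nome \<tau>" and ?lead = "exp (2 * pi * \<i> * (of_int (xN r) / 24) * \<tau>)"
  have "(\<lambda>m. ?lead * (eta_prod_coeff r m * ?q ^ m)) sums eta_quot r \<tau>"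
    unfolding eta_quot_conv_prod
    by (rule sums_mult[OF eta_prod_coeff_sums[OF assms(1) norm_nome_less_1[OF assms(2)]]])
  moreover have "?lead * (eta_prod_coeff r m * ?q ^ m)
      = eta_prod_coeff r m * exp (2 * pi * \<i> * of_real (of_int (xN r) / 24 + real m) * \<tau>)" for m
    by (simp add: algebra_simps flip: exp_of_nat_mult exp_add)
  ultimately show ?thesis by (simp only:)
qed

lemma has_integral_ee:
  assumes "L > 0" "L * w \<in> \<int>"
  shows "((\<lambda>t. ee (w * t)) has_integral (if w = 0 then of_real L else 0)) {0..L}"
proof (cases "w = 0")
  case True
  have "((\<lambda>t. 1::complex) has_integral Henstock_Kurzweil_Integration.content {0..L} *\<^sub>R 1) {0..L}"
    by (rule has_integral_const_real)
  then show ?thesis using True assms by (simp add: scaleR_conv_of_real)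
next
  case False
  define F where "F t = ee (w * t) / (2 * pi * \<i> * w)" for t
  have "((\<lambda>t. ee (w * t)) has_integral F L - F 0) {0..L}"
  proof (rule fundamental_theorem_of_calculus)
    fix t assume "t \<in> {0..L}"
    have "((\<lambda>z. exp (2 * pi * \<i> * complex_of_real w * z) / (2 * pi * \<i> * w)) has_field_derivative
       exp (2 * pi * \<i> * complex_of_real w * complex_of_real t)) (at (complex_of_real t))"
      using False by (auto intro!: derivative_eq_intros)
    from has_vector_derivative_real_field[OF this, of "{0..L}"]
    show "(F has_vector_derivative ee (w * t)) (at t within {0..L})"
      unfolding F_def ee_def by (simp add: mult_ac)
  qed (use assms in simp)
  moreover have "F L = F 0"
    using assms(2) ee_eqI[of "w * L" "w * 0"] by (simp add: F_def mult.commute)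
  ultimately show ?thesis using False by simp
qed

lemma integral_fourier_series:
  fixes c :: "nat \<Rightarrow> complex" and w :: "nat \<Rightarrow> real"
  assumes "L > 0" "\<And>m. L * w m \<in> \<int>" "summable (\<lambda>m. norm (c m))"
    and "\<And>t. (\<lambda>m. c m * ee (w m * t)) sums g t"
  shows "(\<lambda>m. if w m = 0 then of_real L * c m else 0) sums integral {0..L} g"
proof -
  define S where "S n t = (\<Sum>m<n. c m * ee (w m * t))" for n t
  have "uniform_limit {0..L} S (\<lambda>t. \<Sum>m. c m * ee (w m * t)) sequentially"
    unfolding S_def by (rule Weierstrass_m_test[OF _ assms(3)]) (simp add: norm_mult)
  moreover have "(\<Sum>m. c m * ee (w m * t)) = g t" for t using assms(4) by (simp add: sums_iff)
  ultimately have limit: "uniform_limit {0..L} S g sequentially" by simp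
  have "continuous_on {0..L} (S n)" for n
    unfolding S_def ee_def by (intro continuous_intros)
  with limit obtain I J where I: "\<And>n. (S n has_integral I n) {0..L}"
    and J: "(g has_integral J) {0..L}" "I \<longlonglongrightarrow> J"
    using uniform_limit_integral by (metis sequentially_bot)
  have "((\<lambda>t. c m * ee (w m * t)) has_integral (if w m = 0 then of_real L * c m else 0)) {0..L}"
    for m
    using has_integral_mult_right[OF has_integral_ee[OF assms(1,2)], of "c m" m]
    by (simp add: mult.commute if_distrib cong: if_cong)
  then have "(S n has_integral (\<Sum>m<n. if w m = 0 then of_real L * c m else 0)) {0..L}" for n
    unfolding S_def by (intro has_integral_sum) auto
  then have "I = (\<lambda>n. \<Sum>m<n. if w m = 0 then of_real L * c m else 0)"
    using I has_integral_unique by blast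
  then show ?thesis using J unfolding sums_def by (metis integral_unique)
qed

definition fourier_kernel :: "real \<Rightarrow> real \<Rightarrow> complex" where
  "fourier_kernel n t = exp (- 2 * pi * \<i> * of_real n * (of_real t + \<i>))"

lemma summable_eta_prod_coeff_exp:
  fixes \<rho> \<theta> n :: real
  assumes "0 \<notin> supp r" "\<rho> > 0"
  shows "summable (\<lambda>m. norm (eta_prod_coeff r m) * exp (- 2 * pi * ((\<theta> + real m) * \<rho> - n)))"
proof -
  have split: "exp (- 2 * pi * ((\<theta> + real m) * \<rho> - n))
      = exp (- 2 * pi * (\<theta> * \<rho> - n)) * exp (- 2 * pi * \<rho>) ^ m" for m
    by (simp add: algebra_simps flip: exp_of_nat_mult exp_add)
  have "summable (\<lambda>m. norm (eta_prod_coeff r m) * exp (- 2 * pi * \<rho>) ^ m)"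
    using assms by (intro eta_prod_coeff_abs_summable) auto
  from summable_mult[OF this, of "exp (- 2 * pi * (\<theta> * \<rho> - n))"] show ?thesis
    unfolding split by (simp only: mult.left_commute)
qed

lemma sums_eta_quot_affine_mult_kernel:
  fixes \<rho> \<beta> n t :: real and r :: "nat \<Rightarrow> int"
  defines "e \<equiv> \<lambda>m::nat. of_int (xN r) / 24 + real m"
  assumes "0 \<notin> supp r" "\<rho> > 0"
  shows "(\<lambda>m. eta_prod_coeff r m * of_real (exp (- 2 * pi * (e m * \<rho> - n)))
      * ee (e m * \<beta>) * ee ((e m * \<rho> - n) * t))
    sums (eta_quot r (of_real \<rho> * (of_real t + \<i>) + of_real \<beta>) * fourier_kernel n t)"
proof -
  define \<tau> where "\<tau> = of_real \<rho> * (of_real t + \<i>) + complex_of_real \<beta>"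
  have "\<tau> \<in> HH" using assms by (simp add: \<tau>_def HH_def)
  then have "(\<lambda>m. eta_prod_coeff r m * exp (2 * pi * \<i> * of_real (e m) * \<tau>) * fourier_kernel n t)
      sums (eta_quot r \<tau> * fourier_kernel n t)"
    unfolding e_def by (intro sums_mult2 eta_quot_fourier assms)
  moreover have "exp (2 * pi * \<i> * of_real (e m) * \<tau>) * fourier_kernel n t
      = of_real (exp (- 2 * pi * (e m * \<rho> - n))) * ee (e m * \<beta>) * ee ((e m * \<rho> - n) * t)" for m
  proof -
    have "2 * pi * \<i> * of_real (e m) * \<tau> + - 2 * pi * \<i> * of_real n * (of_real t + \<i>)
       = complex_of_real (- 2 * pi * (e m * \<rho> - n)) + 2 * pi * \<i> * complex_of_real (e m * \<beta>)
         + 2 * pi * \<i> * complex_of_real ((e m * \<rho> - n) * t)"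
      unfolding \<tau>_def by (simp add: algebra_simps)
    then show ?thesis
      unfolding fourier_kernel_def ee_def exp_of_real[symmetric] by (simp only: exp_add[symmetric])
  qed
  ultimately show ?thesis unfolding \<tau>_def by (simp only: mult.assoc)
qed

lemma sums_integral_eta_quot_affine:
  fixes \<rho> \<beta> n L :: real and r :: "nat \<Rightarrow> int"
  defines "e \<equiv> \<lambda>m::nat. of_int (xN r) / 24 + real m"
  assumes "0 \<notin> supp r" "\<rho> > 0" "L > 0" and period: "\<And>m. L * (e m * \<rho> - n) \<in> \<int>"
  shows "(\<lambda>m. if e m = n / \<rho> then of_real L * (eta_prod_coeff r m * ee (n / \<rho> * \<beta>)) else 0)
    sums integral {0..L}
      (\<lambda>t. eta_quot r (of_real \<rho> * (of_real t + \<i>) + of_real \<beta>) * fourier_kernel n t)"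
proof -
  let ?w = "\<lambda>m. e m * \<rho> - n"
  let ?c = "\<lambda>m. eta_prod_coeff r m * of_real (exp (- 2 * pi * ?w m)) * ee (e m * \<beta>)"
  have "summable (\<lambda>m. norm (?c m))"
    using summable_eta_prod_coeff_exp[OF assms(2,3)] by (simp add: norm_mult e_def)
  then have "(\<lambda>m. if ?w m = 0 then of_real L * ?c m else 0)
      sums integral {0..L}
        (\<lambda>t. eta_quot r (of_real \<rho> * (of_real t + \<i>) + of_real \<beta>) * fourier_kernel n t)"
    using sums_eta_quot_affine_mult_kernel[OF assms(2,3)] assms(4) period
    by (intro integral_fourier_series) (simp_all add: e_def)
  moreover have "?w m = 0 \<longleftrightarrow> e m = n / \<rho>" for m using assms(3) by (auto simp: field_simps)
  then have "(if ?w m = 0 then of_real L * ?c m else 0)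
      = (if e m = n / \<rho> then of_real L * (eta_prod_coeff r m * ee (n / \<rho> * \<beta>)) else 0)" for m
    using assms(3) by auto
  ultimately show ?thesis by (simp only:)
qed

lemma cf_sums:
  assumes "0 \<notin> supp r"
  shows "(\<lambda>m. if of_int (xN r) / 24 + real m = x then eta_prod_coeff r m else 0) sums cf r x"
proof (cases "\<exists>j::int. x = of_int (xN r) / 24 + of_int j")
  case True
  then have "1 * ((of_int (xN r) / 24 + real m) * 1 - x) \<in> \<int>" for m by auto
  from sums_integral_eta_quot_affine[OF assms _ _ this, of 0] True show ?thesis
    by (simp add: cf_def fourier_kernel_def cong: if_cong)
next
  case False
  then have "of_int (xN r) / 24 + real m \<noteq> x" for m by (metis of_int_of_nat_eq)
  moreover have "cf r x = 0" using False by (simp add: cf_def)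
  ultimately show ?thesis by simp
qed

lemma cf_xN:
  assumes "0 \<notin> supp r"
  shows "cf r (of_int (xN r) / 24) = 1"
proof -
  have "(\<lambda>m. if m = 0 then eta_prod_coeff r m else 0) sums cf r (of_int (xN r) / 24)"
    using cf_sums[OF assms, of "of_int (xN r) / 24"] by simp
  then show ?thesis
    using sums_single[of 0 "eta_prod_coeff r"] sums_unique2 eta_prod_coeff_0[OF assms] by metis
qed

lemma integral_eta_quot_affine:
  fixes \<rho> \<beta> n L :: real
  assumes "0 \<notin> supp r" "\<rho> > 0" "L > 0"
    and "\<And>m::nat. L * ((of_int (xN r) / 24 + real m) * \<rho> - n) \<in> \<int>"
  shows "integral {0..L}
      (\<lambda>t. eta_quot r (of_real \<rho> * (of_real t + \<i>) + of_real \<beta>) * fourier_kernel n t)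
    = of_real L * (cf r (n / \<rho>) * ee (n / \<rho> * \<beta>))"
proof (rule sums_unique2[OF sums_integral_eta_quot_affine[OF assms]])
  let ?P = "\<lambda>m. of_int (xN r) / 24 + real m = n / \<rho>"
  have "(\<lambda>m. of_real L * ((if ?P m then eta_prod_coeff r m else 0) * ee (n / \<rho> * \<beta>)))
      sums (of_real L * (cf r (n / \<rho>) * ee (n / \<rho> * \<beta>)))"
    by (intro sums_mult sums_mult2 cf_sums assms)
  then show "(\<lambda>m. if ?P m then of_real L * (eta_prod_coeff r m * ee (n / \<rho> * \<beta>)) else 0)
      sums (of_real L * (cf r (n / \<rho>) * ee (n / \<rho> * \<beta>)))"
    by (simp add: if_distrib if_distribR cong: if_cong)
qed

section \<open>The character\<close>

lemma ee_cong:
  assumes "[A = B] (mod m)"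
  shows "ee (of_int A / of_int m) = ee (of_int B / of_int m)"
proof (rule ee_eqI)
  obtain k where k: "A - B = m * k" using assms by (auto simp: cong_iff_dvd_diff)
  have "of_int A / of_int m - of_int B / of_int m = (of_int (A - B) / of_int m :: real)"
    by (simp add: diff_divide_distrib)
  also have "\<dots> \<in> \<int>" unfolding k by simp
  finally show "of_int A / of_int m - of_int B / of_int m \<in> (\<int> :: real set)" .
qed

lemma ee_Psi:
  assumes "a * d - b * c = 1" "c > 0" "d > 0" "odd d"
  shows "ee (Psi a b c d / 24) = of_int (kronecker c d) * ee (of_int (petersson a b c d) / 24)"
proof -
  define J where "J = kronecker c d"
  have "coprime c d" using coprime_of_det[OF assms(1)] by (simp add: coprime_commute)
  then have J_sign: "J = 1 \<or> J = -1" using kronecker_in_signs[OF assms(3)] by (auto simp: J_def)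
  obtain P :: int where P: "Psi a b c d = of_int P" "[P = petersson a b c d + 6 * (1 - J)] (mod 24)"
    using Psi_cong_petersson[OF assms] unfolding J_def .
  have "ee (Psi a b c d / 24) = ee (of_int (petersson a b c d + 6 * (1 - J)) / 24)"
    using ee_cong[OF P(2)] by (simp add: P(1))
  also have "\<dots> = of_int J * ee (of_int (petersson a b c d) / 24)"
    using J_sign by (auto simp: add_divide_distrib ee_add ee_half)
  finally show ?thesis by (simp add: J_def)
qed

lemma qr_sign_eq_ee:
  assumes "odd m" "odd n"
  shows "of_int (qr_sign m n) = ee (of_int (eps4 m * (n - 1)) / 4)"
proof (cases "m mod 4 = 1 \<or> n mod 4 = 1")
  case True
  have "4 dvd n - 1" if "n mod 4 = 1" using that by presburger
  then have "[eps4 m * (n - 1) = 0] (mod 4)"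
    using True by (auto simp: eps4_def cong_iff_dvd_diff)
  from ee_cong[OF this] show ?thesis using True by (auto simp: qr_sign_def)
next
  case False
  then have residues: "m mod 4 = 3" "n mod 4 = 3" using assms odd_mod_4_cases by blast+
  moreover from this have "4 dvd n - 1 - 2" by presburger
  ultimately have "[eps4 m * (n - 1) = 2] (mod 4)" by (simp add: eps4_def cong_iff_dvd_diff)
  from ee_cong[OF this] show ?thesis using residues by (simp add: qr_sign_def ee_half)
qed

lemma sum_mult_cong_mod_4:
  assumes "\<And>n. n \<in> A \<Longrightarrow> odd (u n)"
  shows "[(\<Sum>n\<in>A. u n * v n) = (\<Sum>n\<in>A. v n) + 2 * eps4 (\<Prod>n\<in>A. u n ^ nat \<bar>v n\<bar>)] (mod 4)"
proof -
  have "[eps4 (u n) * v n = eps4 (u n ^ nat \<bar>v n\<bar>)] (mod 2)" if "n \<in> A" for n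
  proof -
    have "[v n = int (nat \<bar>v n\<bar>)] (mod 2)" by (auto simp: cong_iff_dvd_diff)
    then have "[eps4 (u n) * v n = int (nat \<bar>v n\<bar>) * eps4 (u n)] (mod 2)"
      unfolding mult.commute[of "int (nat _)"] by (rule cong_scalar_left)
    then show ?thesis
      using eps4_power[OF assms[OF that], of "nat \<bar>v n\<bar>"] cong_sym cong_trans by blast
  qed
  then have "[(\<Sum>n\<in>A. eps4 (u n) * v n) = (\<Sum>n\<in>A. eps4 (u n ^ nat \<bar>v n\<bar>))] (mod 2)"
    by (rule cong_sum)
  also have "[(\<Sum>n\<in>A. eps4 (u n ^ nat \<bar>v n\<bar>)) = eps4 (\<Prod>n\<in>A. u n ^ nat \<bar>v n\<bar>)] (mod 2)"
    using assms by (intro cong_sym[OF eps4_prod]) auto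
  finally have "[2 * (\<Sum>n\<in>A. eps4 (u n) * v n) = 2 * eps4 (\<Prod>n\<in>A. u n ^ nat \<bar>v n\<bar>)] (mod 2 * 2)"
    by (rule cong_cmult_leftI)
  then have eps4_sum: "[2 * (\<Sum>n\<in>A. eps4 (u n) * v n) = 2 * eps4 (\<Prod>n\<in>A. u n ^ nat \<bar>v n\<bar>)] (mod 4)"
    by simp
  have "[(\<Sum>n\<in>A. u n * v n) = (\<Sum>n\<in>A. (1 + 2 * eps4 (u n)) * v n)] (mod 4)"
    using assms by (intro cong_sum cong_scalar_right eps4_cong)
  also have "(\<Sum>n\<in>A. (1 + 2 * eps4 (u n)) * v n) = (\<Sum>n\<in>A. v n) + 2 * (\<Sum>n\<in>A. eps4 (u n) * v n)"
    by (simp add: distrib_right sum.distrib sum_distrib_left mult.assoc)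
  also have "[\<dots> = (\<Sum>n\<in>A. v n) + 2 * eps4 (\<Prod>n\<in>A. u n ^ nat \<bar>v n\<bar>)] (mod 4)"
    by (intro cong_add cong_refl eps4_sum)
  finally show ?thesis .
qed

lemma power_int_sign: "z = 1 \<or> z = -1 \<Longrightarrow> z powi v = z ^ nat \<bar>v\<bar>" for z :: "'a :: field"
  by (cases "v \<ge> 0") (auto simp: power_int_def)

lemma prod_power_int_sum: "z \<noteq> 0 \<Longrightarrow> (\<Prod>n\<in>A. z powi r n) = z powi (\<Sum>n\<in>A. r n)"
  for z :: "'a :: field"
  by (induction A rule: infinite_finite_induct) (auto simp: power_int_add)

definition yN :: "(nat \<Rightarrow> int) \<Rightarrow> int" where
  "yN r = (\<Sum>n\<in>supp r. int (level r div n) * r n)"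

text \<open>The integer $2(k + \delta)$ of the definition of $\psi_{l,\mathbf r}$.\<close>
definition wt_delta2 :: "(nat \<Rightarrow> int) \<Rightarrow> int" where
  "wt_delta2 r = wt2 r + 2 * eps4 (odd_part (varpi r))"

lemma delta_eq_eps4: "delta r = of_int (eps4 (odd_part (varpi r)))"
  by (simp add: delta_def odd_part_def eps4_def Let_def)

lemma wt_add_delta: "wt r + delta r = of_int (wt_delta2 r) / 2"
  by (simp add: wt_def delta_eq_eps4 wt_delta2_def add_divide_distrib)

lemma even_wt_delta2_iff [simp]: "even (wt_delta2 r) \<longleftrightarrow> even (wt2 r)"
  by (simp add: wt_delta2_def)

locale eta_exponents =
  fixes r :: "nat \<Rightarrow> int"
  assumes finite_supp: "finite (supp r)" and zero_notin_supp: "0 \<notin> supp r"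
begin

abbreviation "N \<equiv> level r"

abbreviation cofactor :: "nat \<Rightarrow> int" where
  "cofactor n \<equiv> int (N div n)"

lemma N_pos: "N > 0"
  using finite_supp zero_notin_supp by (auto simp: level_def Lcm_0_iff intro!: gr0I)

lemma mult_cofactor: "n \<in> supp r \<Longrightarrow> int n * cofactor n = int N"
  unfolding of_nat_mult[symmetric] level_def by (simp add: dvd_Lcm)

lemma cofactor_pos: "n \<in> supp r \<Longrightarrow> cofactor n > 0"
  using mult_cofactor[of n] N_pos by (cases "N div n = 0") auto

lemma varpi_pos: "varpi r > 0"
  unfolding varpi_def using cofactor_pos by (intro prod_pos) auto

lemma prime_dvd_varpi_imp_dvd_N:
  assumes "prime p" "int p dvd varpi r"
  shows "int p dvd int N"
proof -
  have prime: "prime (int p)" using assms(1) by simp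
  then obtain n where n: "n \<in> supp r" "int p dvd cofactor n ^ nat \<bar>r n\<bar>"
    using assms(2) unfolding varpi_def prime_dvd_prod_iff[OF finite_supp prime] by blast
  then have "int p dvd cofactor n" using prime prime_dvd_power by blast
  then show ?thesis using mult_cofactor[OF n(1)] by (metis dvd_mult)
qed

lemma odd_part_varpi: "odd_part (varpi r) = (\<Prod>n\<in>supp r. odd_part (cofactor n) ^ nat \<bar>r n\<bar>)"
  unfolding varpi_def using cofactor_pos by (subst odd_part_prod) (force simp: odd_part_power)+

lemma sum_odd_part_mod_4: "[(\<Sum>n\<in>supp r. odd_part (cofactor n) * r n) = wt_delta2 r] (mod 4)"
  unfolding wt_delta2_def wt2_def odd_part_varpi
  using cofactor_pos odd_odd_part by (intro sum_mult_cong_mod_4) force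

lemma multiplicity_varpi:
  "multiplicity 2 (varpi r) = (\<Sum>n\<in>supp r. multiplicity 2 (cofactor n) * nat \<bar>r n\<bar>)"
proof -
  have "multiplicity 2 (varpi r) = (\<Sum>n\<in>supp r. multiplicity 2 (cofactor n ^ nat \<bar>r n\<bar>))"
    unfolding varpi_def using finite_supp cofactor_pos
    by (intro prime_elem_multiplicity_prod_distrib) force+
  also have "\<dots> = (\<Sum>n\<in>supp r. multiplicity 2 (cofactor n) * nat \<bar>r n\<bar>)"
    using cofactor_pos
    by (intro sum.cong refl) (force simp: prime_elem_multiplicity_power_distrib mult.commute)
  finally show ?thesis .
qed

lemma kronecker_varpi_mult:
  assumes "t > 0" "odd t" "[a * t = 1] (mod int N)" "odd a \<Longrightarrow> [a * t = 1] (mod 8)"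
  shows "kronecker a (varpi r) * kronecker (varpi r) t = qr_sign (odd_part (varpi r)) t"
proof -
  have "kronecker (a * t) (varpi r) = 1"
  proof (rule kronecker_eq_1[OF varpi_pos])
    fix p :: nat assume p: "prime p" "int p dvd varpi r"
    then have "[a * t = 1] (mod int p)"
      using prime_dvd_varpi_imp_dvd_N assms(3) cong_dvd_modulus by blast
    moreover have "odd a" if "p = 2" using calculation that by (auto simp: cong_iff_dvd_diff)
    ultimately show "[a * t = 1] (mod (if p = 2 then 8 else int p))" using assms(4) by simp
  qed
  then have "kronecker a (varpi r) * kronecker t (varpi r) = 1"
    by (simp add: kronecker_mult_left varpi_pos)
  then show ?thesis
    using kronecker_reciprocity[OF varpi_pos assms(1,2)] by (simp add: mult.left_commute)
qed

lemma prod_kronecker_powi: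
  assumes "t > 0" "coprime t (int N * s)"
  shows "(\<Prod>n\<in>supp r. (of_int (kronecker (cofactor n * s) t) :: complex) powi r n)
    = of_int (kronecker (varpi r) t) * of_int (kronecker s t) powi wt2 r"
proof -
  have coprime: "coprime s t" "coprime (int N) t" using assms(2) by (auto simp: coprime_commute)
  have factor: "(of_int (kronecker (cofactor n * s) t) :: complex) powi r n
      = of_int (kronecker (cofactor n ^ nat \<bar>r n\<bar>) t) * of_int (kronecker s t) powi r n"
    if "n \<in> supp r" for n
  proof -
    have "cofactor n dvd int N" using mult_cofactor[OF that] by (metis dvd_triv_right)
    then have "kronecker (cofactor n) t \<in> {-1, 1}"
      using coprime(2) assms(1) by (meson kronecker_in_signs coprime_divisors dvd_refl)
    then show ?thesis using assms(1) power_int_sign[of "of_int (kronecker (cofactor n) t)" "r n"]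
      by (auto simp: kronecker_mult_left power_int_mult_distrib kronecker_power_left)
  qed
  have "of_int (kronecker s t) \<noteq> (0::complex)"
    using kronecker_in_signs[OF assms(1) coprime(1)] by auto
  then show ?thesis
    unfolding wt2_def varpi_def kronecker_prod_left[OF assms(1)] of_int_prod
    by (subst prod_power_int_sum[symmetric]) (auto simp: prod.distrib[symmetric] factor)
qed

definition chi_phase :: "int \<Rightarrow> int \<Rightarrow> int \<Rightarrow> int \<Rightarrow> int" where
  "chi_phase p q s t = (p + t) * s * yN r - q * t * (int N * s\<^sup>2 * yN r - xN r)
     + 3 * (t - 1) * wt2 r - 3 * s * t * yN r"

lemma sum_petersson_eq_chi_phase:
  "(\<Sum>n\<in>supp r. r n * petersson p (q * int n) (cofactor n * s) t) = chi_phase p q s t"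
proof -
  have "r n * petersson p (q * int n) (cofactor n * s) t
      = ((p + t) * s - q * t * int N * s\<^sup>2 - 3 * s * t) * (cofactor n * r n)
        + q * t * (int n * r n) + 3 * (t - 1) * r n" if "n \<in> supp r" for n
    unfolding petersson_def mult_cofactor[OF that, symmetric]
    by (simp add: algebra_simps power2_eq_square)
  then have "(\<Sum>n\<in>supp r. r n * petersson p (q * int n) (cofactor n * s) t)
      = ((p + t) * s - q * t * int N * s\<^sup>2 - 3 * s * t) * yN r + q * t * xN r + 3 * (t - 1) * wt2 r"
    unfolding yN_def xN_def wt2_def sum_distrib_left sum.distrib[symmetric]
    by (rule sum.cong[OF refl])
  then show ?thesis unfolding chi_phase_def by (simp add: algebra_simps)
qed

lemma chi_eq:
  assumes det: "p * t - q * (int N * s) = 1" and "s > 0" "t > 0" "odd t"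
  shows "chi r p q (int N * s) t 1
    = of_int (kronecker (varpi r) t) * of_int (kronecker s t) powi wt2 r
      * ee (of_int (chi_phase p q s t) / 24)"
proof -
  let ?c = "\<lambda>n. cofactor n * s" and ?Psi = "\<lambda>n. Psi p (q * int n) (int N * s div int n) t"
  let ?X = "\<lambda>n. petersson p (q * int n) (cofactor n * s) t"
  have factor: "ee (of_int (r n) * ?Psi n / 24)
     = of_int (kronecker (?c n) t) powi r n * ee (of_int (r n * ?X n) / 24)"
     if n: "n \<in> supp r" for n
  proof -
    have N_mult_s: "int N * s = int n * ?c n" by (simp flip: mult_cofactor[OF n])
    have "n > 0" using supp_pos[OF zero_notin_supp n] .
    have "p * t - q * int n * ?c n = 1" using det by (simp add: N_mult_s mult.assoc)
    moreover have "?c n > 0" using cofactor_pos[OF n] assms(2) by simp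
    ultimately have "ee (Psi p (q * int n) (?c n) t / 24)
        = of_int (kronecker (?c n) t) * ee (of_int (?X n) / 24)"
      using assms(3,4) by (rule ee_Psi)
    then have "ee (Psi p (q * int n) (?c n) t / 24) powi r n
        = of_int (kronecker (?c n) t) powi r n * ee (of_int (?X n) / 24) powi r n"
      by (simp add: power_int_mult_distrib)
    then show ?thesis using \<open>n > 0\<close> by (simp add: N_mult_s ee_powi)
  qed
  have "chi r p q (int N * s) t 1 = ee (\<Sum>n\<in>supp r. of_int (r n) * ?Psi n / 24)"
    by (simp add: chi_def sum_divide_distrib)
  also have "\<dots> = (\<Prod>n\<in>supp r. of_int (kronecker (?c n) t) powi r n)
      * ee (of_int (\<Sum>n\<in>supp r. r n * ?X n) / 24)"
    by (simp add: ee_sum finite_supp factor prod.distrib sum_divide_distrib)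
  finally show ?thesis
    using prod_kronecker_powi[OF assms(3) coprime_of_det[OF det]]
    by (simp only: sum_petersson_eq_chi_phase)
qed

end

section \<open>The weights of the Hecke sum\<close>

lemma dvd_24I: "8 dvd x \<Longrightarrow> 3 dvd x \<Longrightarrow> 24 dvd (x::int)"
  by presburger

lemma odd_part_cofactor_mod_8:
  assumes "int n * m = 2 * N'" "odd N'"
  shows "[N' * int n + m = 3 * odd_part m] (mod 8)"
proof (cases "odd n")
  case True
  then obtain i where i: "m = 2 * i"
    using assms(1) by (metis dvd_triv_left even_mult_iff even_of_nat dvdE)
  then have N': "N' = int n * i" using assms(1) by simp
  then have "odd_part m = i" using assms(2) odd_part_power_2_mult[of i 1] by (simp add: i)
  moreover have "[(int n)\<^sup>2 * i + 2 * i = 1 * i + 2 * i] (mod 8)"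
    using True by (intro cong_add cong_scalar_right cong_refl coprime_imp_square_cong_1)
      (auto simp: coprime_8_iff)
  ultimately show ?thesis by (simp add: i N' power2_eq_square algebra_simps)
next
  case False
  then obtain i where i: "int n = 2 * int i" by auto
  then have N': "N' = int i * m" using assms(1) by simp
  then have "odd_part m = m" "odd (int i)" using assms(2) odd_part_odd by auto
  moreover have "[2 * (int i)\<^sup>2 * m + m = 2 * 1 * m + m] (mod 8)"
    using \<open>odd (int i)\<close>
    by (intro cong_add cong_mult cong_refl coprime_imp_square_cong_1) (auto simp: coprime_8_iff)
  ultimately show ?thesis by (simp add: i N' power2_eq_square algebra_simps)
qed

lemma even_multiplicity_2_cofactor_iff:
  assumes "int n * m = 4 * j" "odd j"
  shows "even (multiplicity 2 m) \<longleftrightarrow> odd (int n + m)"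
proof -
  have "int n * m \<noteq> 0" using assms by auto
  then have nonzero: "int n \<noteq> 0" "m \<noteq> 0" by auto
  have "multiplicity 2 (int n * m) = 2"
    using assms by (intro multiplicity_decomposeI[of _ _ _ j]) auto
  then have "multiplicity 2 (int n) + multiplicity 2 m = 2"
    using nonzero by (simp add: prime_elem_multiplicity_mult_distrib)
  moreover have "multiplicity 2 (int n) = 0 \<longleftrightarrow> odd (int n)" "multiplicity 2 m = 0 \<longleftrightarrow> odd m"
    using nonzero by (auto simp: multiplicity_eq_zero_iff)
  ultimately show ?thesis by presburger
qed

context eta_exponents
begin

lemma four_dvd_wt_delta2_if_odd_N:
  assumes "odd N" "8 dvd yN r"
  shows "4 dvd wt_delta2 r"
proof -
  have "odd_part (cofactor n) = cofactor n" if "n \<in> supp r" for n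
    using mult_cofactor[OF that] assms(1) by (intro odd_part_odd) (metis even_mult_iff even_of_nat)
  then have "(\<Sum>n\<in>supp r. odd_part (cofactor n) * r n) = yN r"
    unfolding yN_def by (intro sum.cong) auto
  then have "[yN r = wt_delta2 r] (mod 4)" using sum_odd_part_mod_4 by simp
  moreover have "4 dvd yN r" using assms(2) by presburger
  ultimately show ?thesis by (metis cong_dvd_iff)
qed

lemma four_dvd_wt_delta2_if_N_2_mod_4:
  assumes "even N" "\<not> 4 dvd N" "8 dvd xN r" "8 dvd yN r"
  shows "4 dvd wt_delta2 r"
proof -
  obtain N' where N': "N = 2 * N'" using assms(1) by auto
  then have "odd (int N')" using assms(2) by auto
  then have "[int N' * int n + cofactor n = 3 * odd_part (cofactor n)] (mod 8)"
    if "n \<in> supp r" for n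
    using mult_cofactor[OF that] N' by (intro odd_part_cofactor_mod_8) simp_all
  then have "[(\<Sum>n\<in>supp r. (int N' * int n + cofactor n) * r n)
      = (\<Sum>n\<in>supp r. 3 * odd_part (cofactor n) * r n)] (mod 8)"
    by (intro cong_sum cong_scalar_right)
  then have "[int N' * xN r + yN r = 3 * (\<Sum>n\<in>supp r. odd_part (cofactor n) * r n)] (mod 8)"
    by (simp add: xN_def yN_def sum.distrib sum_distrib_left algebra_simps)
  moreover have "8 dvd int N' * xN r + yN r" using assms by simp
  ultimately have "8 dvd 3 * (\<Sum>n\<in>supp r. odd_part (cofactor n) * r n)"
    by (metis cong_dvd_iff)
  then have "4 dvd (\<Sum>n\<in>supp r. odd_part (cofactor n) * r n)" by presburger
  then show ?thesis using sum_odd_part_mod_4 by (metis cong_dvd_iff)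
qed

lemma odd_multiplicity_varpi:
  assumes "4 dvd N" "\<not> 8 dvd N" "even (xN r)" "even (yN r)" "odd (wt2 r)"
  shows "odd (multiplicity 2 (varpi r))"
proof -
  obtain j where j: "N = 4 * j" using assms(1) by blast
  then have "odd (int j)" using assms(2) by auto
  have "[int (multiplicity 2 (cofactor n) * nat \<bar>r n\<bar>)
       = r n + int n * r n + cofactor n * r n] (mod 2)" if n: "n \<in> supp r" for n
    using even_multiplicity_2_cofactor_iff[OF _ \<open>odd (int j)\<close>, of n "cofactor n"]
      mult_cofactor[OF n] j
    by (auto simp: cong_iff_dvd_diff even_nat_iff)
  then have "[int (multiplicity 2 (varpi r))
      = (\<Sum>n\<in>supp r. r n + int n * r n + cofactor n * r n)] (mod 2)"
    unfolding multiplicity_varpi of_nat_sum by (rule cong_sum)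
  also have "(\<Sum>n\<in>supp r. r n + int n * r n + cofactor n * r n) = wt2 r + xN r + yN r"
    by (simp add: wt2_def xN_def yN_def sum.distrib)
  finally show ?thesis using assms(3-5) by (metis cong_dvd_iff even_add even_of_nat)
qed

end

locale eta_hecke = eta_exponents +
  fixes l :: nat
  assumes l_in_Lf: "l \<in> Lf r"
begin

lemma l_pos: "l > 0" and l_square: "odd (wt2 r) \<Longrightarrow> \<exists>s. l = s\<^sup>2"
  using l_in_Lf by (auto simp: Lf_def)

lemma dvd_l_minus_1_mult:
  assumes "m dvd 24"
  shows "m dvd (int l - 1) * xN r" "m dvd (int l - 1) * yN r"
proof -
  define g where "g = gcd 24 (gcd (yN r) (xN r))"
  have "24 div g dvd int l - 1"
    using l_in_Lf by (simp add: Lf_def mf_def yN_def g_def cong_iff_dvd_diff)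
  moreover have "g dvd xN r" "g dvd yN r" unfolding g_def by (meson dvd_trans gcd_dvd1 gcd_dvd2)+
  ultimately have "24 div g * g dvd (int l - 1) * xN r" "24 div g * g dvd (int l - 1) * yN r"
    by (simp_all add: mult_dvd_mono)
  moreover have "24 div g * g = 24" by (simp add: g_def)
  ultimately show "m dvd (int l - 1) * xN r" "m dvd (int l - 1) * yN r"
    using assms dvd_trans by metis+
qed

lemma coprime_l_or_dvd:
  assumes "m \<in> {3, 8}"
  shows "coprime (int l) m \<or> m dvd xN r \<and> m dvd yN r"
proof -
  have "coprime (int l) m \<or> coprime (int l - 1) m"
    using assms by (auto simp: coprime_3_iff coprime_8_iff) presburger
  moreover have "m dvd (int l - 1) * xN r" "m dvd (int l - 1) * yN r"
    using assms dvd_l_minus_1_mult[of m] by auto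
  ultimately show ?thesis by (auto simp: coprime_dvd_mult_right_iff coprime_commute)
qed

lemma even_l_imp_dvd: "even l \<Longrightarrow> 8 dvd xN r" "even l \<Longrightarrow> 8 dvd yN r"
  using coprime_l_or_dvd[of 8] by (auto simp: coprime_8_iff)

lemma dvd_square_divisor_minus_1_mult:
  assumes "d dvd l"
  shows "24 dvd ((int d)\<^sup>2 - 1) * xN r"
proof -
  have "m dvd ((int d)\<^sup>2 - 1) * xN r" if m: "m \<in> {3, 8}" for m
  proof (cases "coprime (int l) m")
    case True
    then have "coprime (int d) m" using assms by (meson coprime_divisors dvd_refl int_dvd_int_iff)
    then show ?thesis using coprime_imp_square_cong_1[OF m] by (simp add: cong_iff_dvd_diff)
  next
    case False
    then show ?thesis using coprime_l_or_dvd[OF m] by simp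
  qed
  then show ?thesis by (intro dvd_24I) auto
qed

lemma chi_phase_stabilizer:
  "[chi_phase p q (int l * s) t = chi_phase p (int l * q) s t] (mod 24)"
proof -
  have "chi_phase p q (int l * s) t - chi_phase p (int l * q) s t
      = (int l - 1) * yN r * ((p + t) * s - q * t * int N * int l * s\<^sup>2 - 3 * s * t)
        - (int l - 1) * xN r * (q * t)"
    unfolding chi_phase_def by (simp add: algebra_simps power2_eq_square)
  also have "24 dvd \<dots>" using dvd_l_minus_1_mult[of 24] by simp
  finally show ?thesis by (simp add: cong_iff_dvd_diff)
qed

lemma kronecker_l_powi:
  assumes "t > 0" "coprime (int l) t"
  shows "of_int (kronecker (int l) t) powi wt2 r = (1 :: complex)"
proof (cases "even (wt2 r)")
  case True
  then show ?thesis using kronecker_in_signs[OF assms] by (auto simp: power_int_minus_left)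
next
  case False
  then obtain s where s: "l = s\<^sup>2" using l_square by blast
  then have "coprime (int s) t" using assms(2) by simp
  then have "kronecker (int l) t = 1"
    using kronecker_in_signs[OF assms(1)] assms(1) by (force simp: s kronecker_power_left)
  then show ?thesis by simp
qed

lemma chi_stabilizer:
  assumes det: "p * t - int l * q * (int N * s) = 1" and "s > 0" "t > 0" "odd t"
  shows "chi r p q (int N * (int l * s)) t 1 = chi r p (int l * q) (int N * s) t 1"
proof -
  have det': "p * t - q * (int N * (int l * s)) = 1" using det by (simp add: mult_ac)
  have "coprime (int l) t" using coprime_of_det[OF det'] by (auto simp: coprime_commute)
  then have "of_int (kronecker (int l * s) t) powi wt2 r
      = (of_int (kronecker s t) :: complex) powi wt2 r"
    using kronecker_l_powi assms(3) by (simp add: kronecker_mult_left power_int_mult_distrib)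
  moreover have "int l * s > 0" using l_pos assms(2) by simp
  ultimately show ?thesis
    using chi_eq[OF det' _ assms(3,4)] chi_eq[OF det assms(2-4)]
      ee_cong[OF chi_phase_stabilizer, of p q s t]
    by simp
qed

lemma psi_odd_l:
  assumes "odd l"
  shows "psi r l a b
    = ee (of_int (wt_delta2 r * ((int l - 1) * (int N - 1) - (int (l div a) - 1))) / 8)"
proof -
  have "- (wt r + delta r) / 4 * (real (l div a) - 1)
        + (wt r + delta r) * (real l - 1) * (real N - 1) / 4
      = of_int (wt_delta2 r * ((int l - 1) * (int N - 1) - (int (l div a) - 1))) / 8"
    unfolding wt_add_delta by (simp add: field_simps)
  then show ?thesis using assms by (simp only: psi_def Let_def if_True not_False_eq_True)
qed

lemma eight_dvd_wt_delta2_mult_N: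
  assumes "even l" "even N"
  obtains D :: int where "delta1 r l = of_int D" "8 dvd wt_delta2 r * int N * (1 + D)"
proof -
  define D :: int where
    "D = (if 4 dvd N \<and> odd (wt2 r) \<and> odd (multiplicity 2 (varpi r)) then 1 else 0)"
  have "delta1 r l = of_int D" using assms by (simp add: delta1_def D_def)
  moreover consider (not_4_dvd) "\<not> 4 dvd N" | (integral) "4 dvd N" "even (wt2 r)"
    | (eight_dvd) "8 dvd N" | (half_integral) "4 dvd N" "\<not> 8 dvd N" "odd (wt2 r)"
    by blast
  then have "8 dvd wt_delta2 r * int N * (1 + D)"
  proof cases
    case not_4_dvd
    then have "4 * 2 dvd wt_delta2 r * int N"
      using four_dvd_wt_delta2_if_N_2_mod_4 even_l_imp_dvd assms by (intro mult_dvd_mono) auto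
    then show ?thesis by simp
  next
    case integral
    then have "4 dvd int N" by presburger
    then have "2 * 4 dvd wt_delta2 r * int N" using integral by (intro mult_dvd_mono) simp_all
    then show ?thesis by simp
  next
    case eight_dvd
    then have "8 dvd int N" by presburger
    then show ?thesis by simp
  next
    case half_integral
    then have "odd (multiplicity 2 (varpi r))"
      using even_l_imp_dvd assms(1)
      by (intro odd_multiplicity_varpi) (auto dest: dvd_trans[of 2 8])
    moreover have "4 dvd int N" using half_integral by presburger
    ultimately show ?thesis using half_integral by (auto simp: D_def)
  qed
  ultimately show ?thesis using that by blast
qed

lemma psi_even_l:
  assumes "even l" "odd a"
  shows "psi r l a b = ee (of_int (wt_delta2 r * (1 - int a)) / 8)"
proof (cases "even N")
  case True
  obtain D :: int where D: "delta1 r l = of_int D" "8 dvd wt_delta2 r * int N * (1 + D)"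
    using eight_dvd_wt_delta2_mult_N[OF assms(1) True] .
  then obtain k where k: "wt_delta2 r * int N * (1 + D) = 8 * k" by blast
  have "- (wt r + delta r) / 4 * (real a - 1)
      - real N * (wt r + delta r) * (1 + delta1 r l) / 4 * real b
      = of_int (wt_delta2 r * (1 - int a)) / 8
        - of_int (wt_delta2 r * int N * (1 + D)) / 8 * real b"
    unfolding wt_add_delta D(1) by (simp add: field_simps)
  also have "\<dots> = of_int (wt_delta2 r * (1 - int a)) / 8 + of_int (- k * int b)"
    unfolding k by simp
  finally have "psi r l a b = ee (of_int (wt_delta2 r * (1 - int a)) / 8 + of_int (- k * int b))"
    using assms True by (simp only: psi_def Let_def if_True if_False not_True_eq_False)
  then show ?thesis by (simp only: ee_add ee_of_int mult_1_right)
next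
  case False
  then have "4 dvd wt_delta2 r"
    using four_dvd_wt_delta2_if_odd_N even_l_imp_dvd[OF assms(1)] by blast
  then have "4 * 2 dvd wt_delta2 r * (1 - int a)" using assms(2) by (intro mult_dvd_mono) auto
  then have "[wt_delta2 r * (1 - int a) = 0] (mod 8)" by (simp add: cong_0_iff)
  from ee_cong[OF this] show ?thesis using assms False by (simp add: psi_def Let_def)
qed

lemma eight_dvd_wt_delta2_mult_divisors:
  assumes "odd l" "a * d = l"
  shows "8 dvd wt_delta2 r * ((int a - 1) * (int d + 1))"
proof (cases "even (wt2 r)")
  case True
  have "even (int a - 1)" "even (int d + 1)" using assms by auto
  then have "2 * (2 * 2) dvd wt_delta2 r * ((int a - 1) * (int d + 1))"
    using True by (intro mult_dvd_mono) auto
  then show ?thesis by simp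
next
  case False
  then obtain s where s: "l = s\<^sup>2" using l_square by blast
  have "odd s" "odd a" using assms s by (auto, metis even_mult_iff even_power)
  then have squares: "8 dvd (int s)\<^sup>2 - 1" "8 dvd (int a)\<^sup>2 - 1"
    using coprime_imp_square_cong_1[of 8] by (auto simp: coprime_8_iff cong_iff_dvd_diff)
  have "int a * int d = (int s)\<^sup>2" using assms(2) s by (metis of_nat_mult of_nat_power)
  then have "int a * ((int a - 1) * (int d + 1)) = (int a - 1) * ((int s)\<^sup>2 - 1) + ((int a)\<^sup>2 - 1)"
    by (simp add: algebra_simps power2_eq_square)
  then have "8 dvd int a * ((int a - 1) * (int d + 1))" using squares by simp
  then have "8 dvd (int a - 1) * (int d + 1)"
    using \<open>odd a\<close> by (simp add: coprime_dvd_mult_right_iff coprime_8_iff coprime_commute)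
  then show ?thesis by simp
qed

lemma psi_1_0_conv_divisor:
  assumes "odd a" "a dvd l"
  shows "psi r l 1 0 = psi r l a b * ee (of_int (wt_delta2 r * (int a - 1)) / 8)"
proof (cases "even l")
  case True
  then show ?thesis
    using psi_even_l assms(1)
    by (simp add: add_divide_distrib[symmetric] algebra_simps flip: ee_add)
next
  case False
  obtain d where d: "l = a * d" using assms(2) by blast
  have "a > 0" using l_pos d by (cases a) auto
  then have "l div a = d" by (simp add: d)
  have "int l = int a * int d" by (simp add: d)
  then have "wt_delta2 r * ((int l - 1) * (int N - 1) - (int l - 1))
      - (wt_delta2 r * ((int l - 1) * (int N - 1) - (int d - 1)) + wt_delta2 r * (int a - 1))
      = - (wt_delta2 r * ((int a - 1) * (int d + 1)))"
    by (simp add: algebra_simps)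
  also have "8 dvd \<dots>" using eight_dvd_wt_delta2_mult_divisors False d by simp
  finally have "[wt_delta2 r * ((int l - 1) * (int N - 1) - (int l - 1))
      = wt_delta2 r * ((int l - 1) * (int N - 1) - (int d - 1))
        + wt_delta2 r * (int a - 1)] (mod 8)"
    by (simp only: cong_iff_dvd_diff)
  from ee_cong[OF this] show ?thesis
    using False \<open>l div a = d\<close> by (simp add: psi_odd_l add_divide_distrib ee_add)
qed

definition hecke_weight :: "nat \<Rightarrow> nat \<Rightarrow> complex" where
  "hecke_weight a b = of_int (kronecker (int a) (varpi r))
     * of_int (kronecker (- int N * int b) (int (gcd a (l div a)))) powi wt2 r
     * ee (- (real b * real (l div a) * of_int (xN r) / 24)) * psi r l a b"

lemma hecke_weight_1_0: "hecke_weight 1 0 = psi r l 1 0"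
  by (simp add: hecke_weight_def kronecker_1_left varpi_pos)

end

lemma square_cofactor_of_gcd:
  assumes "a * d = s\<^sup>2" "(a::nat) > 0"
  obtains u where "a = gcd a d * u\<^sup>2"
proof -
  define g where "g = gcd a d"
  have "g > 0" using assms(2) by (simp add: g_def)
  obtain a' d' where ad: "a = g * a'" "d = g * d'" "coprime a' d'"
    using gcd_coprime_exists[of a d] \<open>g > 0\<close> unfolding g_def by (metis mult.commute less_irrefl)
  have square: "g\<^sup>2 * (a' * d') = s\<^sup>2" using assms(1) ad by (simp add: power2_eq_square mult_ac)
  then have "g\<^sup>2 dvd s\<^sup>2" by (metis dvd_triv_left)
  then obtain h where "s = g * h" by (auto elim: dvdE)
  then have "a' * d' = h\<^sup>2" using square \<open>g > 0\<close> by (simp add: power_mult_distrib)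
  then have "is_nth_power 2 (a' * d')" by (auto simp: is_nth_power_def)
  moreover have "a' > 0" using ad assms(2) by (cases a') auto
  ultimately have "is_nth_power 2 a'"
    using is_nth_power_mult_coprime_natD[OF ad(3)] by (cases "d' = 0") (use ad in auto)
  then obtain u where "a' = u\<^sup>2" by (auto simp: is_nth_power_def)
  then show ?thesis using that ad(1) unfolding g_def by blast
qed

lemma kronecker_minus_eq_1:
  assumes "B > 0" "M > 0" "[M = 1] (mod 8)" "[M = 1] (mod B)"
  shows "kronecker (- B) M = 1"
proof -
  have M: "M mod 8 = 1" using assms(3) by (simp add: cong_def)
  then have "odd M" "M mod 4 = 1" by presburger+
  have "kronecker M B = 1"
    using assms by (intro kronecker_eq_1) (auto intro: cong_dvd_modulus)
  then have "kronecker B M = 1"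
    using kronecker_reciprocity[OF assms(1,2) \<open>odd M\<close>] \<open>M mod 4 = 1\<close> by (simp add: qr_sign_def)
  moreover have "kronecker (-1) M = 1"
    using kronecker_minus_one[OF assms(2) \<open>odd M\<close>] \<open>M mod 4 = 1\<close> by simp
  ultimately show ?thesis using kronecker_mult_left[OF assms(2), of "-1" B] by simp
qed

text \<open>Data for an element $(a, b'; N s, t)$ of $\Gamma_0(N)$ with $b' \equiv b$ modulo $d = l/a$.
  The divisibility conditions on \<open>s\<close> make its multiplier easy to compare with the weights.\<close>
locale hecke_coset = eta_hecke +
  fixes a b m :: nat and s t :: int
  assumes a_dvd_l: "a dvd l" and coprime_a_N: "coprime a N" and m_pos: "m > 0"
    and s_pos: "s > 0" and t_pos: "t > 0" and odd_t: "odd t"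
    and det: "int a * t - int (b + l div a * m) * (int N * s) = 1"
    and eight_dvd_s: "odd a \<Longrightarrow> 8 dvd s" and three_dvd_s: "\<not> 3 dvd a \<Longrightarrow> 3 dvd s"
begin

abbreviation "d \<equiv> l div a"
definition b_shift :: nat where "b_shift = b + d * m"

lemma l_eq: "l = a * d" and a_pos: "a > 0" and d_pos: "d > 0" and b_shift_pos: "b_shift > 0"
  using a_dvd_l l_pos m_pos by (auto intro!: gr0I simp: b_shift_def dvd_div_eq_0_iff)

lemma d_dvd_l: "d dvd l"
  by (metis l_eq dvd_triv_right)

lemma det_eq_1: "int a * t - int b_shift * (int N * s) = 1"
  using det by (simp add: b_shift_def)

lemma a_mult_t: "int a * t = 1 + int b_shift * int N * s"
  using det_eq_1 by (simp add: algebra_simps)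

lemma cong_a_mult_t:
  assumes "k dvd int N * s"
  shows "[int a * t = 1] (mod k)"
proof -
  have "int a * t - 1 = int b_shift * (int N * s)" by (simp add: a_mult_t mult.assoc)
  then show ?thesis using assms by (simp add: cong_iff_dvd_diff)
qed

lemma coprime_a_or_dvd:
  assumes "k \<in> {3, 8}"
  shows "coprime (int a) k \<and> k dvd s \<or> k dvd xN r \<and> k dvd yN r"
proof (cases "coprime (int a) k")
  case True
  moreover from this have "k dvd s"
    using assms eight_dvd_s three_dvd_s by (auto simp: coprime_3_iff coprime_8_iff) presburger
  ultimately show ?thesis by simp
next
  case False
  then have "\<not> coprime (int l) k"
    using a_dvd_l by (meson coprime_divisors dvd_refl int_dvd_int_iff)
  then show ?thesis using coprime_l_or_dvd[OF assms] by blast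
qed

lemma dvd_phase_difference:
  "24 dvd (int d - t) * int b_shift * xN r - s * yN r * (int d + int a - t - int a * t\<^sup>2)"
proof -
  have "k dvd (int d - t) * int b_shift * xN r - s * yN r * (int d + int a - t - int a * t\<^sup>2)"
    if k: "k \<in> {3, 8}" for k
    using coprime_a_or_dvd[OF k]
  proof
    assume coprime: "coprime (int a) k \<and> k dvd s"
    have "int l = int a * int d" by (metis l_eq of_nat_mult)
    then have "int a * ((int d - t) * xN r) = (int l - 1) * xN r - (int a * t - 1) * xN r"
      by (simp add: algebra_simps)
    also have "k dvd \<dots>"
      using k coprime dvd_l_minus_1_mult[of k] cong_a_mult_t[of k] by (auto simp: cong_iff_dvd_diff)
    finally have "k dvd (int d - t) * xN r"
      using coprime by (simp add: coprime_dvd_mult_right_iff coprime_commute)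
    then have "k dvd int b_shift * ((int d - t) * xN r)" by (rule dvd_mult)
    moreover have "k dvd s * yN r * (int d + int a - t - int a * t\<^sup>2)" using coprime by simp
    ultimately show ?thesis by (simp only: dvd_diff mult_ac)
  qed simp
  then show ?thesis by (intro dvd_24I) auto
qed

lemma chi_phase_cong:
  "[chi_phase 1 0 (s * int d) 1 + xN r * int m + 3 * (t - 1) * wt2 r
    = chi_phase (int a) (int b_shift) s t - int b * int d * xN r] (mod 24)"
proof -
  have "chi_phase (int a) (int b_shift) s t - int b * int d * xN r
      - (chi_phase 1 0 (s * int d) 1 + xN r * int m + 3 * (t - 1) * wt2 r)
      = ((int d)\<^sup>2 - 1) * xN r * int m
        - ((int d - t) * int b_shift * xN r - s * yN r * (int d + int a - t - int a * t\<^sup>2))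
        + (int a * t - 1 - int b_shift * int N * s) * (t * s * yN r)"
    unfolding chi_phase_def b_shift_def by (simp add: algebra_simps power2_eq_square)
  also have "\<dots> = ((int d)\<^sup>2 - 1) * xN r * int m
        - ((int d - t) * int b_shift * xN r - s * yN r * (int d + int a - t - int a * t\<^sup>2))"
    by (simp add: a_mult_t)
  also have "24 dvd \<dots>"
    by (intro dvd_diff[OF dvd_mult2[OF dvd_square_divisor_minus_1_mult]] d_dvd_l
        dvd_phase_difference)
  finally show ?thesis unfolding cong_iff_dvd_diff[symmetric] by (rule cong_sym)
qed

lemma even_a_imp:
  assumes "even a"
  shows "even l" "odd N" "4 dvd wt_delta2 r"
proof -
  show "even l" using a_dvd_l assms by (rule dvd_trans[rotated])
  show "odd N" using coprime_a_N assms by (auto dest: coprime_common_divisor)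
  then show "4 dvd wt_delta2 r" using four_dvd_wt_delta2_if_odd_N even_l_imp_dvd \<open>even l\<close> by blast
qed

lemma odd_a_if_odd_wt2:
  assumes "odd (wt2 r)"
  shows "odd a"
proof
  assume "even a"
  then have "4 dvd wt_delta2 r" by (rule even_a_imp(3))
  then have "even (wt_delta2 r)" by presburger
  then show False using assms by simp
qed

lemma coprime_a_mult_N_b_shift: "coprime (int a) (int N * int b_shift)"
proof -
  have "t * int a - (int N * s) * int b_shift = 1" using det_eq_1 by (simp add: mult.commute)
  then have "coprime (int a) (int b_shift)" by (rule coprime_of_det)
  then show ?thesis using coprime_a_N by simp
qed

lemma kronecker_gcd_eq:
  assumes "odd a"
  shows "kronecker (- int N * int b) (int (gcd a d))
    = kronecker (- (int N * int b_shift)) (int (gcd a d))"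
proof (rule kronecker_cong)
  have "- int N * int b - - (int N * int b_shift) = int d * (int N * int m)"
    by (simp add: b_shift_def algebra_simps)
  moreover have "int (gcd a d) dvd int d" by simp
  ultimately show "[- int N * int b = - (int N * int b_shift)] (mod int (gcd a d))"
    unfolding cong_iff_dvd_diff by (metis dvd_mult2)
  show "odd (int (gcd a d))" using assms by (metis dvd_trans even_of_nat gcd_dvd1)
qed (use a_pos in simp)

lemma kronecker_square_part:
  assumes "odd (wt2 r)"
  shows "kronecker (- (int N * int b_shift)) (int a)
    = kronecker (- (int N * int b_shift)) (int (gcd a d))"
proof -
  let ?B = "int N * int b_shift"
  obtain v where "a * d = v\<^sup>2" using l_square[OF assms] l_eq by metis
  then obtain u where u: "a = gcd a d * u\<^sup>2" using square_cofactor_of_gcd a_pos by metis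
  then have "u > 0" using a_pos by (cases u) auto
  have "int a = int (gcd a d) * (int u)\<^sup>2" by (metis u of_nat_mult of_nat_power)
  moreover from this have "coprime (- ?B) (int u)"
    using coprime_a_mult_N_b_shift by (auto simp: coprime_commute)
  then have "kronecker (- ?B) (int u) \<in> {-1, 1}" using \<open>u > 0\<close> by (intro kronecker_in_signs) auto
  then have "kronecker (- ?B) (int u) ^ 2 = 1" by auto
  ultimately show ?thesis
    using a_pos \<open>u > 0\<close> by (simp add: kronecker_mult_right kronecker_power_right)
qed

lemma half_integral_sign:
  assumes "odd (wt2 r)"
  shows "kronecker (- int N * int b) (int (gcd a d)) * kronecker s t = 1"
proof -
  let ?B = "int N * int b_shift"
  have "odd a" by (rule odd_a_if_odd_wt2[OF assms])
  have "kronecker (- ?B) (int a * t) = 1"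
  proof (rule kronecker_minus_eq_1)
    show "[int a * t = 1] (mod 8)" using eight_dvd_s[OF \<open>odd a\<close>] by (intro cong_a_mult_t) simp
    have "int a * t - 1 = ?B * s" using a_mult_t by (simp add: mult_ac)
    then show "[int a * t = 1] (mod ?B)" by (simp add: cong_iff_dvd_diff)
  qed (use N_pos b_shift_pos a_pos t_pos in simp_all)
  then have at: "kronecker (- ?B) (int a) * kronecker (- ?B) t = 1"
    using a_pos t_pos by (simp add: kronecker_mult_right)
  have "kronecker (- ?B * s) t = kronecker 1 t"
  proof (rule kronecker_cong[OF t_pos odd_t])
    have "- ?B * s - 1 = t * (- int a)" using a_mult_t by (simp add: algebra_simps)
    then show "[- ?B * s = 1] (mod t)" unfolding cong_iff_dvd_diff by (metis dvd_triv_left)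
  qed
  then have st: "kronecker (- ?B) t * kronecker s t = 1"
    using t_pos by (simp only: kronecker_mult_left kronecker_1_left)
  have "kronecker (- ?B) (int a) = kronecker s t"
    using at st by (metis mult.commute mult.left_commute mult.right_neutral)
  moreover have "kronecker s t * kronecker s t = 1"
    using st by (auto simp: zmult_eq_1_iff)
  ultimately show ?thesis
    using kronecker_gcd_eq[OF \<open>odd a\<close>] kronecker_square_part[OF assms] by simp
qed

lemma kronecker_signs_powi:
  "(of_int (kronecker (- int N * int b) (int (gcd a d))) * of_int (kronecker s t)) powi wt2 r
    = (1 :: complex)"
proof (cases "even (wt2 r)")
  case True
  have "coprime s t" using coprime_of_det[OF det_eq_1] by (auto simp: coprime_commute)
  then have "kronecker s t \<in> {-1, 1}" using t_pos by (intro kronecker_in_signs)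
  moreover have "kronecker (- int N * int b) (int (gcd a d)) \<in> {-1, 1}"
  proof (rule kronecker_in_signs)
    have "coprime (int (gcd a d)) (int N * int b_shift)"
      using coprime_a_mult_N_b_shift by (meson coprime_divisors dvd_refl gcd_dvd1 int_dvd_int_iff)
    moreover have "[int N * int b_shift = int N * int b] (mod int (gcd a d))"
      by (simp add: b_shift_def cong_iff_dvd_diff algebra_simps)
    ultimately show "coprime (- int N * int b) (int (gcd a d))"
      by (metis cong_imp_coprime coprime_commute coprime_minus_left_iff mult_minus_left)
  qed (use a_pos in simp)
  ultimately show ?thesis using True by (auto simp: power_int_minus_left)
next
  case False
  then show ?thesis using half_integral_sign by (simp flip: of_int_mult)
qed

lemma kronecker_a_varpi_mult:
  "of_int (kronecker (int a) (varpi r)) * of_int (kronecker (varpi r) t)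
    = ee (of_int (eps4 (odd_part (varpi r)) * (t - 1)) / 4)"
proof -
  have "[int a * t = 1] (mod 8)" if "odd (int a)"
    using that eight_dvd_s by (intro cong_a_mult_t) simp
  then have "kronecker (int a) (varpi r) * kronecker (varpi r) t = qr_sign (odd_part (varpi r)) t"
    using t_pos odd_t cong_a_mult_t by (intro kronecker_varpi_mult) auto
  moreover have "odd (odd_part (varpi r))" using varpi_pos by (intro odd_odd_part) simp
  ultimately show ?thesis using qr_sign_eq_ee odd_t by (metis of_int_mult)
qed

lemma psi_1_0_conv_t:
  "psi r l 1 0 = psi r l a b * ee (of_int (wt_delta2 r * (t - 1)) / 8)"
proof (cases "even a")
  case True
  then have "4 * 2 dvd wt_delta2 r * (t - 1)"
    using even_a_imp(3) odd_t by (intro mult_dvd_mono) auto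
  then have "[wt_delta2 r * (t - 1) = 0] (mod 8)" by (simp add: cong_0_iff)
  from ee_cong[OF this] show ?thesis using even_a_imp(1,2)[OF True] by (simp add: psi_def Let_def)
next
  case False
  have "[int a * t = (int a)\<^sup>2] (mod 8)"
    using False eight_dvd_s cong_a_mult_t[of 8] coprime_imp_square_cong_1[of 8 "int a"]
    by (auto simp: coprime_8_iff intro: cong_trans cong_sym)
  then have "[t = int a] (mod 8)"
    using False by (simp add: power2_eq_square cong_mult_lcancel coprime_8_iff)
  then have "[wt_delta2 r * (t - 1) = wt_delta2 r * (int a - 1)] (mod 8)"
    by (intro cong_scalar_left cong_diff cong_refl)
  from ee_cong[OF this] show ?thesis using psi_1_0_conv_divisor[OF False a_dvd_l, of b] by simp
qed

lemma ee_chi_phase: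
  "ee (of_int (chi_phase (int a) (int b_shift) s t) / 24)
      * ee (- (real b * real d * of_int (xN r) / 24))
    = ee (of_int (chi_phase 1 0 (s * int d) 1) / 24) * ee (of_int (xN r * int m) / 24)
      * ee (of_int (wt2 r * (t - 1)) / 8)"
proof -
  have "of_int (chi_phase 1 0 (s * int d) 1 + xN r * int m + 3 * (t - 1) * wt2 r) / (24::real)
      = of_int (chi_phase 1 0 (s * int d) 1) / 24 + of_int (xN r * int m) / 24
        + of_int (wt2 r * (t - 1)) / 8"
    "of_int (chi_phase (int a) (int b_shift) s t - int b * int d * xN r) / (24::real)
      = of_int (chi_phase (int a) (int b_shift) s t) / 24
        + - (real b * real d * of_int (xN r) / 24)"
    by (simp_all add: field_simps)
  then show ?thesis using ee_cong[OF chi_phase_cong] by (simp only: ee_add of_int_numeral)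
qed

theorem hecke_weight_chi:
  "hecke_weight 1 0 * chi r 1 0 (int N * (s * int d)) 1 1 * ee (of_int (xN r * int m) / 24)
    = hecke_weight a b * chi r (int a) (int b_shift) (int N * s) t 1"
proof -
  let ?w = "wt2 r" and ?u = "eps4 (odd_part (varpi r))"
  have weight: "ee (of_int (wt_delta2 r * (t - 1)) / 8)
      = ee (of_int (?u * (t - 1)) / 4) * ee (of_int (?w * (t - 1)) / 8)"
    unfolding ee_add[symmetric] by (rule arg_cong[of _ _ ee]) (simp add: wt_delta2_def field_simps)
  have "s * int d > 0" using s_pos d_pos by simp
  then have chi_unipotent:
    "chi r 1 0 (int N * (s * int d)) 1 1 = ee (of_int (chi_phase 1 0 (s * int d) 1) / 24)"
    using chi_eq[of 1 1 0 "s * int d"] by simp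
  have "hecke_weight a b * chi r (int a) (int b_shift) (int N * s) t 1
      = (of_int (kronecker (int a) (varpi r)) * of_int (kronecker (varpi r) t))
        * (of_int (kronecker (- int N * int b) (int (gcd a d))) * of_int (kronecker s t)) powi ?w
        * psi r l a b * (ee (of_int (chi_phase (int a) (int b_shift) s t) / 24)
          * ee (- (real b * real d * of_int (xN r) / 24)))"
    unfolding hecke_weight_def chi_eq[OF det_eq_1 s_pos t_pos odd_t] power_int_mult_distrib
    by (simp only: mult_ac)
  also have "\<dots> = psi r l a b * ee (of_int (wt_delta2 r * (t - 1)) / 8)
        * chi r 1 0 (int N * (s * int d)) 1 1 * ee (of_int (xN r * int m) / 24)"
    unfolding kronecker_signs_powi kronecker_a_varpi_mult ee_chi_phase weight chi_unipotent
    by (simp only: mult_ac mult_1_left)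
  also have "\<dots> = hecke_weight 1 0 * chi r 1 0 (int N * (s * int d)) 1 1
      * ee (of_int (xN r * int m) / 24)"
    unfolding hecke_weight_1_0 psi_1_0_conv_t[symmetric] ..
  finally show ?thesis by simp
qed

end

section \<open>The action of integral matrices\<close>

type_synonym mat2 = "int \<times> int \<times> int \<times> int"

fun mat_mult :: "mat2 \<Rightarrow> mat2 \<Rightarrow> mat2" (infixl "\<cdot>" 70) where
  "(a, b, c, d) \<cdot> (a', b', c', d') =
     (a * a' + b * c', a * b' + b * d', c * a' + d * c', c * b' + d * d')"

fun mat_det :: "mat2 \<Rightarrow> int" where
  "mat_det (a, b, c, d) = a * d - b * c"

fun mat_adj :: "mat2 \<Rightarrow> mat2" where
  "mat_adj (a, b, c, d) = (d, - b, - c, a)"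

fun mat_dvd :: "int \<Rightarrow> mat2 \<Rightarrow> bool" where
  "mat_dvd e (a, b, c, d) \<longleftrightarrow> e dvd a \<and> e dvd b \<and> e dvd c \<and> e dvd d"

fun mat_denom :: "mat2 \<Rightarrow> complex \<Rightarrow> complex" where
  "mat_denom (a, b, c, d) \<tau> = of_int c * \<tau> + of_int d"

fun mat_act :: "mat2 \<Rightarrow> complex \<Rightarrow> complex" where
  "mat_act (a, b, c, d) \<tau> = (of_int a * \<tau> + of_int b) / mat_denom (a, b, c, d) \<tau>"

definition Gamma0 :: "nat \<Rightarrow> mat2 set" where
  "Gamma0 n = {(a, b, c, d). a * d - b * c = 1 \<and> int n dvd c}"

lemma mat_mult_assoc: "(A \<cdot> B) \<cdot> C = A \<cdot> (B \<cdot> C)"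
  by (cases A; cases B; cases C) (simp add: algebra_simps)

lemma mat_det_mult: "mat_det (A \<cdot> B) = mat_det A * mat_det B"
  by (cases A; cases B) (simp add: algebra_simps)

lemma mat_mult_adj:
  assumes "mat_det A = 1"
  shows "A \<cdot> (mat_adj A \<cdot> B) = B" "mat_adj A \<cdot> (A \<cdot> B) = B"
    "B \<cdot> A \<cdot> mat_adj A = B" "B \<cdot> mat_adj A \<cdot> A = B"
proof -
  have inverse: "A \<cdot> mat_adj A = (1, 0, 0, 1)" "mat_adj A \<cdot> A = (1, 0, 0, 1)"
    using assms by (cases A; simp add: algebra_simps)+
  have one: "B \<cdot> (1, 0, 0, 1) = B" "(1, 0, 0, 1) \<cdot> B = B" by (cases B; simp)+
  show "A \<cdot> (mat_adj A \<cdot> B) = B" "mat_adj A \<cdot> (A \<cdot> B) = B"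
    by (simp_all only: inverse one flip: mat_mult_assoc)
  show "B \<cdot> A \<cdot> mat_adj A = B" "B \<cdot> mat_adj A \<cdot> A = B"
    by (simp_all only: mat_mult_assoc inverse one)
qed

lemma mat_dvd_mult: "mat_dvd e A \<Longrightarrow> mat_dvd e (A \<cdot> B)" "mat_dvd e A \<Longrightarrow> mat_dvd e (B \<cdot> A)"
  by (cases A; cases B; simp)+

lemma mat_det_Gamma0: "A \<in> Gamma0 n \<Longrightarrow> mat_det A = 1"
  by (auto simp: Gamma0_def)

lemma Gamma0_mult: "A \<in> Gamma0 n \<Longrightarrow> B \<in> Gamma0 n \<Longrightarrow> A \<cdot> B \<in> Gamma0 n"
  using mat_det_mult[of A B] by (cases A; cases B) (auto simp: Gamma0_def)

lemma Gamma0_adj: "A \<in> Gamma0 n \<Longrightarrow> mat_adj A \<in> Gamma0 n"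
  by (cases A) (auto simp: Gamma0_def algebra_simps)

lemma mat_denom_nonzero:
  assumes "\<tau> \<in> HH" "mat_det A \<noteq> 0"
  shows "mat_denom A \<tau> \<noteq> 0"
proof
  obtain a b c d where A: "A = (a, b, c, d)" by (cases A)
  assume zero: "mat_denom A \<tau> = 0"
  then have "Im (of_int c * \<tau> + of_int d) = 0" by (simp add: A)
  then have "c = 0" using assms(1) by (simp add: HH_def)
  then show False using zero assms(2) by (simp add: A)
qed

lemma mat_act_in_HH:
  assumes "\<tau> \<in> HH" "mat_det A > 0"
  shows "mat_act A \<tau> \<in> HH"
proof -
  obtain a b c d where A: "A = (a, b, c, d)" by (cases A)
  let ?z = "of_int c * \<tau> + of_int d"
  have "?z \<noteq> 0" using mat_denom_nonzero[OF assms(1), of A] assms(2) by (simp add: A)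
  then have "(Re ?z)\<^sup>2 + (Im ?z)\<^sup>2 > 0" by (simp add: complex_eq_iff sum_power2_gt_zero_iff)
  moreover have "Im (mat_act A \<tau>) = of_int (mat_det A) * Im \<tau> / ((Re ?z)\<^sup>2 + (Im ?z)\<^sup>2)"
    by (simp add: A Im_divide algebra_simps)
  moreover have "of_int (mat_det A) * Im \<tau> > 0" using assms by (simp add: HH_def)
  ultimately show ?thesis by (simp add: HH_def)
qed

lemma mat_denom_mult:
  assumes "mat_denom B \<tau> \<noteq> 0"
  shows "mat_denom (A \<cdot> B) \<tau> = mat_denom A (mat_act B \<tau>) * mat_denom B \<tau>"
  using assms by (cases A; cases B) (simp add: field_simps)

lemma mat_act_mult:
  assumes "\<tau> \<in> HH" "mat_det A > 0" "mat_det B > 0"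
  shows "mat_act (A \<cdot> B) \<tau> = mat_act A (mat_act B \<tau>)"
proof -
  have denom: "mat_denom B \<tau> \<noteq> 0" "mat_denom A (mat_act B \<tau>) \<noteq> 0"
    using assms mat_act_in_HH mat_denom_nonzero by (metis less_irrefl)+
  obtain a b c d a' b' c' d' where AB: "A = (a, b, c, d)" "B = (a', b', c', d')"
    by (cases A; cases B)
  have "of_int (a * a' + b * c') * \<tau> + of_int (a * b' + b * d')
      = (of_int a * mat_act B \<tau> + of_int b) * mat_denom B \<tau>"
    using denom(1) by (simp add: AB field_simps)
  then show ?thesis
    using denom mat_denom_mult[OF denom(1), of A] by (simp add: AB del: mat_denom.simps)
qed

lemma exists_odd_shift:
  fixes c t B :: int
  assumes "c > 0" "odd c \<or> odd t"
  obtains k where "k \<ge> 0" "odd (t + c * k)" "t + c * k > B"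
proof -
  define k0 where "k0 = \<bar>t\<bar> + \<bar>B\<bar> + 1"
  have large: "t + c * k > B" if "k \<ge> k0" for k
  proof -
    have "1 * k \<le> c * k" using assms(1) that by (intro mult_right_mono) (auto simp: k0_def)
    then show ?thesis using that unfolding k0_def by linarith
  qed
  have "odd (t + c * k0) \<or> odd (t + c * (k0 + 1))" using assms(2) by auto
  then show ?thesis using that[of k0] that[of "k0 + 1"] large by (auto simp: k0_def)
qed

lemma exists_odd_positive_bezout:
  fixes a B :: int
  assumes "a > 0" "B > 0" "coprime a B"
  obtains s t where "s > 0" "t > 0" "odd t" "a * t - B * s = 1"
proof -
  obtain u where "[a * u = 1] (mod B)" using cong_solve_coprime_int[OF assms(3)] by blast
  then obtain v where v: "a * u = 1 + B * v" by (metis cong_iff_lin cong_sym)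
  have "odd B \<or> odd u" using v by (metis even_add even_mult_iff odd_one)
  then obtain k where k: "odd (u + B * k)" "u + B * k > 1"
    using exists_odd_shift[OF assms(2)] by metis
  have bezout: "a * (u + B * k) - B * (v + a * k) = 1" using v by (simp add: algebra_simps)
  moreover have "1 * 1 < a * (u + B * k)" using assms(1) k(2) by (intro mult_le_less_imp_less) auto
  ultimately have "B * (v + a * k) > 0" by linarith
  then have "v + a * k > 0" using assms(2) by (simp add: zero_less_mult_iff)
  then show ?thesis using k by (intro that[OF _ _ k(1) bezout]) auto
qed

lemma coprime_shift_exists:
  fixes a b d :: nat
  assumes "a > 0" "gcd (gcd a b) d = 1"
  obtains m :: nat where "m > 0" "coprime a (b + d * m)"
proof -
  define P where "P = {p. prime p \<and> p dvd a \<and> \<not> p dvd b}"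
  have "finite P" by (rule finite_subset[OF _ finite_divisors_nat[OF assms(1)]]) (auto simp: P_def)
  have prime_dvd_iff: "p dvd \<Prod>P \<longleftrightarrow> p \<in> P" if "prime p" for p
  proof -
    have "p dvd \<Prod>P \<longleftrightarrow> (\<exists>q\<in>P. p dvd q)" using prime_dvd_prod_iff[OF \<open>finite P\<close> that, of id] by simp
    also have "\<dots> \<longleftrightarrow> p \<in> P" using that by (auto simp: P_def dest: primes_dvd_imp_eq)
    finally show ?thesis .
  qed
  have "\<not> p dvd b + d * \<Prod>P" if p: "prime p" "p dvd a" for p
  proof (cases "p dvd b")
    case True
    then have "\<not> p dvd d" using assms(2) p by (metis gcd_greatest not_prime_unit)
    moreover have "\<not> p dvd \<Prod>P" unfolding prime_dvd_iff[OF p(1)] using True by (simp add: P_def)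
    ultimately have "\<not> p dvd d * \<Prod>P" using p(1) by (simp add: prime_dvd_mult_iff)
    then show ?thesis using True by (simp add: dvd_add_right_iff)
  next
    case False
    then have "p \<in> P" using p by (simp add: P_def)
    then have "p dvd d * \<Prod>P" using prime_dvd_iff[OF p(1)] by simp
    then show ?thesis using False by (simp add: dvd_add_left_iff)
  qed
  then have "gcd a (b + d * \<Prod>P) = 1" using prime_factor_nat[of "gcd a (b + d * \<Prod>P)"] by auto
  then have "coprime a (b + d * \<Prod>P)" by (rule gcd_eq_1_imp_coprime)
  moreover have "\<Prod>P > 0" by (intro prod_pos) (auto simp: P_def prime_gt_0_nat)
  ultimately show ?thesis using that by blast
qed

lemma hermite_form:
  assumes "mat_det M > 0"
  obtains \<gamma> a b d where "\<gamma> \<in> Gamma0 1" "a > 0" "b < d" "M = \<gamma> \<cdot> (int a, int b, 0, int d)"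
proof -
  obtain P Q R S where M: "M = (P, Q, R, S)" by (cases M)
  define a where "a = gcd P R"
  have "P \<noteq> 0 \<or> R \<noteq> 0" using assms by (auto simp: M)
  then have "a > 0" by (simp add: a_def)
  obtain p s where PR: "P = p * a" "R = s * a"
    unfolding a_def by (metis dvdE gcd_dvd1 gcd_dvd2 mult.commute)
  obtain v u where "v * P + u * R = a" using bezout_int[of P R] unfolding a_def by blast
  then have "a * (v * p + u * s) = a * 1" by (simp add: PR algebra_simps)
  then have bezout: "v * p + u * s = 1" using \<open>a > 0\<close> by simp
  define \<gamma>0 where "\<gamma>0 = (p, - u, s, v)"
  have \<gamma>0: "mat_det \<gamma>0 = 1" using bezout by (simp add: \<gamma>0_def algebra_simps)
  define B D where "B = v * Q + u * S" and "D = p * S - s * Q"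
  have "a * (v * p + u * s) = a" using bezout by simp
  then have triangular: "mat_adj \<gamma>0 \<cdot> M = (a, B, 0, D)"
    by (simp add: \<gamma>0_def M PR B_def D_def algebra_simps)
  have "a * D > 0" using assms by (simp add: M PR D_def algebra_simps)
  then have "D > 0" using \<open>a > 0\<close> by (simp add: zero_less_mult_iff)
  define \<gamma> where "\<gamma> = \<gamma>0 \<cdot> (1, B div D, 0, 1)"
  have "M = \<gamma>0 \<cdot> (a, B, 0, D)" using mat_mult_adj(1)[OF \<gamma>0, of M] triangular by simp
  also have "(a, B, 0, D) = (1, B div D, 0, 1) \<cdot> (a, B mod D, 0, D)" by simp
  also have "\<gamma>0 \<cdot> \<dots> = \<gamma> \<cdot> (int (nat a), int (nat (B mod D)), 0, int (nat D))"
    using \<open>a > 0\<close> \<open>D > 0\<close> by (simp only: \<gamma>_def mat_mult_assoc) simp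
  finally have "M = \<gamma> \<cdot> (int (nat a), int (nat (B mod D)), 0, int (nat D))" .
  moreover have "\<gamma> \<in> Gamma0 1"
    using mat_det_mult[of \<gamma>0 "(1, B div D, 0, 1)"] \<gamma>0
    by (cases \<gamma>) (simp add: Gamma0_def \<gamma>_def[symmetric])
  moreover have "nat a > 0" "nat (B mod D) < nat D" using \<open>a > 0\<close> \<open>D > 0\<close> by simp_all
  ultimately show ?thesis using that by blast
qed

lemma Gamma0_of_triangular_mult:
  assumes "\<gamma> \<in> Gamma0 1" "\<gamma> \<cdot> (a, b, 0, d) = (P, Q, R, S)" "coprime P (int n)" "int n dvd R"
  shows "\<gamma> \<in> Gamma0 n" "coprime a (int n)"
proof -
  obtain p q s t where \<gamma>: "\<gamma> = (p, q, s, t)" by (cases \<gamma>)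
  have "p * a = P" "s * a = R" using assms(2) by (auto simp: \<gamma>)
  then show coprime: "coprime a (int n)" using assms(3) by auto
  have "int n dvd s" using assms(4) coprime \<open>s * a = R\<close>
    by (auto simp: coprime_dvd_mult_left_iff coprime_commute)
  then show "\<gamma> \<in> Gamma0 n" using assms(1) by (simp add: \<gamma> Gamma0_def)
qed

lemma csqrt_of_real_mult_powi:
  assumes "x > 0"
  shows "csqrt (of_real x * z) powi n = of_real (x powr (of_int n / 2)) * csqrt z powi n"
proof -
  have "csqrt (of_real x * z) = of_real (sqrt x) * csqrt z"
  proof (rule csqrt_unique)
    show "(of_real (sqrt x) * csqrt z)\<^sup>2 = of_real x * z"
      using assms by (simp add: power_mult_distrib flip: of_real_power)
    show "0 < Re (of_real (sqrt x) * csqrt z) \<or>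
          Re (of_real (sqrt x) * csqrt z) = 0 \<and> 0 \<le> Im (of_real (sqrt x) * csqrt z)"
      using csqrt_principal[of z] assms by auto
  qed
  moreover have "sqrt x powi n = x powr (of_int n / 2)"
    using assms by (simp add: powr_real_of_int'[symmetric] powr_half_sqrt[symmetric] powr_powr)
  ultimately show ?thesis by (simp add: power_int_mult_distrib flip: of_real_power_int)
qed

section \<open>The summands of the Hecke sum\<close>

lemma chi_nonzero: "chi r a b c d 1 \<noteq> 0"
  by (simp add: chi_def)

locale eta_hecke_form = eta_hecke +
  assumes transforms_f: "transforms r (eta_quot r)"
begin

abbreviation "f \<equiv> eta_quot r"

lemma f_nonzero: "\<tau> \<in> HH \<Longrightarrow> f \<tau> \<noteq> 0"
  using eta_quot_nonzero[OF finite_supp zero_notin_supp] .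

lemma f_mat_act:
  assumes "(p, q, s, t) \<in> Gamma0 N" "\<tau> \<in> HH"
  shows "f (mat_act (p, q, s, t) \<tau>)
    = chi r p q s t 1 * csqrt (mat_denom (p, q, s, t) \<tau>) powi wt2 r * f \<tau>"
proof -
  have "slash r f p q s t 1 \<tau> = chi r p q s t 1 * f \<tau>"
    using transforms_f assms unfolding transforms_def Gamma0_def by blast
  moreover have "mat_denom (p, q, s, t) \<tau> \<noteq> 0"
    using mat_denom_nonzero[OF assms(2), of "(p, q, s, t)"] mat_det_Gamma0[OF assms(1)] by simp
  ultimately show ?thesis by (simp add: slash_def power_int_minus field_simps)
qed

definition hecke_rep :: "nat \<Rightarrow> nat \<Rightarrow> mat2" where
  "hecke_rep a b = (int a, int b, 0, int (l div a))"

definition hecke_index :: "(nat \<times> nat) set" where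
  "hecke_index = {(a, b). a dvd l \<and> coprime a N \<and> b < l div a \<and> gcd (gcd a b) (l div a) = 1}"

definition hecke_const :: "nat \<Rightarrow> nat \<Rightarrow> complex" where
  "hecke_const a b = hecke_weight a b * of_real (real (l div a) powr (- wt r))"

definition hecke_ratio :: "nat \<Rightarrow> nat \<Rightarrow> complex \<Rightarrow> complex" where
  "hecke_ratio a b \<tau> = hecke_const a b * f (mat_act (hecke_rep a b) \<tau>) / f \<tau>"

lemma hecke_rep_1_0: "hecke_rep 1 0 = (1, 0, 0, int l)" "hecke_rep (Suc 0) 0 = (1, 0, 0, int l)"
  by (simp_all add: hecke_rep_def)

lemma mat_det_hecke_rep: "a dvd l \<Longrightarrow> mat_det (hecke_rep a b) = int l"
  by (simp add: hecke_rep_def flip: of_nat_mult)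

lemma hecke_rep_in_HH: "a dvd l \<Longrightarrow> \<tau> \<in> HH \<Longrightarrow> mat_act (hecke_rep a b) \<tau> \<in> HH"
  using mat_act_in_HH mat_det_hecke_rep l_pos by simp

lemma mat_act_hecke_rep: "mat_act (hecke_rep a b) \<tau> = (of_nat a * \<tau> + of_nat b) / of_nat (l div a)"
  by (simp add: hecke_rep_def)

lemma hecke_ratio_1_0_stabilizer_pos:
  assumes "(p, int l * q, int N * s, t) \<in> Gamma0 N" "s > 0" "t > 0" "odd t" "\<tau> \<in> HH"
  shows "hecke_ratio 1 0 (mat_act (p, int l * q, int N * s, t) \<tau>) = hecke_ratio 1 0 \<tau>"
proof -
  let ?\<gamma> = "(p, int l * q, int N * s, t)" and ?\<gamma>' = "(p, q, int N * (int l * s), t)"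
  let ?R = "hecke_rep 1 0"
  have det: "p * t - int l * q * (int N * s) = 1" using assms(1) by (simp add: Gamma0_def)
  then have \<gamma>': "?\<gamma>' \<in> Gamma0 N" by (simp add: Gamma0_def mult_ac)
  have R: "mat_det ?R > 0" using mat_det_hecke_rep[of 1 0] l_pos by simp
  have \<sigma>: "mat_act ?R \<tau> \<in> HH" using assms(5) by (intro hecke_rep_in_HH) auto
  have conj: "?R \<cdot> ?\<gamma> = ?\<gamma>' \<cdot> ?R" by (simp add: hecke_rep_1_0)
  have arg: "mat_act ?R (mat_act ?\<gamma> \<tau>) = mat_act ?\<gamma>' (mat_act ?R \<tau>)"
    using mat_act_mult[OF assms(5) R, of ?\<gamma>] mat_act_mult[OF assms(5) _ R, of ?\<gamma>']
      mat_det_Gamma0[OF assms(1)] mat_det_Gamma0[OF \<gamma>'] conj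
    by (simp del: mat_act.simps mat_mult.simps)
  have denom: "mat_denom ?\<gamma>' (mat_act ?R \<tau>) = mat_denom ?\<gamma> \<tau>"
    using l_pos by (simp add: hecke_rep_1_0)
  have "mat_denom ?\<gamma> \<tau> \<noteq> 0"
    using mat_denom_nonzero[OF assms(5), of ?\<gamma>] mat_det_Gamma0[OF assms(1)] by simp
  then show ?thesis
    unfolding hecke_ratio_def arg f_mat_act[OF assms(1,5)] f_mat_act[OF \<gamma>' \<sigma>] denom
      chi_stabilizer[OF det assms(2-4)]
    using chi_nonzero[of r p "int l * q" "int N * s" t] by (simp del: mat_denom.simps)
qed

lemma hecke_ratio_1_0_translate: "hecke_ratio 1 0 (\<tau> + of_int (int l * k)) = hecke_ratio 1 0 \<tau>"
proof -
  have "(\<tau> + of_int (int l * k)) / of_nat l = \<tau> / of_nat l + of_int k"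
    using l_pos by (simp add: field_simps)
  moreover have "[xN r * k = xN r * (int l * k)] (mod 24)"
  proof -
    have "xN r * k - xN r * (int l * k) = - k * ((int l - 1) * xN r)" by (simp add: algebra_simps)
    then show ?thesis unfolding cong_iff_dvd_diff using dvd_l_minus_1_mult[of 24] by simp
  qed
  then have "ee (of_int (xN r * k) / 24) = ee (of_int (xN r * (int l * k)) / 24)"
    using ee_cong by fastforce
  ultimately show ?thesis
    unfolding hecke_ratio_def mat_act_hecke_rep by (simp add: eta_quot_add_int del: of_int_mult)
qed

lemma hecke_ratio_1_0_stabilizer_lower_pos:
  assumes "(p, int l * q, s, t) \<in> Gamma0 N" "s > 0" "\<tau> \<in> HH"
  shows "hecke_ratio 1 0 (mat_act (p, int l * q, s, t) \<tau>) = hecke_ratio 1 0 \<tau>"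
proof -
  have det: "p * t - int l * q * s = 1" using assms(1) by (simp add: Gamma0_def)
  obtain s' where s': "s = int N * s'" using assms(1) by (auto simp: Gamma0_def)
  then have "s' > 0" using assms(2) N_pos by (simp add: zero_less_mult_iff)
  have "odd (p * t - int l * q * s)" using det by simp
  then have "odd (s * int l) \<or> odd t" by auto
  moreover have "s * int l > 0" using assms(2) l_pos by simp
  ultimately obtain k where k: "odd (t + s * int l * k)" "t + s * int l * k > 0"
    using exists_odd_shift by metis
  define \<sigma> where "\<sigma> = \<tau> - of_int (int l * k)"
  have \<sigma>: "\<sigma> \<in> HH" using assms(3) by (simp add: HH_def \<sigma>_def)
  have "(p, int l * (q + p * k), int N * s', t + s * int l * k) \<in> Gamma0 N"
    using det by (simp add: Gamma0_def s' algebra_simps)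
  moreover have "mat_act (p, int l * q, s, t) \<tau>
      = mat_act (p, int l * (q + p * k), int N * s', t + s * int l * k) \<sigma>"
    by (simp add: \<sigma>_def s' algebra_simps)
  ultimately have "hecke_ratio 1 0 (mat_act (p, int l * q, s, t) \<tau>) = hecke_ratio 1 0 \<sigma>"
    using hecke_ratio_1_0_stabilizer_pos[OF _ \<open>s' > 0\<close> k(2,1) \<sigma>] by (simp only:)
  then show ?thesis using hecke_ratio_1_0_translate[of \<sigma> k] by (simp add: \<sigma>_def)
qed

lemma hecke_ratio_1_0_stabilizer:
  assumes "(p, int l * q, s, t) \<in> Gamma0 N" "\<tau> \<in> HH"
  shows "hecke_ratio 1 0 (mat_act (p, int l * q, s, t) \<tau>) = hecke_ratio 1 0 \<tau>"
proof (cases s "0 :: int" rule: linorder_cases)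
  case greater
  then show ?thesis using hecke_ratio_1_0_stabilizer_lower_pos assms by blast
next
  case less
  have "(- p, int l * (- q), - s, - t) \<in> Gamma0 N" using assms(1) by (simp add: Gamma0_def)
  moreover have "mat_act (- p, int l * (- q), - s, - t) \<tau> = mat_act (p, int l * q, s, t) \<tau>"
    using minus_divide_divide[of "of_int p * \<tau> + of_int (int l * q)" "of_int s * \<tau> + of_int t"]
    by simp
  ultimately show ?thesis
    using hecke_ratio_1_0_stabilizer_lower_pos less assms(2) by (metis neg_0_less_iff_less)
next
  case equal
  then have "p * t = 1" using assms(1) by (simp add: Gamma0_def)
  then have "p = 1 \<and> t = 1 \<or> p = -1 \<and> t = -1" by (simp add: zmult_eq_1_iff)
  then have "mat_act (p, int l * q, s, t) \<tau> = \<tau> + of_int (int l * (q * p))"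
    using equal by auto
  then show ?thesis by (simp only: hecke_ratio_1_0_translate)
qed

end

locale hecke_coset_form = hecke_coset + eta_hecke_form
begin

abbreviation coset_mat :: mat2 where
  "coset_mat \<equiv> (int a, int b_shift, int N * s, t)"

abbreviation shear_mat :: mat2 where
  "shear_mat \<equiv> (1, 0, int N * (s * int d), 1)"

abbreviation shifted_rep :: mat2 where
  "shifted_rep \<equiv> (int a, int b_shift, 0, int d)"

lemma hecke_rep_coset:
  "hecke_rep 1 0 \<cdot> coset_mat = shear_mat \<cdot> shifted_rep"
  "shifted_rep = (1, int m, 0, 1) \<cdot> hecke_rep a b"
proof -
  have "int l = int a * int d" by (metis l_eq of_nat_mult)
  then have "int l * (int N * s) = int N * (s * int d) * int a" by simp
  moreover have "int l * t = int N * (s * int d) * int b_shift + int d"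
  proof -
    have "int l * t = int d * (int a * t)" using \<open>int l = int a * int d\<close> by simp
    then show ?thesis unfolding a_mult_t by (simp add: algebra_simps)
  qed
  ultimately show "hecke_rep 1 0 \<cdot> coset_mat = shear_mat \<cdot> shifted_rep"
    by (simp add: hecke_rep_1_0)
  show "shifted_rep = (1, int m, 0, 1) \<cdot> hecke_rep a b"
    by (simp add: hecke_rep_def b_shift_def algebra_simps)
qed

lemma coset_in_Gamma0:
  "coset_mat \<in> Gamma0 N" "shear_mat \<in> Gamma0 N"
  using det_eq_1 by (simp_all add: Gamma0_def)

lemma f_hecke_rep_1_0_coset:
  assumes "\<tau> \<in> HH"
  shows "f (mat_act (hecke_rep 1 0) (mat_act coset_mat \<tau>))
    = chi r 1 0 (int N * (s * int d)) 1 1 * ee (of_int (xN r * int m) / 24)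
      * of_real (real a powr wt r) * csqrt (mat_denom coset_mat \<tau>) powi wt2 r
      * f (mat_act (hecke_rep a b) \<tau>)"
proof -
  let ?R = "hecke_rep 1 0"
  have dets: "mat_det ?R > 0" "mat_det coset_mat > 0"
    "mat_det shear_mat > 0" "mat_det shifted_rep > 0"
    using mat_det_hecke_rep[of 1 0] l_pos det_eq_1 a_pos d_pos by simp_all
  have \<sigma>: "mat_act shifted_rep \<tau> \<in> HH" using assms dets(4) by (rule mat_act_in_HH)
  have arg: "mat_act ?R (mat_act coset_mat \<tau>) = mat_act shear_mat (mat_act shifted_rep \<tau>)"
    using mat_act_mult[OF assms dets(1,2)] mat_act_mult[OF assms dets(3,4)] hecke_rep_coset(1)
    by (simp del: mat_act.simps mat_mult.simps)
  have "of_nat d * mat_denom shear_mat (mat_act shifted_rep \<tau>)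
      = mat_denom (shear_mat \<cdot> shifted_rep) \<tau>"
    using mat_denom_mult[of shifted_rep \<tau> shear_mat] d_pos by (simp del: mat_mult.simps of_nat_div)
  also have "\<dots> = of_nat l * mat_denom coset_mat \<tau>"
    unfolding hecke_rep_coset(1)[symmetric] by (simp add: hecke_rep_1_0 algebra_simps)
  also have "(of_nat l :: complex) = of_nat d * of_nat a" by (metis l_eq of_nat_mult mult.commute)
  finally have denom:
    "mat_denom shear_mat (mat_act shifted_rep \<tau>) = of_real (real a) * mat_denom coset_mat \<tau>"
    using d_pos by (simp del: of_nat_div)
  have "csqrt (mat_denom shear_mat (mat_act shifted_rep \<tau>)) powi wt2 r
      = of_real (real a powr wt r) * csqrt (mat_denom coset_mat \<tau>) powi wt2 r"
    unfolding denom wt_def using a_pos by (intro csqrt_of_real_mult_powi) simp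
  moreover have "f (mat_act shifted_rep \<tau>)
      = ee (of_int (xN r * int m) / 24) * f (mat_act (hecke_rep a b) \<tau>)"
  proof -
    have "mat_act shifted_rep \<tau> = mat_act (hecke_rep a b) \<tau> + of_int (int m)"
      using d_pos by (simp add: mat_act_hecke_rep b_shift_def field_simps del: of_nat_div)
    then show ?thesis by (simp only: eta_quot_add_int)
  qed
  ultimately show ?thesis unfolding arg f_mat_act[OF coset_in_Gamma0(2) \<sigma>] by (simp only: mult_ac)
qed

lemma hecke_ratio_coset:
  assumes "\<tau> \<in> HH"
  shows "hecke_ratio 1 0 (mat_act coset_mat \<tau>) = hecke_ratio a b \<tau>"
proof -
  let ?chi = "chi r (int a) (int b_shift) (int N * s) t 1"
  have nonzero: "mat_denom coset_mat \<tau> \<noteq> 0"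
    using mat_denom_nonzero[OF assms, of coset_mat] det_eq_1 by simp
  have "real l = real a * real d" by (metis l_eq of_nat_mult)
  then have powr: "real l powr (- wt r) * real a powr wt r = real d powr (- wt r)"
    using a_pos d_pos by (simp add: powr_mult powr_minus field_simps)
  have "hecke_ratio 1 0 (mat_act coset_mat \<tau>)
      = (hecke_weight 1 0 * chi r 1 0 (int N * (s * int d)) 1 1 * ee (of_int (xN r * int m) / 24))
        * of_real (real l powr (- wt r) * real a powr wt r) * f (mat_act (hecke_rep a b) \<tau>)
        / (?chi * f \<tau>)"
    unfolding hecke_ratio_def hecke_const_def f_hecke_rep_1_0_coset[OF assms]
      f_mat_act[OF coset_in_Gamma0(1) assms] using nonzero by (simp del: mat_denom.simps)
  also have "\<dots> = hecke_ratio a b \<tau>"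
    unfolding hecke_weight_chi powr hecke_ratio_def hecke_const_def
    using chi_nonzero[of r "int a" "int b_shift" "int N * s" t] by simp
  finally show ?thesis .
qed

end

context eta_hecke_form
begin

lemma hecke_index_D:
  assumes "(a, b) \<in> hecke_index"
  shows "a dvd l" "coprime a N" "b < l div a" "gcd (gcd a b) (l div a) = 1"
    "a > 0" "l div a > 0" "l = a * (l div a)"
  using assms l_pos by (auto simp: hecke_index_def intro!: gr0I dest: dvd_imp_le)

lemma hecke_ratio_orbit:
  assumes "(a, b) \<in> hecke_index"
  obtains \<gamma> \<gamma>' where "\<gamma> \<in> Gamma0 N" "\<gamma>' \<in> Gamma0 N" "hecke_rep 1 0 \<cdot> \<gamma> = \<gamma>' \<cdot> hecke_rep a b"
    "\<And>\<tau>. \<tau> \<in> HH \<Longrightarrow> hecke_ratio 1 0 (mat_act \<gamma> \<tau>) = hecke_ratio a b \<tau>"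
proof -
  note ab = hecke_index_D[OF assms]
  obtain m where m: "m > 0" "coprime a (b + l div a * m)"
    using coprime_shift_exists[OF ab(5,4)] .
  define M :: int where "M = (if odd a then 8 else 1) * (if 3 dvd a then 1 else 3)"
  have "3 dvd int a \<longleftrightarrow> 3 dvd a" by presburger
  then have "coprime (int a) M" by (auto simp: M_def coprime_8_iff coprime_3_iff)
  moreover have "coprime (int a) (int (b + l div a * m))" using m(2) by (simp only: coprime_int_iff)
  moreover have "int (b + l div a * m) * int N * M > 0"
    using m(1) ab(6) N_pos by (simp add: M_def add_nonneg_pos)
  ultimately obtain s0 t where st: "s0 > 0" "t > 0" "odd t"
    "int a * t - int (b + l div a * m) * int N * M * s0 = 1"
    using exists_odd_positive_bezout[of "int a" "int (b + l div a * m) * int N * M"] ab(2,5) by auto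
  interpret hecke_coset_form r l a b m "M * s0" t
  proof
    show "int a * t - int (b + l div a * m) * (int N * (M * s0)) = 1"
      using st(4) by (simp only: mult.assoc)
    show "M * s0 > 0" using st(1) by (simp add: M_def)
  qed (use ab m st in \<open>auto simp: M_def\<close>)
  have "shear_mat \<cdot> (1, int m, 0, 1) \<in> Gamma0 N"
    using coset_in_Gamma0(2) by (intro Gamma0_mult) (simp_all add: Gamma0_def)
  moreover have "hecke_rep 1 0 \<cdot> coset_mat = (shear_mat \<cdot> (1, int m, 0, 1)) \<cdot> hecke_rep a b"
    unfolding hecke_rep_coset(1) mat_mult_assoc hecke_rep_coset(2)[symmetric] ..
  ultimately show ?thesis
    using that coset_in_Gamma0(1) hecke_ratio_coset by blast
qed

lemma hecke_ratio_mat_act: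
  assumes A: "(a, b) \<in> hecke_index" and A': "(a', b') \<in> hecke_index"
    and \<gamma>: "\<gamma> \<in> Gamma0 N" "\<gamma>' \<in> Gamma0 N" "hecke_rep a b \<cdot> \<gamma> = \<gamma>' \<cdot> hecke_rep a' b'"
    and \<tau>: "\<tau> \<in> HH"
  shows "hecke_ratio a b (mat_act \<gamma> \<tau>) = hecke_ratio a' b' \<tau>"
proof -
  obtain g g' where g: "g \<in> Gamma0 N" "g' \<in> Gamma0 N" "hecke_rep 1 0 \<cdot> g = g' \<cdot> hecke_rep a b"
    and ratio_g: "\<And>\<tau>. \<tau> \<in> HH \<Longrightarrow> hecke_ratio 1 0 (mat_act g \<tau>) = hecke_ratio a b \<tau>"
    using hecke_ratio_orbit[OF A] by blast
  obtain h h' where h: "h \<in> Gamma0 N" "h' \<in> Gamma0 N" "hecke_rep 1 0 \<cdot> h = h' \<cdot> hecke_rep a' b'"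
    and ratio_h: "\<And>\<tau>. \<tau> \<in> HH \<Longrightarrow> hecke_ratio 1 0 (mat_act h \<tau>) = hecke_ratio a' b' \<tau>"
    using hecke_ratio_orbit[OF A'] by blast
  define \<delta> \<delta>' where "\<delta> = g \<cdot> \<gamma> \<cdot> mat_adj h" and "\<delta>' = g' \<cdot> \<gamma>' \<cdot> mat_adj h'"
  have \<delta>: "\<delta> \<in> Gamma0 N" unfolding \<delta>_def using g h \<gamma> by (intro Gamma0_mult Gamma0_adj)
  note dets = mat_det_Gamma0[OF h(1)] mat_det_Gamma0[OF h(2)] mat_det_Gamma0[OF g(1)]
    mat_det_Gamma0[OF \<gamma>(1)] mat_det_Gamma0[OF \<delta>]
  have "hecke_rep a' b' = mat_adj h' \<cdot> (hecke_rep 1 0 \<cdot> h)"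
    unfolding h(3) mat_mult_adj[OF dets(2)] ..
  then have "hecke_rep 1 0 \<cdot> \<delta> = g' \<cdot> \<gamma>' \<cdot> (mat_adj h' \<cdot> (hecke_rep 1 0 \<cdot> h)) \<cdot> mat_adj h"
    unfolding \<delta>_def mat_mult_assoc[symmetric] g(3) by (simp only: mat_mult_assoc \<gamma>(3))
  also have "\<dots> = \<delta>' \<cdot> (hecke_rep 1 0 \<cdot> h \<cdot> mat_adj h)" by (simp only: \<delta>'_def mat_mult_assoc)
  also have "\<dots> = \<delta>' \<cdot> hecke_rep 1 0" unfolding mat_mult_adj[OF dets(1)] ..
  finally have stabilizer: "hecke_rep 1 0 \<cdot> \<delta> = \<delta>' \<cdot> hecke_rep 1 0" .
  obtain p q s t p' q' s' t' where entries: "\<delta> = (p, q, s, t)" "\<delta>' = (p', q', s', t')"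
    by (cases \<delta>; cases \<delta>')
  have "q = int l * q'" using stabilizer by (simp add: entries hecke_rep_1_0 mult.commute)
  have HH: "mat_act h \<tau> \<in> HH" "mat_act \<gamma> \<tau> \<in> HH" using mat_act_in_HH[OF \<tau>] dets by auto
  have "hecke_ratio 1 0 (mat_act h \<tau>) = hecke_ratio 1 0 (mat_act \<delta> (mat_act h \<tau>))"
    using hecke_ratio_1_0_stabilizer[of p q' s t] \<delta> HH(1) by (simp only: entries \<open>q = int l * q'\<close>)
  also have "mat_act \<delta> (mat_act h \<tau>) = mat_act (\<delta> \<cdot> h) \<tau>" using \<tau> dets by (simp add: mat_act_mult)
  also have "\<delta> \<cdot> h = g \<cdot> \<gamma>" unfolding \<delta>_def mat_mult_adj[OF dets(1)] ..
  also have "mat_act (g \<cdot> \<gamma>) \<tau> = mat_act g (mat_act \<gamma> \<tau>)" using \<tau> dets by (simp add: mat_act_mult)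
  finally show ?thesis using ratio_g[OF HH(2)] ratio_h[OF \<tau>] by simp
qed

end

section \<open>The Hecke sum as a modular form\<close>

lemma sum_eq_by_matching:
  assumes "finite I" "\<And>A. A \<in> I \<Longrightarrow> \<exists>B\<in>I. P A B"
    and "\<And>A A' B. A \<in> I \<Longrightarrow> A' \<in> I \<Longrightarrow> P A B \<Longrightarrow> P A' B \<Longrightarrow> A = A'"
    and "\<And>A B. A \<in> I \<Longrightarrow> B \<in> I \<Longrightarrow> P A B \<Longrightarrow> u A = v B"
  shows "sum u I = sum v I"
proof -
  obtain h where h: "\<And>A. A \<in> I \<Longrightarrow> h A \<in> I" "\<And>A. A \<in> I \<Longrightarrow> P A (h A)"
    using assms(2) by metis
  have "inj_on h I" using assms(3) h by (metis inj_onI)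
  then have "bij_betw h I I"
    using assms(1) h(1) by (simp add: bij_betw_def endo_inj_surj image_subset_iff)
  then have "sum v I = (\<Sum>A\<in>I. v (h A))" by (rule sum.reindex_bij_betw[symmetric])
  also have "\<dots> = sum u I" using assms(4)[OF _ h(1) h(2)] by (intro sum.cong) simp_all
  finally show ?thesis by simp
qed

context eta_hecke_form
begin

lemma hecke_index_Sigma:
  "hecke_index =
     (SIGMA a:{a. a dvd l \<and> coprime a N}. {b. b < l div a \<and> gcd (gcd a b) (l div a) = 1})"
  by (auto simp: hecke_index_def)

lemma finite_divisors_l: "finite {a. a dvd l \<and> coprime a N}"
  using l_pos by (auto intro: finite_subset[OF _ finite_divisors_nat[of l]])

lemma finite_hecke_index: "finite hecke_index"
  unfolding hecke_index_Sigma by (intro finite_SigmaI finite_divisors_l) auto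

lemma mat_dvd_hecke_rep:
  assumes "(a, b) \<in> hecke_index" "mat_dvd e (hecke_rep a b)"
  shows "is_unit e"
proof -
  have "e dvd int (gcd (gcd a b) (l div a))"
    using assms(2) by (simp add: hecke_rep_def flip: gcd_int_int_eq)
  then show ?thesis using hecke_index_D(4)[OF assms(1)] by simp
qed

lemma mat_dvd_hecke_rep_gcd: "mat_dvd (int (gcd (gcd a b) (l div a))) (hecke_rep a b)"
  by (auto simp: hecke_rep_def intro: dvd_trans[OF gcd_dvd1] simp flip: gcd_int_int_eq)

lemma hecke_rep_mult_first_column:
  assumes "(a, b) \<in> hecke_index" "\<gamma> \<in> Gamma0 N" "hecke_rep a b \<cdot> \<gamma> = (P, Q, R, S)"
  shows "coprime P (int N)" "int N dvd R"
proof -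
  obtain p q s t where \<gamma>: "\<gamma> = (p, q, s, t)" by (cases \<gamma>)
  have det: "p * t - q * s = 1" and "int N dvd s" using assms(2) by (auto simp: \<gamma> Gamma0_def)
  have entries: "P = int a * p + int b * s" "R = int (l div a) * s"
    using assms(3) by (simp_all add: hecke_rep_def \<gamma>)
  have "coprime p s" using det by (intro coprime_of_det[of t p q s]) (simp add: mult.commute)
  then have "coprime (int a * p) (int N)"
    using hecke_index_D(2)[OF assms(1)] \<open>int N dvd s\<close> by (auto intro: coprime_divisors[OF dvd_refl])
  moreover have "[P = int a * p] (mod int N)"
    using \<open>int N dvd s\<close> by (simp add: entries cong_iff_dvd_diff)
  ultimately show "coprime P (int N)" by (metis cong_imp_coprime cong_sym)
  show "int N dvd R" using \<open>int N dvd s\<close> by (simp add: entries)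
qed

lemma hecke_rep_mult_Gamma0:
  assumes "(a, b) \<in> hecke_index" "\<gamma> \<in> Gamma0 N"
  obtains a' b' \<gamma>' where "(a', b') \<in> hecke_index" "\<gamma>' \<in> Gamma0 N"
    "hecke_rep a b \<cdot> \<gamma> = \<gamma>' \<cdot> hecke_rep a' b'"
proof -
  note dets = mat_det_hecke_rep[OF hecke_index_D(1)[OF assms(1)]] mat_det_Gamma0[OF assms(2)]
  define M where "M = hecke_rep a b \<cdot> \<gamma>"
  have "mat_det M = int l" by (simp only: M_def mat_det_mult dets mult_1_right)
  then obtain \<gamma>' a' b' d' where \<gamma>': "\<gamma>' \<in> Gamma0 1" and "a' > 0" "b' < d'"
    and M: "M = \<gamma>' \<cdot> (int a', int b', 0, int d')"
    using hermite_form[of M] l_pos by (metis of_nat_0_less_iff)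
  have "int l = int a' * int d'"
    using \<open>mat_det M = int l\<close> mat_det_Gamma0[OF \<gamma>'] by (simp add: M mat_det_mult)
  then have "l = a' * d'" by (metis of_nat_eq_iff of_nat_mult)
  then have "a' dvd l" "l div a' = d'" using \<open>a' > 0\<close> by simp_all
  then have rep: "hecke_rep a' b' = (int a', int b', 0, int d')" by (simp add: hecke_rep_def)
  obtain P Q R S where "M = (P, Q, R, S)" by (cases M)
  then have "\<gamma>' \<in> Gamma0 N" "coprime (int a') (int N)"
    using Gamma0_of_triangular_mult[OF \<gamma>'] hecke_rep_mult_first_column[OF assms] M M_def by metis+
  moreover have "gcd (gcd a' b') d' = 1"
  proof -
    let ?e = "int (gcd (gcd a' b') d')"
    have "mat_dvd ?e (\<gamma>' \<cdot> hecke_rep a' b' \<cdot> mat_adj \<gamma>)"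
      using mat_dvd_hecke_rep_gcd[of a' b'] \<open>l div a' = d'\<close> by (intro mat_dvd_mult) simp
    then have "mat_dvd ?e (hecke_rep a b)"
      unfolding rep M[symmetric] M_def mat_mult_adj[OF dets(2)] .
    from mat_dvd_hecke_rep[OF assms(1) this] show ?thesis by simp
  qed
  ultimately have "(a', b') \<in> hecke_index"
    using \<open>a' dvd l\<close> \<open>l div a' = d'\<close> \<open>b' < d'\<close> by (simp add: hecke_index_def)
  then show ?thesis using that \<open>\<gamma>' \<in> Gamma0 N\<close> M by (simp only: M_def rep)
qed

lemma hecke_rep_unique:
  assumes "(a, b) \<in> hecke_index" "(a', b') \<in> hecke_index" "mat_det \<gamma> = 1"
    "hecke_rep a b = \<gamma> \<cdot> hecke_rep a' b'"
  shows "(a, b) = (a', b')"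
proof -
  note ab = hecke_index_D[OF assms(1)] and ab' = hecke_index_D[OF assms(2)]
  obtain p q s t where \<gamma>: "\<gamma> = (p, q, s, t)" by (cases \<gamma>)
  have entries: "int a = p * int a'" "int b = p * int b' + q * int (l div a')" "s * int a' = 0"
    using assms(4) by (simp_all add: hecke_rep_def \<gamma>)
  then have "s = 0" using ab'(5) by simp
  then have "p * t = 1" using assms(3) by (simp add: \<gamma>)
  moreover have "p > 0"
    using entries(1) ab(5) ab'(5) by (metis of_nat_0_less_iff zero_less_mult_pos2)
  ultimately have "p = 1" by (auto simp: zmult_eq_1_iff)
  then have "a = a'" using entries(1) by simp
  moreover have "int b mod int (l div a') = int b' mod int (l div a')"
    using entries(2) \<open>p = 1\<close> by simp
  ultimately show ?thesis using ab(3) ab'(3) by (simp flip: of_nat_mod)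
qed

lemma sum_hecke_ratio_mat_act:
  assumes "\<gamma> \<in> Gamma0 N" "\<tau> \<in> HH"
  shows "(\<Sum>(a, b)\<in>hecke_index. hecke_ratio a b (mat_act \<gamma> \<tau>))
    = (\<Sum>(a, b)\<in>hecke_index. hecke_ratio a b \<tau>)"
proof (rule sum_eq_by_matching[OF finite_hecke_index])
  let ?P = "\<lambda>(a, b) (a', b'). \<exists>\<gamma>'\<in>Gamma0 N. hecke_rep a b \<cdot> \<gamma> = \<gamma>' \<cdot> hecke_rep a' b'"
  show "\<exists>B\<in>hecke_index. ?P A B" if index: "A \<in> hecke_index" for A
  proof -
    obtain a b where A: "A = (a, b)" by (cases A)
    obtain a' b' \<gamma>' where "(a', b') \<in> hecke_index" "\<gamma>' \<in> Gamma0 N"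
      "hecke_rep a b \<cdot> \<gamma> = \<gamma>' \<cdot> hecke_rep a' b'"
      using hecke_rep_mult_Gamma0[OF index[unfolded A] assms(1)] .
    then show ?thesis unfolding A by blast
  qed
  show "(case A of (a, b) \<Rightarrow> hecke_ratio a b (mat_act \<gamma> \<tau>)) = (case B of (a, b) \<Rightarrow> hecke_ratio a b \<tau>)"
    if "A \<in> hecke_index" "B \<in> hecke_index" "?P A B" for A B
    using that hecke_ratio_mat_act[OF _ _ assms(1) _ _ assms(2)] by (cases A; cases B) auto
  show "A = A'" if A: "A \<in> hecke_index" "A' \<in> hecke_index" and P: "?P A B" "?P A' B" for A A' B
  proof -
    obtain a b a' b' a'' b'' where AB: "A = (a, b)" "A' = (a', b')" "B = (a'', b'')"
      by (cases A; cases A'; cases B)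
    obtain g g' where g: "g \<in> Gamma0 N" "hecke_rep a b \<cdot> \<gamma> = g \<cdot> hecke_rep a'' b''"
      and g': "g' \<in> Gamma0 N" "hecke_rep a' b' \<cdot> \<gamma> = g' \<cdot> hecke_rep a'' b''"
      using P by (auto simp: AB)
    note dets = mat_det_Gamma0[OF assms(1)] mat_det_Gamma0[OF g'(1)]
    have "hecke_rep a'' b'' = mat_adj g' \<cdot> (hecke_rep a' b' \<cdot> \<gamma>)"
      unfolding g'(2) mat_mult_adj[OF dets(2)] ..
    then have "hecke_rep a b \<cdot> \<gamma> = (g \<cdot> mat_adj g') \<cdot> hecke_rep a' b' \<cdot> \<gamma>"
      unfolding g(2) by (simp only: mat_mult_assoc)
    then have "hecke_rep a b = (g \<cdot> mat_adj g') \<cdot> hecke_rep a' b'"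
      using mat_mult_adj(3)[OF dets(1)] by metis
    moreover have "mat_det (g \<cdot> mat_adj g') = 1"
      by (rule mat_det_Gamma0[OF Gamma0_mult[OF g(1) Gamma0_adj[OF g'(1)]]])
    ultimately show ?thesis using hecke_rep_unique A by (simp only: AB)
  qed
qed

definition hecke_sum :: "complex \<Rightarrow> complex" where
  "hecke_sum \<tau> = (\<Sum>(a, b)\<in>hecke_index. hecke_const a b * f (mat_act (hecke_rep a b) \<tau>))"

lemma hecke_sum_eq_f_mult:
  "\<tau> \<in> HH \<Longrightarrow> hecke_sum \<tau> = f \<tau> * (\<Sum>(a, b)\<in>hecke_index. hecke_ratio a b \<tau>)"
  using f_nonzero[of \<tau>] by (simp add: hecke_sum_def hecke_ratio_def sum_distrib_left case_prod_beta)

lemma transforms_hecke_sum: "transforms r hecke_sum"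
  unfolding transforms_def
proof (intro allI impI ballI)
  fix p q s t :: int and \<epsilon> \<tau> :: complex
  assume \<gamma>: "p * t - q * s = 1 \<and> int N dvd s \<and> (\<epsilon> = 1 \<or> \<epsilon> = -1)" and \<tau>: "\<tau> \<in> HH"
  then have G: "(p, q, s, t) \<in> Gamma0 N" by (simp add: Gamma0_def)
  then have "mat_act (p, q, s, t) \<tau> \<in> HH" using \<tau> mat_det_Gamma0[OF G] by (intro mat_act_in_HH) auto
  then have "hecke_sum (mat_act (p, q, s, t) \<tau>)
      = f (mat_act (p, q, s, t) \<tau>) * (\<Sum>(a, b)\<in>hecke_index. hecke_ratio a b \<tau>)"
    using sum_hecke_ratio_mat_act[OF G \<tau>] by (simp only: hecke_sum_eq_f_mult)
  then have "slash r hecke_sum p q s t \<epsilon> \<tau>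
      = slash r f p q s t \<epsilon> \<tau> * (\<Sum>(a, b)\<in>hecke_index. hecke_ratio a b \<tau>)"
    by (simp add: slash_def)
  also have "slash r f p q s t \<epsilon> \<tau> = chi r p q s t \<epsilon> * f \<tau>"
    using transforms_f \<gamma> \<tau> unfolding transforms_def by blast
  finally show "slash r hecke_sum p q s t \<epsilon> \<tau> = chi r p q s t \<epsilon> * hecke_sum \<tau>"
    using \<tau> by (simp add: hecke_sum_eq_f_mult)
qed

lemma holomorphic_f: "f holomorphic_on HH"
  by (rule holomorphic_eta_quot[OF zero_notin_supp])

lemma holomorphic_hecke_sum: "hecke_sum holomorphic_on HH"
  unfolding hecke_sum_def case_prod_beta
proof (intro holomorphic_intros)
  fix A assume A: "A \<in> hecke_index"
  obtain a b where ab: "A = (a, b)" by (cases A)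
  have "l div a > 0" "a dvd l" using hecke_index_D A by (auto simp: ab)
  then have "(f \<circ> mat_act (hecke_rep a b)) holomorphic_on HH"
    using hecke_rep_in_HH
    by (intro holomorphic_on_compose_gen[OF _ holomorphic_f])
       (auto intro!: holomorphic_intros simp: mat_act_hecke_rep[abs_def] simp del: of_nat_div)
  then show "(\<lambda>\<tau>. f (mat_act (hecke_rep (fst A) (snd A)) \<tau>)) holomorphic_on HH"
    by (simp add: ab comp_def)
qed

end

section \<open>Expansions at the cusps\<close>

definition qexp_with :: "nat \<Rightarrow> (nat \<Rightarrow> complex) \<Rightarrow> (complex \<Rightarrow> complex) \<Rightarrow> bool" where
  "qexp_with h co u \<longleftrightarrow> (\<forall>\<tau>\<in>HH. (\<lambda>m. co m * exp (2 * pi * \<i> * of_nat m * \<tau> / of_nat h)) sums u \<tau>)"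

definition has_qexp :: "bool \<Rightarrow> (complex \<Rightarrow> complex) \<Rightarrow> bool" where
  "has_qexp strict u \<longleftrightarrow> (\<exists>h>0. \<exists>co. (strict \<longrightarrow> co 0 = 0) \<and> qexp_with h co u)"

lemma has_qexpI: "h > 0 \<Longrightarrow> (strict \<longrightarrow> co 0 = 0) \<Longrightarrow> qexp_with h co u \<Longrightarrow> has_qexp strict u"
  unfolding has_qexp_def by blast

lemma has_qexpE:
  assumes "has_qexp strict u"
  obtains h co where "h > 0" "strict \<longrightarrow> co 0 = 0" "qexp_with h co u"
  using assms unfolding has_qexp_def by blast

lemma cusp_expansions_iff_has_qexp:
  "cusp_expansions strict r g \<longleftrightarrow>
     (\<forall>a b c d. a * d - b * c = 1 \<longrightarrow> has_qexp strict (slash r g a b c d 1))"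
  unfolding cusp_expansions_def has_qexp_def qexp_with_def ..

lemma has_qexp_cong: "(\<And>\<tau>. \<tau> \<in> HH \<Longrightarrow> u \<tau> = v \<tau>) \<Longrightarrow> has_qexp strict u \<longleftrightarrow> has_qexp strict v"
  unfolding has_qexp_def qexp_with_def by auto

definition dilate_coeffs :: "nat \<Rightarrow> (nat \<Rightarrow> complex) \<Rightarrow> nat \<Rightarrow> complex" where
  "dilate_coeffs k co m = (if k dvd m then co (m div k) else 0)"

lemma sums_dilate_coeffs:
  assumes "k > 0" "(\<lambda>m. co m * e (k * m)) sums s"
  shows "(\<lambda>m. dilate_coeffs k co m * e m) sums s"
proof -
  have "strict_mono (\<lambda>m. k * m)" using assms(1) by (simp add: strict_mono_def)
  moreover have "dilate_coeffs k co n * e n = 0" if "n \<notin> range (\<lambda>m. k * m)" for n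
    using that by (auto simp: dilate_coeffs_def image_iff dvd_def)
  ultimately show ?thesis
    using assms
    by (subst sums_mono_reindex[symmetric, where g = "\<lambda>m. k * m"]) (auto simp: dilate_coeffs_def)
qed

lemma qexp_with_dilate:
  assumes "k > 0" "qexp_with h co u"
  shows "qexp_with (h * k) (dilate_coeffs k co) u"
  unfolding qexp_with_def
proof
  fix \<tau> assume "\<tau> \<in> HH"
  then have "(\<lambda>m. co m * exp (2 * pi * \<i> * of_nat m * \<tau> / of_nat h)) sums u \<tau>"
    using assms(2) by (simp add: qexp_with_def)
  moreover have "2 * pi * \<i> * of_nat m * \<tau> / of_nat h
      = 2 * pi * \<i> * of_nat (k * m) * \<tau> / of_nat (h * k)" for m
    using assms(1) by simp
  ultimately have "(\<lambda>m. co m * exp (2 * pi * \<i> * of_nat (k * m) * \<tau> / of_nat (h * k))) sums u \<tau>"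
    by (simp only:)
  then show "(\<lambda>m. dilate_coeffs k co m * exp (2 * pi * \<i> * of_nat m * \<tau> / of_nat (h * k))) sums u \<tau>"
    by (rule sums_dilate_coeffs[OF assms(1)])
qed

lemma has_qexp_upper_triangular:
  assumes "has_qexp strict u" "a > 0" "d > 0"
  shows "has_qexp strict (\<lambda>\<tau>. u (mat_act (int a, int b, 0, int d) \<tau>))"
proof -
  obtain h co where h: "h > 0" "strict \<longrightarrow> co 0 = 0" "qexp_with h co u"
    by (rule has_qexpE[OF assms(1)])
  define co' where "co' m = co m * exp (2 * pi * \<i> * of_nat m * of_nat b / of_nat (d * h))" for m
  have "(\<lambda>m. dilate_coeffs a co' m * exp (2 * pi * \<i> * of_nat m * \<tau> / of_nat (d * h)))
      sums u (mat_act (int a, int b, 0, int d) \<tau>)" if \<tau>: "\<tau> \<in> HH" for \<tau>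
  proof (rule sums_dilate_coeffs[OF assms(2)])
    let ?\<sigma> = "mat_act (int a, int b, 0, int d) \<tau>"
    have "?\<sigma> \<in> HH" using assms \<tau> by (intro mat_act_in_HH) simp_all
    then have "(\<lambda>m. co m * exp (2 * pi * \<i> * of_nat m * ?\<sigma> / of_nat h)) sums u ?\<sigma>"
      using h(3) by (simp only: qexp_with_def)
    moreover have "co m * exp (2 * pi * \<i> * of_nat m * ?\<sigma> / of_nat h)
        = co' m * exp (2 * pi * \<i> * of_nat (a * m) * \<tau> / of_nat (d * h))" for m
    proof -
      have "2 * pi * \<i> * of_nat m * ?\<sigma> / of_nat h
          = 2 * pi * \<i> * of_nat m * of_nat b / of_nat (d * h)
          + 2 * pi * \<i> * of_nat (a * m) * \<tau> / of_nat (d * h)"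
        using h(1) assms by (simp add: field_simps)
      then show ?thesis unfolding co'_def by (simp only: exp_add mult.assoc)
    qed
    ultimately show "(\<lambda>m. co' m * exp (2 * pi * \<i> * of_nat (a * m) * \<tau> / of_nat (d * h))) sums u ?\<sigma>"
      by (simp only:)
  qed
  then have "qexp_with (d * h) (dilate_coeffs a co') (\<lambda>\<tau>. u (mat_act (int a, int b, 0, int d) \<tau>))"
    unfolding qexp_with_def by blast
  then show ?thesis
    using assms h by (intro has_qexpI[of "d * h"]) (auto simp: dilate_coeffs_def co'_def)
qed

lemma has_qexp_add:
  assumes "has_qexp strict u" "has_qexp strict v"
  shows "has_qexp strict (\<lambda>\<tau>. u \<tau> + v \<tau>)"
proof -
  obtain h co where h: "h > 0" "strict \<longrightarrow> co 0 = 0" "qexp_with h co u"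
    by (rule has_qexpE[OF assms(1)])
  obtain h' co' where h': "h' > 0" "strict \<longrightarrow> co' 0 = 0" "qexp_with h' co' v"
    by (rule has_qexpE[OF assms(2)])
  have "qexp_with (h * h') (dilate_coeffs h' co) u" "qexp_with (h * h') (dilate_coeffs h co') v"
    using qexp_with_dilate[OF h'(1) h(3)] qexp_with_dilate[OF h(1) h'(3)]
    by (simp_all add: mult.commute)
  then have "qexp_with (h * h') (\<lambda>m. dilate_coeffs h' co m + dilate_coeffs h co' m) (\<lambda>\<tau>. u \<tau> + v \<tau>)"
    by (simp add: qexp_with_def distrib_right sums_add)
  then show ?thesis using h h' by (intro has_qexpI[of "h * h'"]) (auto simp: dilate_coeffs_def)
qed

lemma has_qexp_cmult:
  assumes "has_qexp strict u"
  shows "has_qexp strict (\<lambda>\<tau>. k * u \<tau>)"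
proof -
  obtain h co where h: "h > 0" "strict \<longrightarrow> co 0 = 0" "qexp_with h co u"
    by (rule has_qexpE[OF assms])
  then have "qexp_with h (\<lambda>m. k * co m) (\<lambda>\<tau>. k * u \<tau>)"
    by (simp add: qexp_with_def mult.assoc sums_mult)
  then show ?thesis using h(1,2) by (intro has_qexpI[of h]) auto
qed

lemma has_qexp_sum:
  assumes "finite I" "\<And>i. i \<in> I \<Longrightarrow> has_qexp strict (u i)"
  shows "has_qexp strict (\<lambda>\<tau>. \<Sum>i\<in>I. u i \<tau>)"
  using assms
proof (induction I rule: finite_induct)
  case empty
  show ?case by (rule has_qexpI[of 1 _ "\<lambda>_. 0"]) (auto simp: qexp_with_def)
next
  case (insert i I)
  then show ?case by (simp add: has_qexp_add)
qed

lemma slash_conv_mat_act: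
  "slash r g a b c d 1 \<tau>
     = csqrt (mat_denom (a, b, c, d) \<tau>) powi (- wt2 r) * g (mat_act (a, b, c, d) \<tau>)"
  by (simp add: slash_def)

lemma has_qexp_slash_mat:
  assumes "cusp_expansions strict r g" "mat_det M > 0"
  shows "has_qexp strict (\<lambda>\<tau>. csqrt (mat_denom M \<tau>) powi (- wt2 r) * g (mat_act M \<tau>))"
proof -
  obtain \<gamma> a b d where \<gamma>: "\<gamma> \<in> Gamma0 1" and ad: "a > 0" "b < d"
    and M: "M = \<gamma> \<cdot> (int a, int b, 0, int d)"
    using hermite_form[OF assms(2)] .
  obtain p q s t where pqst: "\<gamma> = (p, q, s, t)" by (cases \<gamma>)
  let ?T = "(int a, int b, 0, int d)"
    and ?k = "complex_of_real (real d powr (of_int (- wt2 r) / 2))"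
  have "has_qexp strict (slash r g p q s t 1)"
    using assms(1) \<gamma> by (auto simp: cusp_expansions_iff_has_qexp Gamma0_def pqst)
  then have "has_qexp strict (\<lambda>\<tau>. ?k * slash r g p q s t 1 (mat_act ?T \<tau>))"
    using ad by (intro has_qexp_cmult has_qexp_upper_triangular) auto
  moreover have "csqrt (mat_denom M \<tau>) powi (- wt2 r) * g (mat_act M \<tau>)
      = ?k * slash r g p q s t 1 (mat_act ?T \<tau>)" if \<tau>: "\<tau> \<in> HH" for \<tau>
  proof -
    have "mat_denom M \<tau> = of_real (real d) * mat_denom \<gamma> (mat_act ?T \<tau>)"
      using mat_denom_mult[of ?T \<tau> \<gamma>] ad by (simp add: M)
    then have "csqrt (mat_denom M \<tau>) powi (- wt2 r)
        = ?k * csqrt (mat_denom \<gamma> (mat_act ?T \<tau>)) powi (- wt2 r)"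
      using csqrt_of_real_mult_powi[of "real d"] ad by (simp only: of_nat_0_less_iff)
    moreover have "mat_act M \<tau> = mat_act \<gamma> (mat_act ?T \<tau>)"
      unfolding M using \<tau> ad mat_det_Gamma0[OF \<gamma>] by (intro mat_act_mult) simp_all
    ultimately show ?thesis unfolding slash_conv_mat_act pqst by (simp only: mult.assoc)
  qed
  ultimately show ?thesis by (simp cong: has_qexp_cong)
qed

context eta_hecke_form
begin

lemma has_qexp_hecke_summand:
  assumes "(a, b) \<in> hecke_index" "\<gamma> \<in> Gamma0 1" "cusp_expansions strict r f"
  shows "has_qexp strict (\<lambda>\<tau>. csqrt (mat_denom \<gamma> \<tau>) powi (- wt2 r)
     * f (mat_act (hecke_rep a b) (mat_act \<gamma> \<tau>)))"
proof -
  note ab = hecke_index_D[OF assms(1)]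
  let ?d = "real (l div a)" and ?M = "hecke_rep a b \<cdot> \<gamma>"
  have dets: "mat_det (hecke_rep a b) > 0" "mat_det \<gamma> > 0"
    using mat_det_hecke_rep[OF ab(1)] mat_det_Gamma0[OF assms(2)] l_pos by simp_all
  have "has_qexp strict (\<lambda>\<tau>. of_real (?d powr (of_int (wt2 r) / 2))
      * (csqrt (mat_denom ?M \<tau>) powi (- wt2 r) * f (mat_act ?M \<tau>)))"
    using dets by (intro has_qexp_cmult has_qexp_slash_mat assms(3)) (simp add: mat_det_mult)
  moreover have "csqrt (mat_denom \<gamma> \<tau>) powi (- wt2 r) * f (mat_act (hecke_rep a b) (mat_act \<gamma> \<tau>))
      = of_real (?d powr (of_int (wt2 r) / 2))
        * (csqrt (mat_denom ?M \<tau>) powi (- wt2 r) * f (mat_act ?M \<tau>))"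
    if \<tau>: "\<tau> \<in> HH" for \<tau>
  proof -
    have "mat_denom ?M \<tau> = of_real ?d * mat_denom \<gamma> \<tau>"
      using mat_denom_mult[OF mat_denom_nonzero[OF \<tau>], of \<gamma> "hecke_rep a b"] dets(2)
      by (simp add: hecke_rep_def del: of_nat_div mat_mult.simps)
    then have "csqrt (mat_denom ?M \<tau>) powi (- wt2 r)
        = of_real (?d powr (of_int (- wt2 r) / 2)) * csqrt (mat_denom \<gamma> \<tau>) powi (- wt2 r)"
      using csqrt_of_real_mult_powi[of ?d] ab(6) by (simp only: of_nat_0_less_iff)
    moreover have
      "of_real (?d powr (of_int (wt2 r) / 2)) * of_real (?d powr (of_int (- wt2 r) / 2))
        = (1 :: complex)"
      using ab(6)
      by (simp add: minus_divide_left[symmetric] powr_minus flip: of_real_mult del: of_nat_div)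
    ultimately show ?thesis
      using mat_act_mult[OF \<tau> dets] by (simp only: mult.assoc[symmetric] mult_1_left)
  qed
  ultimately show ?thesis by (simp cong: has_qexp_cong)
qed

lemma cusp_expansions_hecke_sum:
  assumes "cusp_expansions strict r f"
  shows "cusp_expansions strict r hecke_sum"
  unfolding cusp_expansions_iff_has_qexp
proof (intro allI impI)
  fix p q s t :: int
  assume "p * t - q * s = 1"
  then have "(p, q, s, t) \<in> Gamma0 1" by (simp add: Gamma0_def)
  then have "has_qexp strict (\<lambda>\<tau>. \<Sum>A\<in>hecke_index. hecke_const (fst A) (snd A)
      * (csqrt (mat_denom (p, q, s, t) \<tau>) powi (- wt2 r)
         * f (mat_act (hecke_rep (fst A) (snd A)) (mat_act (p, q, s, t) \<tau>))))"
    using assms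
    by (intro has_qexp_sum finite_hecke_index has_qexp_cmult has_qexp_hecke_summand) auto
  moreover have "(\<Sum>A\<in>hecke_index. hecke_const (fst A) (snd A)
      * (csqrt (mat_denom (p, q, s, t) \<tau>) powi (- wt2 r)
         * f (mat_act (hecke_rep (fst A) (snd A)) (mat_act (p, q, s, t) \<tau>))))
      = slash r hecke_sum p q s t 1 \<tau>" for \<tau>
    unfolding slash_conv_mat_act hecke_sum_def
    by (simp add: sum_distrib_left case_prod_beta mult_ac del: mat_act.simps mat_denom.simps)
  ultimately show "has_qexp strict (slash r hecke_sum p q s t 1)" by simp
qed

end

section \<open>Fourier coefficients of the Hecke sum\<close>

lemma of_real_add_i_in_HH: "of_real t + \<i> \<in> HH"
  by (simp add: HH_def)

lemma dim_eq_1_imp_multiple: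
  assumes "dim_eq_1 V" "V f" "V g" "\<tau>0 \<in> HH" "f \<tau>0 \<noteq> 0"
  obtains c where "\<And>\<tau>. \<tau> \<in> HH \<Longrightarrow> g \<tau> = c * f \<tau>"
proof -
  obtain u where u: "\<And>h. V h \<Longrightarrow> \<exists>c. \<forall>\<tau>\<in>HH. h \<tau> = c * u \<tau>"
    using assms(1) unfolding dim_eq_1_def by blast
  obtain cf cg where multiples: "\<forall>\<tau>\<in>HH. f \<tau> = cf * u \<tau>" "\<forall>\<tau>\<in>HH. g \<tau> = cg * u \<tau>"
    using u[OF assms(2)] u[OF assms(3)] by blast
  then have "cf \<noteq> 0" using assms(4,5) by auto
  then have "g \<tau> = (cg / cf) * f \<tau>" if "\<tau> \<in> HH" for \<tau> using multiples that by simp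
  then show ?thesis using that by blast
qed

context eta_hecke_form
begin

abbreviation period :: real where
  "period \<equiv> 24 * real l"

definition hecke_coeff :: "real \<Rightarrow> complex" where
  "hecke_coeff n = (\<Sum>(a, b)\<in>hecke_index.
     hecke_const a b * (cf r (real l * n / (real a)\<^sup>2) * ee (n * real b / real a)))"

lemma integral_f:
  assumes "n = of_int (xN r) / 24 + of_int j"
  shows "integral {0..period} (\<lambda>t. f (of_real t + \<i>) * fourier_kernel n t)
    = of_real period * cf r n"
proof -
  have "period * ((of_int (xN r) / 24 + real i) * 1 - n) = of_int (24 * int l * (int i - j))" for i
    unfolding assms by (simp add: algebra_simps)
  then have "period * ((of_int (xN r) / 24 + real i) * 1 - n) \<in> \<int>" for i
    by (metis Ints_of_int)
  from integral_eta_quot_affine[OF zero_notin_supp _ _ this, of 0] l_pos show ?thesis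
    by simp
qed

lemma integral_f_hecke_rep:
  assumes "(a, b) \<in> hecke_index" "n = of_int (xN r) / 24 + of_int j"
  shows "integral {0..period} (\<lambda>t. f (mat_act (hecke_rep a b) (of_real t + \<i>)) * fourier_kernel n t)
    = of_real period * (cf r (real l * n / (real a)\<^sup>2) * ee (n * real b / real a))"
proof -
  note ab = hecke_index_D[OF assms(1)]
  define d where "d = l div a"
  have l: "real l = real a * real d" unfolding d_def using ab(7) by (metis of_nat_mult)
  have pos: "real a > 0" "real d > 0" using ab by (simp_all add: d_def)
  have act: "mat_act (hecke_rep a b) (of_real t + \<i>)
      = of_real (real a / real d) * (of_real t + \<i>) + of_real (real b / real d)" for t
    by (simp add: mat_act_hecke_rep add_divide_distrib flip: d_def)
  have integral_exponent:
    "period * ((of_int (xN r) / 24 + real i) * (real a / real d) - n) \<in> \<int>" for i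
  proof -
    have "period * ((of_int (xN r) / 24 + real i) * (real a / real d) - n)
        = of_int ((xN r + 24 * int i) * int a * int a - int l * (xN r + 24 * j))"
      unfolding assms(2) using pos l by (simp add: field_simps)
    then show ?thesis by (metis Ints_of_int)
  qed
  have "integral {0..period} (\<lambda>t. f (mat_act (hecke_rep a b) (of_real t + \<i>)) * fourier_kernel n t)
      = of_real period
        * (cf r (n / (real a / real d)) * ee (n / (real a / real d) * (real b / real d)))"
    unfolding act
    by (rule integral_eta_quot_affine[OF zero_notin_supp _ _ integral_exponent])
       (use pos l_pos in simp_all)
  moreover have "n / (real a / real d) = real l * n / (real a)\<^sup>2"
    using pos l by (simp add: power2_eq_square)
  moreover have "n / (real a / real d) * (real b / real d) = n * real b / real a" using pos by simp
  ultimately show ?thesis by (simp only:)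
qed

lemma integrable_f_hecke_rep:
  assumes "(a, b) \<in> hecke_index"
  shows "(\<lambda>t. f (mat_act (hecke_rep a b) (of_real t + \<i>)) * fourier_kernel n t)
    integrable_on {0..L}"
proof -
  note ab = hecke_index_D[OF assms]
  have "continuous_on {0..L} (\<lambda>t. f (mat_act (hecke_rep a b) (of_real t + \<i>)))"
  proof (rule continuous_on_compose2[OF holomorphic_on_imp_continuous_on[OF holomorphic_f]])
    show "continuous_on {0..L} (\<lambda>t. mat_act (hecke_rep a b) (of_real t + \<i>))"
      unfolding mat_act_hecke_rep using ab(6) by (intro continuous_intros) auto
    show "(\<lambda>t. mat_act (hecke_rep a b) (of_real t + \<i>)) ` {0..L} \<subseteq> HH"
      using hecke_rep_in_HH[OF ab(1) of_real_add_i_in_HH] by blast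
  qed
  moreover have "continuous_on {0..L} (fourier_kernel n)"
    unfolding fourier_kernel_def by (intro continuous_intros)
  ultimately show ?thesis by (intro integrable_continuous_interval continuous_on_mult)
qed

lemma integral_hecke_sum:
  assumes "n = of_int (xN r) / 24 + of_int j"
  shows "integral {0..period} (\<lambda>t. hecke_sum (of_real t + \<i>) * fourier_kernel n t)
    = of_real period * hecke_coeff n"
proof -
  let ?F = "\<lambda>a b t. f (mat_act (hecke_rep a b) (of_real t + \<i>)) * fourier_kernel n t"
  have "integral {0..period} (\<lambda>t. hecke_sum (of_real t + \<i>) * fourier_kernel n t)
      = integral {0..period}
          (\<lambda>t. \<Sum>A\<in>hecke_index. hecke_const (fst A) (snd A) * ?F (fst A) (snd A) t)"
    unfolding hecke_sum_def by (simp only: case_prod_beta sum_distrib_right mult.assoc)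
  also have "\<dots> = (\<Sum>A\<in>hecke_index.
    integral {0..period} (\<lambda>t. hecke_const (fst A) (snd A) * ?F (fst A) (snd A) t))"
    using integrable_f_hecke_rep
    by (intro integral_sum finite_hecke_index integrable_on_mult_right) auto
  also have "\<dots> = (\<Sum>A\<in>hecke_index.
    hecke_const (fst A) (snd A) * integral {0..period} (?F (fst A) (snd A)))"
    by (simp only: integral_mult_right)
  also have "\<dots> = of_real period * hecke_coeff n"
    unfolding hecke_coeff_def sum_distrib_left
    by (intro sum.cong refl)
       (auto simp only: split_paired_all prod.case fst_conv snd_conv
         integral_f_hecke_rep[OF _ assms] mult.left_commute)
  finally show ?thesis .
qed

lemma hecke_coeff_eq:
  assumes "\<And>\<tau>. \<tau> \<in> HH \<Longrightarrow> hecke_sum \<tau> = c * f \<tau>" "n = of_int (xN r) / 24 + of_int j"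
  shows "hecke_coeff n = c * cf r n"
proof -
  have "of_real period * hecke_coeff n
      = integral {0..period} (\<lambda>t. c * (f (of_real t + \<i>) * fourier_kernel n t))"
    unfolding integral_hecke_sum[OF assms(2), symmetric]
    by (simp only: assms(1)[OF of_real_add_i_in_HH] mult.assoc)
  also have "\<dots> = of_real period * (c * cf r n)"
    unfolding integral_mult_right integral_f[OF assms(2)] by (simp only: mult_ac)
  finally show ?thesis using l_pos by simp
qed

definition hecke_term :: "real \<Rightarrow> nat \<Rightarrow> nat \<Rightarrow> complex" where
  "hecke_term n a b = of_int (kronecker (int a) (varpi r)) * of_real (real a powr wt r)
     * cf r (real l * n / (real a)\<^sup>2)
     * (of_int (kronecker (- int N * int b) (int (gcd a (l div a)))) powi wt2 r
        * ee (real b * real (l div a) * (n / real l - of_int (xN r) / 24)) * psi r l a b)"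

lemma hecke_lhs_conv_hecke_term:
  "hecke_lhs r l n
     = of_real (real l powr (- wt r / 2)) * (\<Sum>(a, b)\<in>hecke_index. hecke_term n a b)"
  unfolding hecke_lhs_def Let_def sum_distrib_left[of "_ * cf r _"] hecke_index_Sigma hecke_term_def
  by (subst sum.Sigma[OF finite_divisors_l]) auto

lemma hecke_term_eq:
  assumes "(a, b) \<in> hecke_index"
  shows "of_real (real l powr (- wt r / 2)) * hecke_term n a b
    = of_real (real l powr (wt r / 2))
      * (hecke_const a b * (cf r (real l * n / (real a)\<^sup>2) * ee (n * real b / real a)))"
proof -
  note ab = hecke_index_D[OF assms]
  define d where "d = l div a"
  have l: "real l = real a * real d" unfolding d_def using ab(7) by (metis of_nat_mult)
  have pos: "real a > 0" "real d > 0" using ab by (simp_all add: d_def)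
  have "real l powr (- wt r / 2) = real l powr (wt r / 2) * real l powr (- wt r)"
    using l_pos by (simp flip: powr_add)
  then have "real l powr (- wt r / 2) * real a powr wt r
      = real l powr (wt r / 2) * real d powr (- wt r)"
    using pos unfolding l by (simp add: powr_mult powr_minus field_simps)
  then have powr: "of_real (real l powr (- wt r / 2)) * of_real (real a powr wt r)
      = of_real (real l powr (wt r / 2)) * (of_real (real d powr (- wt r)) :: complex)"
    unfolding of_real_mult[symmetric] by (rule arg_cong)
  have "real b * real d * (n / real l - of_int (xN r) / 24)
      = - (real b * real d * of_int (xN r) / 24) + n * real b / real a"
    using pos l by (simp add: field_simps)
  then have phase: "ee (real b * real d * (n / real l - of_int (xN r) / 24))
      = ee (- (real b * real d * of_int (xN r) / 24)) * ee (n * real b / real a)"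
    by (simp only: ee_add)
  define C where "C = of_int (kronecker (int a) (varpi r))
      * of_int (kronecker (- int N * int b) (int (gcd a d))) powi wt2 r
      * ee (- (real b * real d * of_int (xN r) / 24)) * psi r l a b"
  define D where "D = cf r (real l * n / (real a)\<^sup>2) * ee (n * real b / real a)"
  have "(of_real (real l powr (- wt r / 2)) * of_real (real a powr wt r)) * C * D
      = of_real (real l powr (wt r / 2)) * (C * of_real (real d powr (- wt r)) * D)"
    unfolding powr by (simp only: mult_ac)
  then show ?thesis
    unfolding hecke_term_def hecke_const_def hecke_weight_def d_def[symmetric] phase C_def D_def
    by (simp only: mult_ac)
qed

lemma hecke_lhs_eq: "hecke_lhs r l n = of_real (real l powr (wt r / 2)) * hecke_coeff n"
  unfolding hecke_lhs_conv_hecke_term hecke_coeff_def sum_distrib_left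
  by (intro sum.cong refl) (auto simp only: hecke_term_eq split: prod.split)

lemma MF_hecke_sum: "MF r f \<Longrightarrow> MF r hecke_sum" and SF_hecke_sum: "SF r f \<Longrightarrow> SF r hecke_sum"
  using holomorphic_hecke_sum transforms_hecke_sum cusp_expansions_hecke_sum
  by (auto simp: MF_def SF_def)

lemma hecke_sum_multiple:
  assumes "weakly_admissible r"
  obtains c where "\<And>\<tau>. \<tau> \<in> HH \<Longrightarrow> hecke_sum \<tau> = c * f \<tau>"
proof -
  obtain V where "dim_eq_1 V" "V f" "V hecke_sum"
    using assms MF_hecke_sum SF_hecke_sum unfolding weakly_admissible_def by blast
  moreover have "f \<i> \<noteq> 0" "\<i> \<in> HH" using f_nonzero[of \<i>] by (simp_all add: HH_def)
  ultimately show ?thesis using dim_eq_1_imp_multiple that by blast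
qed

lemma hecke_lhs_multiple:
  assumes "weakly_admissible r"
  obtains c where "\<And>j n. n = of_int (xN r) / 24 + of_int j \<Longrightarrow> hecke_lhs r l n = c * cf r n"
proof -
  obtain c where "\<And>\<tau>. \<tau> \<in> HH \<Longrightarrow> hecke_sum \<tau> = c * f \<tau>"
    using hecke_sum_multiple[OF assms] by blast
  then have "hecke_lhs r l n = (of_real (real l powr (wt r / 2)) * c) * cf r n"
    if "n = of_int (xN r) / 24 + of_int j" for j n
    using hecke_coeff_eq that by (simp add: hecke_lhs_eq)
  then show ?thesis using that by blast
qed

end

theorem theorem9p19:
  fixes r :: "nat \<Rightarrow> int" and l :: nat
  assumes "finite (supp r)"
    and "0 \<notin> supp r"
    and "weakly_admissible r"
    and "l \<in> Lf r"
  shows "(\<exists>!c. \<forall>n. (\<exists>m::int. n = real_of_int (xN r) / 24 + real_of_int m) \<longrightarrow>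
                 hecke_lhs r l n = c * cf r n)
       \<and> (\<forall>c. (\<forall>n. (\<exists>m::int. n = real_of_int (xN r) / 24 + real_of_int m) \<longrightarrow>
                 hecke_lhs r l n = c * cf r n)
              \<longrightarrow> c = hecke_lhs r l (real_of_int (xN r) / 24))"
proof -
  interpret eta_hecke_form r l
    using assms by unfold_locales (auto simp: weakly_admissible_def MF_def)
  define eigenvalue where "eigenvalue c \<longleftrightarrow>
      (\<forall>n. (\<exists>m::int. n = real_of_int (xN r) / 24 + real_of_int m) \<longrightarrow>
        hecke_lhs r l n = c * cf r n)" for c
  obtain c where "eigenvalue c"
    using hecke_lhs_multiple[OF assms(3)] unfolding eigenvalue_def by metis
  moreover have "c' = hecke_lhs r l (real_of_int (xN r) / 24)" if "eigenvalue c'" for c'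
  proof -
    have "\<exists>m::int. real_of_int (xN r) / 24 = real_of_int (xN r) / 24 + real_of_int m"
      by (rule exI[of _ 0]) simp
    then have "hecke_lhs r l (real_of_int (xN r) / 24) = c' * cf r (real_of_int (xN r) / 24)"
      using that unfolding eigenvalue_def by blast
    then show ?thesis using cf_xN[OF assms(2)] by simp
  qed
  ultimately show ?thesis unfolding eigenvalue_def[symmetric] by metis
qed

end
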